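(* Let $\mathbf U$ be a smooth physical field on the computational domain and consider a uniformly refined set of quadrilateral meshes $\{M_h\}$. Let the nodal velocities $\tilde{\mathbf v}$ and half-edge pressures $\widetilde P$ on $M_h$ be given by the jump condition and the balance condition described in the context. Then the resulting numerical flux has 4th order accuracy $\mathcal O(h^4)$ at each cell edge: for every cell $\omega^i$ and every edge $\overline{\boldsymbol x^i_r\boldsymbol x^i_{r+1}}$ of it, with $\mathbf n=\mathbf n^i_{r,r+1}$, $\mathbf F_M-\mathbf F_S=\mathcal O(h^4)$, where $$\mathbf F_M=\begin{bmatrix}-\frac12(\tilde{\mathbf v}^i_r+\tilde{\mathbf v}^i_{r+1})\cdot\mathbf n\\[2pt]\frac12\big(\widetilde P^i_{r,r+\frac12}+\widetilde P^i_{r+\frac12,r+1}\big)\mathbf n\\[2pt]\frac12\big(\widetilde P^i_{r,r+\frac12}\tilde{\mathbf v}^i_r+\widetilde P^i_{r+\frac12,r+1}\tilde{\mathbf v}^i_{r+1}\big)\cdot\mathbf n\end{bmatrix}$$ is the numerical flux and $$\mathbf F_S=\begin{bmatrix}-\big(\frac16\mathbf v^i_r+\frac23\mathbf v^i_{r+\frac12}+\frac16\mathbf v^i_{r+1}\big)\cdot\mathbf n\\[2pt]\big(\frac16P^i_r+\frac23P^i_{r+\frac12}+\frac16P^i_{r+1}\big)\mathbf n\\[2pt]\big(\frac16P^i_r\mathbf v^i_r+\frac23P^i_{r+\frac12}\mathbf v^i_{r+\frac12}+\frac16P^i_{r+1}\mathbf v^i_{r+1}\big)\cdot\mathbf n\end{bmatrix}$$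 is the Simpson's rule value, a 4th-order accurate approximation of the exact Lagrangian flux (the average of $(-\mathbf v\cdot\mathbf n,\;P\mathbf n,\;P\mathbf v\cdot\mathbf n)$ over the edge).
   Context: Field. $\mathbf U=(\rho,\rho\mathbf v,\rho E)$ is the state of an ideal gas with density $\rho$, velocity $\mathbf v\in\mathbb R^2$, total energy $E$ and pressure $P=\rho(\gamma-1)(E-\frac12|\mathbf v|^2)$, where $\gamma$ is the specific heat ratio; $\alpha=\rho c$ is the acoustic impedance, with $c$ the sound speed. Meshes. $M_h$ has nodes $\boldsymbol x_{k,l}=\boldsymbol\phi(kh,lh)$, $k,l\in\mathbb Z$, where $\boldsymbol\phi:\mathbb R^2\to\mathbb R^2$ is a fixed smooth homeomorphism; its cells are the straight-edged quadrilaterals with vertices $\boldsymbol x_{k,l},\boldsymbol x_{k+1,l},\boldsymbol x_{k+1,l+1},\boldsymbol x_{k,l+1}$. $\mathcal O(h^p)$ is meant as $h\to0^+$. Notation. A cell $\omega^i$ has vertices $\boldsymbol x^i_1,\dots,\boldsymbol x^i_4$ in counterclockwise order (indices mod 4), $\boldsymbol x^i_{r+\frac12}=\frac12(\boldsymbol x^i_r+\boldsymbol x^i_{r+1})$, and $\mathbf n^i_{r,r+1}$ is the unit outward normal of the edge $\overline{\boldsymbol x^i_r\boldsymbol x^i_{r+1}}$. The inputs of the solver are the values of the smooth field: $\mathbf v^i_r=\mathbf v(\boldsymbol x^i_r)$, $\mathbf v^i_{r+\frac12}=\mathbf v(\boldsymbol x^i_{r+\frac12})$, and likewise for $P$ and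 $\alpha$. Each node $\boldsymbol x$ carries a single nodal velocity $\tilde{\mathbf v}(\boldsymbol x)$, and $\tilde{\mathbf v}^i_r=\tilde{\mathbf v}(\boldsymbol x^i_r)$. Half edges. $\mathcal E(\boldsymbol x)$ is the set of half edges (from a node to the midpoint of an edge) with the node $\boldsymbol x$ as a vertex. Each $e\in\mathcal E(\boldsymbol x)$ is written $e=\overline{\boldsymbol x^i_r\boldsymbol x^i_{r+\frac12}}=\overline{\boldsymbol x^j_{k-\frac12}\boldsymbol x^j_k}\subset\omega^i\cap\omega^j$ with $\boldsymbol x=\boldsymbol x^i_r=\boldsymbol x^j_k$; $L_e$ is its length, $\mathbf n_e=\mathbf n^i_{r,r+1}=-\mathbf n^j_{k-1,k}$, $\widetilde P_{e+}=\widetilde P^i_{r,r+\frac12}$, $\widetilde P_{e-}=\widetilde P^j_{k-\frac12,k}$. Jump condition. $$\widetilde P^i_{r,r+\frac12}=\Big(\tfrac13P^i_r+\tfrac23P^i_{r+\frac12}+\alpha^i_{r+\frac12}w^i_{r+\frac12}\Big)-\Big(\tfrac13\alpha^i_r+\tfrac23\alpha^i_{r+\frac12}\Big)(\tilde{\mathbf v}^i_r-\mathbf v^i_r)\cdot\mathbf n^i_{r,r+1},$$ $$\widetilde P^j_{k-\frac12,k}=\Big(\tfrac13P^j_k+\tfrac23P^j_{k-\frac12}+\alpha^j_{k-\frac12}w^j_{k-\frac12}\Big)-\Big(\tfrac13\alpha^j_k+\tfrac23\alpha^j_{k-\frac12}\Big)(\tilde{\mathbf v}^i_r-\mathbf v^j_k)\cdot\mathbf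 n^j_{k-1,k},$$ where $w^i_{r+\frac12}=\frac23(\mathbf v^i_{r+\frac12}-\frac12\mathbf v^i_r-\frac12\mathbf v^i_{r+1})\cdot\mathbf n^i_{r,r+1}$ and $w^j_{k-\frac12}=\frac23(\mathbf v^j_{k-\frac12}-\frac12\mathbf v^j_k-\frac12\mathbf v^j_{k-1})\cdot\mathbf n^j_{k-1,k}$. Balance condition. For every node $\boldsymbol x$, $\sum_{e\in\mathcal E(\boldsymbol x)}L_e(\widetilde P_{e+}-\widetilde P_{e-})\mathbf n_e=\boldsymbol0$. The nodal velocity $\tilde{\mathbf v}(\boldsymbol x)$ is obtained by substituting the jump condition into the balance condition and solving the resulting $2\times2$ linear system.
   Formalization: The smooth homeomorphism φ is required to have a smooth inverse (nonvanishing Jacobian), since the claim fails e.g. for φ(x,y)=(x+y,y³); O(h^4) is uniform over edges starting in any given compact set. *)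

theory Defs
  imports "HOL-Analysis.Analysis"
begin

section \<open>Smooth maps\<close>

text \<open>
  \<open>Ck n f\<close>: \<open>f\<close> is \<open>n\<close> times continuously differentiable on the whole space.  Since the
  derivative of \<open>f\<close> lives in another type, the recursion goes through all directional
  derivatives; in finite dimension this is the usual notion.
\<close>

primrec Ck :: "nat \<Rightarrow> ('a::euclidean_space \<Rightarrow> 'b::real_normed_vector) \<Rightarrow> bool" where
  "Ck 0 f \<longleftrightarrow> continuous_on UNIV f"
| "Ck (Suc n) f \<longleftrightarrow>
     (\<forall>x. f differentiable (at x)) \<and> (\<forall>d. Ck n (\<lambda>x. frechet_derivative f (at x) d))"

definition smooth :: "('a::euclidean_space \<Rightarrow> 'b::real_normed_vector) \<Rightarrow> bool" where
  "smooth f \<longleftrightarrow> (\<forall>n. Ck n f)"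

section \<open>The ideal gas\<close>

text \<open>A state is a triple (density, momentum, total energy per unit volume).\<close>

type_synonym state = "real \<times> (real^2) \<times> real"

definition density :: "state \<Rightarrow> real" where
  "density u = fst u"

definition velocity :: "state \<Rightarrow> real^2" where
  "velocity u = fst (snd u) /\<^sub>R density u"

definition energy :: "state \<Rightarrow> real" where
  "energy u = snd (snd u) / density u"

definition pressure :: "real \<Rightarrow> state \<Rightarrow> real" where
  "pressure \<gamma> u = density u * (\<gamma> - 1) * (energy u - 1/2 * (norm (velocity u))\<^sup>2)"

definition sound_speed :: "real \<Rightarrow> state \<Rightarrow> real" where
  "sound_speed \<gamma> u = sqrt (\<gamma> * pressure \<gamma> u / density u)"

definition impedance :: "real \<Rightarrow> state \<Rightarrow> real" where
  "impedance \<gamma> u = density u * sound_speed \<gamma> u"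

definition physical_field :: "real \<Rightarrow> (real^2 \<Rightarrow> state) \<Rightarrow> bool" where
  "physical_field \<gamma> U \<longleftrightarrow> (\<forall>x. density (U x) > 0 \<and> pressure \<gamma> (U x) > 0)"

section \<open>The meshes\<close>

definition node :: "(real^2 \<Rightarrow> real^2) \<Rightarrow> real \<Rightarrow> int \<Rightarrow> int \<Rightarrow> real^2" where
  "node \<phi> h k l = \<phi> (vector [of_int k * h, of_int l * h])"

definition nodes :: "(real^2 \<Rightarrow> real^2) \<Rightarrow> real \<Rightarrow> (real^2) set" where
  "nodes \<phi> h = {node \<phi> h k l | k l. True}"

type_synonym cell = "int \<times> int"

text \<open>
  The cell \<open>(k, l)\<close> has the corners \<open>(k, l)\<close>, \<open>(k+1, l)\<close>, \<open>(k+1, l+1)\<close>, \<open>(k, l+1)\<close>, numbered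
  \<open>0, 1, 2, 3\<close> modulo 4.
\<close>

definition corner :: "(real^2 \<Rightarrow> real^2) \<Rightarrow> real \<Rightarrow> cell \<Rightarrow> nat \<Rightarrow> real^2" where
  "corner \<phi> h i r =
     node \<phi> h (fst i + (if r mod 4 \<in> {1, 2} then 1 else 0))
              (snd i + (if r mod 4 \<in> {2, 3} then 1 else 0))"

definition signed_area :: "(real^2 \<Rightarrow> real^2) \<Rightarrow> real \<Rightarrow> cell \<Rightarrow> real" where
  "signed_area \<phi> h i =
     1/2 * (\<Sum>r<4. corner \<phi> h i r $ 1 * corner \<phi> h i (Suc r) $ 2
                 - corner \<phi> h i r $ 2 * corner \<phi> h i (Suc r) $ 1)"

text \<open>
  The vertices in counterclockwise order: the mesh map may reverse the orientation, and then the
  corners above are listed clockwise and have to be enumerated backwards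
  (\<open>3 * r\<close> is \<open>- r\<close> modulo 4).
\<close>

definition vertex :: "(real^2 \<Rightarrow> real^2) \<Rightarrow> real \<Rightarrow> cell \<Rightarrow> nat \<Rightarrow> real^2" where
  "vertex \<phi> h i r = corner \<phi> h i (if signed_area \<phi> h i > 0 then r else 3 * r)"

text \<open>
  For a polygon traversed counterclockwise, the outward normal of an edge is the direction of the
  edge rotated by a right angle clockwise.
\<close>

definition right_normal :: "real^2 \<Rightarrow> real^2 \<Rightarrow> real^2" where
  "right_normal a b = vector [(b - a) $ 2, - ((b - a) $ 1)] /\<^sub>R dist a b"

definition edge_normal :: "(real^2 \<Rightarrow> real^2) \<Rightarrow> real \<Rightarrow> cell \<Rightarrow> nat \<Rightarrow> real^2" where
  "edge_normal \<phi> h i r = right_normal (vertex \<phi> h i r) (vertex \<phi> h i (Suc r))"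

text \<open>
  An element \<open>(i, r, j, s)\<close> of \<open>half_edges \<phi> h x\<close> stands for the half edge from the node \<open>x\<close> to
  the midpoint of the edge that is the edge from vertex \<open>r\<close> to vertex \<open>r + 1\<close> of cell \<open>i\<close> and,
  traversed in the opposite direction, the edge from vertex \<open>s\<close> to vertex \<open>s + 1\<close> of cell \<open>j\<close>.
  So \<open>x\<close> is vertex \<open>r\<close> of \<open>i\<close> and vertex \<open>k = s + 1\<close> of \<open>j\<close>.
\<close>

definition half_edges ::
    "(real^2 \<Rightarrow> real^2) \<Rightarrow> real \<Rightarrow> real^2 \<Rightarrow> (cell \<times> nat \<times> cell \<times> nat) set" where
  "half_edges \<phi> h x =
     {(i, r, j, s). r < 4 \<and> s < 4 \<and>
        vertex \<phi> h i r = x \<and> vertex \<phi> h j (Suc s) = x \<and>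
        vertex \<phi> h i (Suc r) = vertex \<phi> h j s}"

section \<open>The nodal solver\<close>

text \<open>
  Pressure prescribed by the jump condition on the half edge from the node \<open>a\<close> to the midpoint of
  the edge joining \<open>a\<close> and \<open>b\<close>, seen from a cell with outward normal \<open>n\<close>, if \<open>V\<close> is the nodal
  velocity at \<open>a\<close>.
\<close>

definition jump_pressure ::
    "real \<Rightarrow> (real^2 \<Rightarrow> state) \<Rightarrow> real^2 \<Rightarrow> real^2 \<Rightarrow> real^2 \<Rightarrow> real^2 \<Rightarrow> real" where
  "jump_pressure \<gamma> U a b n V =
    (let m = midpoint a b;
         v = \<lambda>x. velocity (U x);
         P = \<lambda>x. pressure \<gamma> (U x);
         \<alpha> = \<lambda>x. impedance \<gamma> (U x);
         w = 2/3 * ((v m - (1/2) *\<^sub>R v a - (1/2) *\<^sub>R v b) \<bullet> n)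
     in (1/3 * P a + 2/3 * P m + \<alpha> m * w) - (1/3 * \<alpha> a + 2/3 * \<alpha> m) * ((V - v a) \<bullet> n))"

text \<open>
  Below, \<open>vt x\<close> is the velocity of the node \<open>x\<close>, and \<open>PA i r\<close> and \<open>PB i r\<close> are the pressures
  in cell \<open>i\<close> on the first and on the second half of its edge from vertex \<open>r\<close> to vertex \<open>r + 1\<close>,
  that is, those with the subscripts \<open>r, r + 1/2\<close> and \<open>r + 1/2, r + 1\<close>, for \<open>r < 4\<close>.
\<close>

definition jump_condition ::
    "real \<Rightarrow> (real^2 \<Rightarrow> state) \<Rightarrow> (real^2 \<Rightarrow> real^2) \<Rightarrow> real \<Rightarrow> (real^2 \<Rightarrow> real^2) \<Rightarrow>
     (cell \<Rightarrow> nat \<Rightarrow> real) \<Rightarrow> (cell \<Rightarrow> nat \<Rightarrow> real) \<Rightarrow> bool" where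
  "jump_condition \<gamma> U \<phi> h vt PA PB \<longleftrightarrow>
     (\<forall>x\<in>nodes \<phi> h. \<forall>(i, r, j, s)\<in>half_edges \<phi> h x.
        PA i r = jump_pressure \<gamma> U (vertex \<phi> h i r) (vertex \<phi> h i (Suc r))
                   (edge_normal \<phi> h i r) (vt x) \<and>
        PB j s = jump_pressure \<gamma> U (vertex \<phi> h j (Suc s)) (vertex \<phi> h j s)
                   (edge_normal \<phi> h j s) (vt x))"

definition balance_condition ::
    "(real^2 \<Rightarrow> real^2) \<Rightarrow> real \<Rightarrow> (cell \<Rightarrow> nat \<Rightarrow> real) \<Rightarrow> (cell \<Rightarrow> nat \<Rightarrow> real) \<Rightarrow> bool" where
  "balance_condition \<phi> h PA PB \<longleftrightarrow>
     (\<forall>x\<in>nodes \<phi> h.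
        (\<Sum>(i, r, j, s)\<in>half_edges \<phi> h x.
           (dist x (midpoint (vertex \<phi> h i r) (vertex \<phi> h i (Suc r))) * (PA i r - PB j s))
             *\<^sub>R edge_normal \<phi> h i r) = 0)"

section \<open>Fluxes through the edge from vertex \<open>r\<close> to vertex \<open>r + 1\<close> of a cell\<close>

type_synonym flux = "real \<times> (real^2) \<times> real"

definition numerical_flux ::
    "(real^2 \<Rightarrow> real^2) \<Rightarrow> real \<Rightarrow> (real^2 \<Rightarrow> real^2) \<Rightarrow>
     (cell \<Rightarrow> nat \<Rightarrow> real) \<Rightarrow> (cell \<Rightarrow> nat \<Rightarrow> real) \<Rightarrow> cell \<Rightarrow> nat \<Rightarrow> flux" where
  "numerical_flux \<phi> h vt PA PB i r =
    (let a = vertex \<phi> h i r; b = vertex \<phi> h i (Suc r); n = edge_normal \<phi> h i r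
     in (- (((1/2) *\<^sub>R (vt a + vt b)) \<bullet> n),
         (1/2 * (PA i r + PB i r)) *\<^sub>R n,
         ((1/2) *\<^sub>R (PA i r *\<^sub>R vt a + PB i r *\<^sub>R vt b)) \<bullet> n))"

definition simpson_flux ::
    "real \<Rightarrow> (real^2 \<Rightarrow> state) \<Rightarrow> (real^2 \<Rightarrow> real^2) \<Rightarrow> real \<Rightarrow> cell \<Rightarrow> nat \<Rightarrow> flux" where
  "simpson_flux \<gamma> U \<phi> h i r =
    (let a = vertex \<phi> h i r; b = vertex \<phi> h i (Suc r); m = midpoint a b;
         n = edge_normal \<phi> h i r;
         v = \<lambda>x. velocity (U x);
         P = \<lambda>x. pressure \<gamma> (U x)
     in (- (((1/6) *\<^sub>R v a + (2/3) *\<^sub>R v m + (1/6) *\<^sub>R v b) \<bullet> n),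
         (1/6 * P a + 2/3 * P m + 1/6 * P b) *\<^sub>R n,
         ((1/6 * P a) *\<^sub>R v a + (2/3 * P m) *\<^sub>R v m + (1/6 * P b) *\<^sub>R v b) \<bullet> n))"

definition exact_flux ::
    "real \<Rightarrow> (real^2 \<Rightarrow> state) \<Rightarrow> (real^2 \<Rightarrow> real^2) \<Rightarrow> real \<Rightarrow> cell \<Rightarrow> nat \<Rightarrow> flux" where
  "exact_flux \<gamma> U \<phi> h i r =
    (let a = vertex \<phi> h i r; b = vertex \<phi> h i (Suc r); n = edge_normal \<phi> h i r
     in integral {0..1} (\<lambda>t. let u = U (linepath a b t) in
          (- (velocity u \<bullet> n), pressure \<gamma> u *\<^sub>R n, (pressure \<gamma> u *\<^sub>R velocity u) \<bullet> n)))"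

section \<open>Order of accuracy\<close>

text \<open>
  The constant is uniform over all edges that start in a given compact set; over the whole
  unbounded mesh there are no uniform bounds on the data.
\<close>

definition edge_error_order ::
    "nat \<Rightarrow> (real^2 \<Rightarrow> real^2) \<Rightarrow> (real \<Rightarrow> cell \<Rightarrow> nat \<Rightarrow> flux) \<Rightarrow> bool" where
  "edge_error_order p \<phi> err \<longleftrightarrow>
     (\<forall>K. compact K \<longrightarrow>
        (\<exists>C. \<forall>\<^sub>F h in at_right 0. \<forall>i. \<forall>r<4. vertex \<phi> h i r \<in> K \<longrightarrow> norm (err h i r) \<le> C * h ^ p))"

end

theory Submission
  imports Defs
begin

text \<open>
  Let \<open>h\<close> be half the mesh size.  Every quantity attached to an edge is a function of the parameter
  point \<open>q\<close> at the centre of the edge and of \<open>h\<close>, even in \<open>h\<close>.  Let \<open>D(q)\<close> be the vector whose normal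
  components on the two edges centred at \<open>q\<close> are exactly \<open>2/3 (v_mid - (v_a + v_b)/2) \<bullet> n\<close>; it is
  \<open>O(h^2)\<close>, with second differences \<open>O(h^4)\<close>.  Inserting \<open>v + D\<close> into the balance at a node \<open>p\<close>, the half
  edges in opposite directions contribute \<open>f(p + h u) + f(p - h u) = 2 f(p) + O(h^4)\<close>, and
  \<open>f(p) = O(h^4)\<close> by the choice of \<open>D\<close>; as the balance is uniformly coercive in the nodal velocity, the
  latter equals \<open>v + D + O(h^4)\<close>.  On an edge centred at \<open>q\<close>, \<open>D(q + h u) + D(q - h u) = 2 D(q) + O(h^4)\<close>
  then gives Simpson's rule for the velocity, and the other two components follow from symmetric
  expansions about \<open>q\<close>.
\<close>

section \<open>Smooth maps\<close>

text \<open>Fourth order seems to ask for long expansions of all quantities, unit normals and edge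
  lengths included. Second differences suffice, because the terms that matter are already small: a
  family carries an order p together with first differences of order p + 1 and second differences of
  order p + 2, and this triple survives products and, for positive families of order 0 away from
  zero, reciprocals and square roots. Each error term then becomes a product whose orders add up to
  at least four, such as a second difference of the impedance times a deviation of size
  \<open>O(h^2)\<close>.

  Two obstacles shape the rest. Unit normals are quotients that degenerate at \<open>h = 0\<close>,
  so chords are divided by \<open>h\<close>; their lengths and cross products stay away from zero
  because the mesh map has a smooth inverse, hence an injective derivative. And the numbering of the
  vertices depends on the sign of the area of each cell, which is controlled only for small
  \<open>h\<close> over bounded regions; nodes whose surrounding cells are not yet known to be well
  oriented get a harmless artificial deviation, so that all families live on the whole parameter
  plane.\<close>

text \<open>Uniqueness of the Frechet derivative allows any candidate \<open>f'\<close> to stand in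
  for \<open>frechet_derivative\<close>, which the definition of \<open>Ck\<close> mentions.\<close>

lemma Ck_SucI:
  assumes "\<And>x. (f has_derivative f' x) (at x)" "\<And>d. Ck n (\<lambda>x. f' x d)"
  shows "Ck (Suc n) f"
proof -
  have "frechet_derivative f (at x) = f' x" for x
    using frechet_derivative_at[OF assms(1)] by simp
  with assms show ?thesis by (auto simp: differentiable_def)
qed

lemma Ck_SucE:
  assumes "Ck (Suc n) f"
  obtains f' where "\<And>x. (f has_derivative f' x) (at x)" "\<And>d. Ck n (\<lambda>x. f' x d)"
  using assms that[of "\<lambda>x. frechet_derivative f (at x)"] frechet_derivative_works by auto

lemma Ck_SucD: "Ck (Suc n) f \<Longrightarrow> Ck n f"
proof (induction n arbitrary: f)
  case 0
  then show ?case
    by (auto intro!: continuous_at_imp_continuous_on differentiable_imp_continuous_within)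
next
  case (Suc n)
  then show ?case by simp
qed

lemma Ck_const: "Ck n (\<lambda>x. c)"
  by (induction n arbitrary: c) (auto intro!: Ck_SucI[where f'="\<lambda>x d. 0"] derivative_eq_intros)

lemma Ck_bounded_linear:
  assumes "bounded_linear L" shows "Ck n L"
proof (cases n)
  case 0
  then show ?thesis using assms by (simp add: linear_continuous_on)
next
  case (Suc m)
  show ?thesis
    unfolding Suc using assms
    by (intro Ck_SucI[where f'="\<lambda>x. L"] Ck_const bounded_linear_imp_has_derivative)
qed

lemma Ck_linear_compose:
  assumes "bounded_linear L" shows "Ck n f \<Longrightarrow> Ck n (\<lambda>x. L (f x))"
proof (induction n arbitrary: f)
  case 0
  then show ?case
    using bounded_linear.continuous_on[OF assms] by simp
next
  case (Suc n)
  then obtain f' where f': "\<And>x. (f has_derivative f' x) (at x)" "\<And>d. Ck n (\<lambda>x. f' x d)"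
    using Ck_SucE by blast
  show ?case
    by (rule Ck_SucI[where f'="\<lambda>x d. L (f' x d)"])
      (auto intro: bounded_linear.has_derivative[OF assms] f' Suc.IH)
qed

lemma Ck_add: "Ck n f \<Longrightarrow> Ck n g \<Longrightarrow> Ck n (\<lambda>x. f x + g x)"
proof (induction n arbitrary: f g)
  case 0
  then show ?case by (auto intro: continuous_intros)
next
  case (Suc n)
  obtain f' where f': "\<And>x. (f has_derivative f' x) (at x)" "\<And>d. Ck n (\<lambda>x. f' x d)"
    using Suc.prems Ck_SucE by blast
  obtain g' where g': "\<And>x. (g has_derivative g' x) (at x)" "\<And>d. Ck n (\<lambda>x. g' x d)"
    using Suc.prems Ck_SucE by blast
  show ?case
    by (rule Ck_SucI[where f'="\<lambda>x d. f' x d + g' x d"])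
      (auto intro!: derivative_eq_intros f' g' Suc.IH)
qed

lemma Ck_sum: "finite I \<Longrightarrow> (\<And>i. i \<in> I \<Longrightarrow> Ck n (f i)) \<Longrightarrow> Ck n (\<lambda>x. \<Sum>i\<in>I. f i x)"
  by (induction I rule: finite_induct) (auto intro: Ck_const Ck_add)

lemma Ck_bilinear:
  assumes "bounded_bilinear bop"
  shows "Ck n f \<Longrightarrow> Ck n g \<Longrightarrow> Ck n (\<lambda>x. bop (f x) (g x))"
proof (induction n arbitrary: f g)
  case 0
  then show ?case by (auto intro: bounded_bilinear.continuous_on[OF assms])
next
  case (Suc n)
  obtain f' where f': "\<And>x. (f has_derivative f' x) (at x)" "\<And>d. Ck n (\<lambda>x. f' x d)"
    using Suc.prems Ck_SucE by blast
  obtain g' where g': "\<And>x. (g has_derivative g' x) (at x)" "\<And>d. Ck n (\<lambda>x. g' x d)"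
    using Suc.prems Ck_SucE by blast
  show ?case
    by (rule Ck_SucI[where f'="\<lambda>x d. bop (f x) (g' x d) + bop (f' x d) (g x)"])
      (auto intro!: bounded_bilinear.FDERIV[OF assms] f' g' Suc.IH Ck_add
        intro: Ck_SucD Suc.prems)
qed

lemma Ck_compose:
  fixes g :: "'a::euclidean_space \<Rightarrow> 'b::euclidean_space"
  shows "Ck n f \<Longrightarrow> Ck n g \<Longrightarrow> Ck n (\<lambda>x. f (g x))"
proof (induction n arbitrary: f)
  case 0
  then show ?case by (auto intro: continuous_on_compose2)
next
  case (Suc n)
  obtain f' where f': "\<And>x. (f has_derivative f' x) (at x)" "\<And>d. Ck n (\<lambda>x. f' x d)"
    using Suc.prems Ck_SucE by blast
  obtain g' where g': "\<And>x. (g has_derivative g' x) (at x)" "\<And>d. Ck n (\<lambda>x. g' x d)"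
    using Suc.prems Ck_SucE by blast
  \<comment> \<open>In the chain rule the direction \<open>g' x d\<close> varies with
    \<open>x\<close>, while regularity of \<open>f'\<close> is known for fixed directions only.
    Expanding in the basis leaves fixed directions with scalar coefficients.\<close>
  have "f' (g x) (g' x d) = (\<Sum>b\<in>Basis. (g' x d \<bullet> b) *\<^sub>R f' (g x) b)" for x d
    using bounded_linear.linear[OF has_derivative_bounded_linear[OF f'(1)]]
    by (subst euclidean_representation[of "g' x d", symmetric]) (simp only: linear_sum linear_scale)
  moreover have "Ck n (\<lambda>x. \<Sum>b\<in>Basis. (g' x d \<bullet> b) *\<^sub>R f' (g x) b)" for d
    by (intro Ck_sum Ck_bilinear[OF bounded_bilinear_scaleR] Suc.IH f'(2) Ck_SucD[OF Suc.prems(2)]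
        Ck_linear_compose[OF bounded_linear_inner_left] g'(2)) auto
  ultimately have "Ck n (\<lambda>x. f' (g x) (g' x d))" for d by simp
  then show ?case
    by (intro Ck_SucI[where f'="\<lambda>x d. f' (g x) (g' x d)"] has_derivative_compose[OF g'(1) f'(1)])
qed

lemma Ck_inverse:
  fixes f :: "'a::euclidean_space \<Rightarrow> real"
  assumes "\<And>x. f x \<noteq> 0"
  shows "Ck n f \<Longrightarrow> Ck n (\<lambda>x. inverse (f x))"
proof (induction n)
  case 0
  then show ?case using assms by (auto intro: continuous_intros)
next
  case (Suc n)
  obtain f' where f': "\<And>x. (f has_derivative f' x) (at x)" "\<And>d. Ck n (\<lambda>x. f' x d)"
    using Suc.prems Ck_SucE by blast
  \<comment> \<open>The derivative of the reciprocal is a product of the reciprocal itself and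
    \<open>f'\<close>, so the induction hypothesis supplies its regularity.\<close>
  have "Ck n (\<lambda>x. inverse (f x))" using Suc.IH Suc.prems Ck_SucD by blast
  then have "Ck n (\<lambda>x. - (inverse (f x) * f' x d * inverse (f x)))" for d
    by (intro Ck_linear_compose[OF bounded_linear_minus[OF bounded_linear_ident]]
        Ck_bilinear[OF bounded_bilinear_mult] f')
  then show ?case
    by (intro Ck_SucI[where f'="\<lambda>x d. - (inverse (f x) * f' x d * inverse (f x))"]
        Deriv.has_derivative_inverse assms f')
qed

lemma Ck_sqrt:
  fixes f :: "'a::euclidean_space \<Rightarrow> real"
  assumes "\<And>x. f x > 0"
  shows "Ck n f \<Longrightarrow> Ck n (\<lambda>x. sqrt (f x))"
proof (induction n)
  case 0
  then show ?case by (auto intro: continuous_intros)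
next
  case (Suc n)
  obtain f' where f': "\<And>x. (f has_derivative f' x) (at x)" "\<And>d. Ck n (\<lambda>x. f' x d)"
    using Suc.prems Ck_SucE by blast
  have pos: "sqrt (f x) \<noteq> 0" for x using assms[of x] by simp
  have "Ck n (\<lambda>x. sqrt (f x))" using Suc.IH Suc.prems Ck_SucD by blast
  then have "Ck n (\<lambda>x. f' x d * (inverse (sqrt (f x)) * (1/2)))" for d
    by (intro Ck_bilinear[OF bounded_bilinear_mult] f' Ck_inverse pos Ck_const)
  moreover have "((\<lambda>x. sqrt (f x)) has_derivative (\<lambda>d. f' x d * (inverse (sqrt (f x)) * (1/2)))) (at x)"
    for x
    using assms[of x] by (auto intro!: derivative_eq_intros f' simp: field_simps)
  ultimately show ?case by (intro Ck_SucI)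
qed

lemma smooth_const: "smooth (\<lambda>x. c)"
  by (simp add: smooth_def Ck_const)

lemma smooth_bounded_linear: "bounded_linear L \<Longrightarrow> smooth L"
  by (simp add: smooth_def Ck_bounded_linear)

lemma smooth_linear_compose: "bounded_linear L \<Longrightarrow> smooth f \<Longrightarrow> smooth (\<lambda>x. L (f x))"
  by (simp add: smooth_def Ck_linear_compose)

lemma smooth_add: "smooth f \<Longrightarrow> smooth g \<Longrightarrow> smooth (\<lambda>x. f x + g x)"
  by (simp add: smooth_def Ck_add)

lemma smooth_bilinear:
  "bounded_bilinear bop \<Longrightarrow> smooth f \<Longrightarrow> smooth g \<Longrightarrow> smooth (\<lambda>x. bop (f x) (g x))"
  by (simp add: smooth_def Ck_bilinear)

lemma smooth_compose:
  fixes g :: "'a::euclidean_space \<Rightarrow> 'b::euclidean_space"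
  shows "smooth f \<Longrightarrow> smooth g \<Longrightarrow> smooth (\<lambda>x. f (g x))"
  by (auto simp: smooth_def intro: Ck_compose)

lemma smooth_inverse:
  fixes f :: "'a::euclidean_space \<Rightarrow> real"
  shows "(\<And>x. f x \<noteq> 0) \<Longrightarrow> smooth f \<Longrightarrow> smooth (\<lambda>x. inverse (f x))"
  by (auto simp: smooth_def intro: Ck_inverse)

lemma smooth_sqrt:
  fixes f :: "'a::euclidean_space \<Rightarrow> real"
  shows "(\<And>x. f x > 0) \<Longrightarrow> smooth f \<Longrightarrow> smooth (\<lambda>x. sqrt (f x))"
  by (auto simp: smooth_def intro: Ck_sqrt)

lemmas smooth_scaleR = smooth_bilinear[OF bounded_bilinear_scaleR]
  and smooth_mult = smooth_bilinear[OF bounded_bilinear_mult]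
  and smooth_inner = smooth_bilinear[OF bounded_bilinear_inner]
  and smooth_cscaleR = smooth_linear_compose[OF bounded_linear_scaleR_right]

lemma smooth_minus: "smooth f \<Longrightarrow> smooth (\<lambda>x. - f x)"
  by (rule smooth_linear_compose[OF bounded_linear_minus[OF bounded_linear_ident]])

lemma smooth_diff: "smooth f \<Longrightarrow> smooth g \<Longrightarrow> smooth (\<lambda>x. f x - g x)"
  using smooth_add[OF _ smooth_minus] by force

section \<open>Smooth maps along lines, local bounds and the mean value inequality\<close>

lemma smooth_deriv:
  assumes "smooth f" shows "smooth (\<lambda>x. frechet_derivative f (at x) d)"
  unfolding smooth_def
proof
  fix n show "Ck n (\<lambda>x. frechet_derivative f (at x) d)"
    using assms[unfolded smooth_def, rule_format, of "Suc n"] by simp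
qed

lemma smooth_has_derivative:
  assumes "smooth f" shows "(f has_derivative frechet_derivative f (at x)) (at x)"
  using assms[unfolded smooth_def, rule_format, of "Suc 0"] frechet_derivative_works by auto

lemma smooth_continuous_on: "smooth f \<Longrightarrow> continuous_on S f"
  using Ck.simps(1) continuous_on_subset smooth_def by blast

lemma smooth_bounded_on:
  assumes "smooth f" "compact S"
  obtains C where "C \<ge> 0" "\<And>x. x \<in> S \<Longrightarrow> norm (f x) \<le> C"
proof -
  have "bounded (f ` S)"
    using assms by (intro compact_imp_bounded compact_continuous_image smooth_continuous_on)
  then obtain C where "\<And>x. x \<in> S \<Longrightarrow> norm (f x) \<le> C"
    by (auto simp: bounded_iff)
  then show thesis using that[of "max 0 C"] by (metis max.cobounded1 max.coboundedI2)
qed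

lemma smooth_has_vector_derivative_line:
  assumes "smooth f"
  shows "((\<lambda>t. f (x + t *\<^sub>R d)) has_vector_derivative frechet_derivative f (at (x + t *\<^sub>R d)) d) (at t within S)"
proof -
  have "((\<lambda>t. x + t *\<^sub>R d) has_vector_derivative d) (at t within S)"
    by (auto intro!: derivative_eq_intros)
  then have "((\<lambda>t. x + t *\<^sub>R d) has_derivative (\<lambda>h. h *\<^sub>R d)) (at t within S)"
    by (simp add: has_vector_derivative_def)
  from has_derivative_compose[OF this smooth_has_derivative[OF assms]]
  show ?thesis
    using linear_scale[OF bounded_linear.linear[OF has_derivative_bounded_linear[OF
          smooth_has_derivative[OF assms]]]]
    by (simp add: has_vector_derivative_def)
qed

text \<open>The mean value inequality in the form in which every Taylor estimate below uses it:
  integrating once from a zero gains one factor \<open>s\<close>.\<close>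

lemma zero_start_bound:
  fixes f :: "real \<Rightarrow> 'a::real_normed_vector"
  assumes "0 \<le> s" "f 0 = 0"
    and "\<And>x. x \<in> {0..s} \<Longrightarrow> (f has_vector_derivative f' x) (at x within {0..s})"
    and "\<And>x. x \<in> {0..s} \<Longrightarrow> norm (f' x) \<le> M"
  shows "norm (f s) \<le> M * s"
proof -
  have "onorm (\<lambda>h. h *\<^sub>R f' x) \<le> M" if "x \<in> {0..s}" for x
    using assms(4)[OF that] by (intro onorm_bound) (auto intro: order_trans[OF norm_ge_zero]
      simp: mult.commute[of M] intro!: mult_left_mono)
  then have "norm (f s - f 0) \<le> M * norm (s - 0)"
    by (intro differentiable_bound[where f'="\<lambda>x h. h *\<^sub>R f' x" and S="{0..s}"])
      (use assms in \<open>auto simp: has_vector_derivative_def\<close>)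
  with assms show ?thesis by simp
qed

section \<open>Calculus of orders in the mesh size\<close>

text \<open>In the applications to the mesh, \<open>q\<close> is a point of the parameter plane of
  the mesh map, not of physical space, and ranges over all points rather than grid points only. Both
  the constant and the threshold for \<open>h\<close> may depend on the ball.\<close>

definition Oh :: "nat \<Rightarrow> (real \<Rightarrow> 'a::euclidean_space \<Rightarrow> 'b::real_normed_vector) \<Rightarrow> bool" where
  "Oh p F \<longleftrightarrow> (\<forall>R. \<exists>C. \<forall>\<^sub>F h in at_right 0. \<forall>q\<in>cball 0 R. norm (F h q) \<le> C * h ^ p)"

lemma OhI:
  assumes "\<And>R. R > 0 \<Longrightarrow> \<exists>C. \<forall>\<^sub>F h in at_right 0. \<forall>q\<in>cball 0 R. norm (F h q) \<le> C * h ^ p"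
  shows "Oh p F"
  unfolding Oh_def
proof
  fix R :: real
  obtain C where "\<forall>\<^sub>F h in at_right 0. \<forall>q\<in>cball 0 (max R 1). norm (F h q) \<le> C * h ^ p"
    using assms[of "max R 1"] by fastforce
  then have "\<forall>\<^sub>F h in at_right 0. \<forall>q\<in>cball 0 R. norm (F h q) \<le> C * h ^ p"
    by (rule eventually_mono) auto
  then show "\<exists>C. \<forall>\<^sub>F h in at_right 0. \<forall>q\<in>cball 0 R. norm (F h q) \<le> C * h ^ p" ..
qed

lemma OhE:
  assumes "Oh p F"
  obtains C where "C \<ge> 0" "\<forall>\<^sub>F h in at_right 0. \<forall>q\<in>cball 0 R. norm (F h q) \<le> C * h ^ p"
proof -
  obtain C where C: "\<forall>\<^sub>F h in at_right 0. \<forall>q\<in>cball 0 R. norm (F h q) \<le> C * h ^ p"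
    using assms by (auto simp: Oh_def)
  have "\<forall>\<^sub>F h in at_right (0::real). \<forall>q\<in>cball 0 R. norm (F h q) \<le> max 0 C * h ^ p"
    using C eventually_at_right_less[of 0]
  proof eventually_elim
    case (elim h)
    then have "C * h ^ p \<le> max 0 C * h ^ p" by (intro mult_right_mono) auto
    with elim show ?case by (meson order_trans)
  qed
  then show thesis by (intro that[of "max 0 C"]) auto
qed

lemma eventually_at_right_0_less: "a > 0 \<Longrightarrow> \<forall>\<^sub>F h in at_right (0::real). 0 < h \<and> h < a"
  using eventually_at_right_real[of 0 a] by (simp add: greaterThanLessThan_iff)

lemma Oh_dominate:
  assumes "Oh p F"
    and "\<And>R. R > 0 \<Longrightarrow> \<forall>\<^sub>F h in at_right 0. \<forall>q\<in>cball 0 R. norm (G h q) \<le> norm (F h q)"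
  shows "Oh p G"
proof (rule OhI)
  fix R :: real assume "R > 0"
  obtain C where "\<forall>\<^sub>F h in at_right 0. \<forall>q\<in>cball 0 R. norm (F h q) \<le> C * h ^ p"
    using OhE[OF assms(1)] by blast
  then have "\<forall>\<^sub>F h in at_right 0. \<forall>q\<in>cball 0 R. norm (G h q) \<le> C * h ^ p"
    using assms(2)[OF \<open>R > 0\<close>] by eventually_elim force
  then show "\<exists>C. \<forall>\<^sub>F h in at_right 0. \<forall>q\<in>cball 0 R. norm (G h q) \<le> C * h ^ p" ..
qed

lemma Oh_cong:
  assumes "Oh p F"
    and "\<And>R. R > 0 \<Longrightarrow> \<forall>\<^sub>F h in at_right 0. \<forall>q\<in>cball 0 R. G h q = F h q"
  shows "Oh p G"
  by (rule Oh_dominate[OF assms(1)], rule eventually_mono[OF assms(2)]) auto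

lemma Oh_zero: "Oh p (\<lambda>h q. 0)"
  by (rule OhI) (auto intro!: exI[of _ 0])

lemma Oh_add:
  assumes "Oh p F" "Oh p G" shows "Oh p (\<lambda>h q. F h q + G h q)"
proof (rule OhI)
  fix R :: real
  obtain C where C: "\<forall>\<^sub>F h in at_right 0. \<forall>q\<in>cball 0 R. norm (F h q) \<le> C * h ^ p"
    using OhE[OF assms(1)] by blast
  obtain D where D: "\<forall>\<^sub>F h in at_right 0. \<forall>q\<in>cball 0 R. norm (G h q) \<le> D * h ^ p"
    using OhE[OF assms(2)] by blast
  from C D have "\<forall>\<^sub>F h in at_right 0. \<forall>q\<in>cball 0 R. norm (F h q + G h q) \<le> (C + D) * h ^ p"
    by eventually_elim (auto simp: distrib_right intro: norm_triangle_mono)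
  then show "\<exists>C. \<forall>\<^sub>F h in at_right 0. \<forall>q\<in>cball 0 R. norm (F h q + G h q) \<le> C * h ^ p" ..
qed

lemma Oh_bilinear:
  fixes F :: "real \<Rightarrow> 'a::euclidean_space \<Rightarrow> 'b::real_normed_vector"
  assumes "bounded_bilinear bop" "Oh p F" "Oh r G" "n = p + r"
  shows "Oh n (\<lambda>h q. bop (F h q) (G h q))"
proof (rule OhI)
  fix R :: real
  obtain K where K: "K > 0" "\<And>a b. norm (bop a b) \<le> norm a * norm b * K"
    using bounded_bilinear.pos_bounded[OF assms(1)] by blast
  obtain C where C: "C \<ge> 0" "\<forall>\<^sub>F h in at_right 0. \<forall>q\<in>cball 0 R. norm (F h q) \<le> C * h ^ p"
    using OhE[OF assms(2)] by blast
  obtain D where D: "D \<ge> 0" "\<forall>\<^sub>F h in at_right 0. \<forall>q\<in>cball 0 R. norm (G h q) \<le> D * h ^ r"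
    using OhE[OF assms(3)] by blast
  have "\<forall>\<^sub>F h in at_right 0. \<forall>q\<in>cball 0 R. norm (bop (F h q) (G h q)) \<le> (C * D * K) * h ^ n"
    using C(2) D(2) eventually_at_right_less[of "0::real"]
  proof eventually_elim
    case (elim h)
    show ?case
    proof
      fix q :: 'a assume "q \<in> cball 0 R"
      then have "norm (F h q) * norm (G h q) \<le> (C * h ^ p) * (D * h ^ r)"
        using elim C D by (intro mult_mono) auto
      then have "norm (F h q) * norm (G h q) * K \<le> (C * h ^ p) * (D * h ^ r) * K"
        using K by (intro mult_right_mono) auto
      with K(2) show "norm (bop (F h q) (G h q)) \<le> (C * D * K) * h ^ n"
        by (force simp: assms(4) power_add mult_ac elim: order_trans[rotated])
    qed
  qed
  then show "\<exists>C. \<forall>\<^sub>F h in at_right 0. \<forall>q\<in>cball 0 R. norm (bop (F h q) (G h q)) \<le> C * h ^ n" ..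
qed

lemma Oh_const: "Oh 0 (\<lambda>h q. c)"
  by (rule OhI) (auto intro!: exI[of _ "norm c"])

lemma Oh_mono:
  assumes "Oh p F" "r \<le> p" shows "Oh r F"
proof (rule OhI)
  fix R :: real
  obtain C where C: "C \<ge> 0" "\<forall>\<^sub>F h in at_right 0. \<forall>q\<in>cball 0 R. norm (F h q) \<le> C * h ^ p"
    using OhE[OF assms(1)] by blast
  have "\<forall>\<^sub>F h in at_right 0. \<forall>q\<in>cball 0 R. norm (F h q) \<le> C * h ^ r"
    using C(2) eventually_at_right_0_less[OF zero_less_one]
  proof eventually_elim
    case (elim h)
    then have "C * h ^ p \<le> C * h ^ r"
      using C assms(2) by (intro mult_left_mono power_decreasing) auto
    with elim show ?case by force
  qed
  then show "\<exists>C. \<forall>\<^sub>F h in at_right 0. \<forall>q\<in>cball 0 R. norm (F h q) \<le> C * h ^ r" ..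
qed

lemma Oh_scaleR:
  assumes "Oh p F" shows "Oh p (\<lambda>h q. c *\<^sub>R F h q)"
  using Oh_bilinear[OF bounded_bilinear_scaleR Oh_const assms] by simp

lemma Oh_minus: "Oh p F \<Longrightarrow> Oh p (\<lambda>h q. - F h q)"
  using Oh_scaleR[of p F "-1"] by simp

lemma Oh_diff: "Oh p F \<Longrightarrow> Oh p G \<Longrightarrow> Oh p (\<lambda>h q. F h q - G h q)"
  using Oh_add[OF _ Oh_minus] by force

lemma Oh_sum: "finite I \<Longrightarrow> (\<And>i. i \<in> I \<Longrightarrow> Oh p (F i)) \<Longrightarrow> Oh p (\<lambda>h q. \<Sum>i\<in>I. F i h q)"
  by (induction I rule: finite_induct) (auto intro: Oh_zero Oh_add)

lemma eventually_shift:
  fixes c :: "'a::euclidean_space"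
  assumes "\<forall>\<^sub>F h in at_right 0. \<forall>q\<in>cball 0 (R + 1). P h q"
  shows "\<forall>\<^sub>F h in at_right 0. \<forall>q\<in>cball 0 R. P h (q + h *\<^sub>R c)"
proof -
  \<comment> \<open>Below this step size the shift by \<open>h *\<^sub>R c\<close> has length at
    most 1, which is why the radius is enlarged by 1; the summand 1 in the denominator covers
    \<open>c = 0\<close>.\<close>
  have "1 / (norm c + 1) > 0" by (simp add: add_nonneg_pos)
  from assms eventually_at_right_0_less[OF this] show ?thesis
  proof eventually_elim
    case (elim h)
    have "q + h *\<^sub>R c \<in> cball 0 (R + 1)" if "q \<in> cball 0 R" for q
    proof -
      have "norm (h *\<^sub>R c) = h * norm c" using elim by simp
      also have "\<dots> \<le> h * (norm c + 1)" using elim by (intro mult_left_mono) auto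
      also have "\<dots> \<le> 1" using elim by (simp add: pos_less_divide_eq add_nonneg_pos less_imp_le)
      finally show ?thesis using that norm_triangle_ineq[of q "h *\<^sub>R c"] by simp
    qed
    with elim show ?case by blast
  qed
qed

lemma Oh_shift:
  assumes "Oh p F" shows "Oh p (\<lambda>h q. F h (q + h *\<^sub>R c))"
proof (rule OhI)
  fix R :: real
  obtain C where "\<forall>\<^sub>F h in at_right 0. \<forall>q\<in>cball 0 (R + 1). norm (F h q) \<le> C * h ^ p"
    using OhE[OF assms(1)] by blast
  from eventually_shift[OF this]
  show "\<exists>C. \<forall>\<^sub>F h in at_right 0. \<forall>q\<in>cball 0 R. norm (F h (q + h *\<^sub>R c)) \<le> C * h ^ p" ..
qed

lemma Oh_shift_minus:
  assumes "Oh p F" shows "Oh p (\<lambda>h q. F h (q - h *\<^sub>R c))"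
  using Oh_shift[OF assms, of "- c"] by simp

lemma Oh_divide_step:
  assumes "Oh (p + k) F" shows "Oh p (\<lambda>h q. F h q /\<^sub>R h ^ k)"
proof (rule OhI)
  fix R :: real
  obtain C where C: "\<forall>\<^sub>F h in at_right 0. \<forall>q\<in>cball 0 R. norm (F h q) \<le> C * h ^ (p + k)"
    using OhE[OF assms(1)] by blast
  have "\<forall>\<^sub>F h in at_right 0. \<forall>q\<in>cball 0 R. norm (F h q /\<^sub>R h ^ k) \<le> C * h ^ p"
    using C eventually_at_right_less[of "0::real"]
    by eventually_elim (auto simp: power_add field_simps)
  then show "\<exists>C. \<forall>\<^sub>F h in at_right 0. \<forall>q\<in>cball 0 R. norm (F h q /\<^sub>R h ^ k) \<le> C * h ^ p" ..
qed

section \<open>Families that stay locally uniformly away from zero\<close>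

definition bounded_below :: "(real \<Rightarrow> 'a::euclidean_space \<Rightarrow> real) \<Rightarrow> bool" where
  "bounded_below F \<longleftrightarrow>
     (\<forall>R>0. \<exists>c>0. \<forall>\<^sub>F h in at_right 0. \<forall>q\<in>cball 0 R. c \<le> F h q)"

lemma bounded_belowD:
  "bounded_below F \<Longrightarrow> R > 0 \<Longrightarrow> \<exists>c>0. \<forall>\<^sub>F h in at_right 0. \<forall>q\<in>cball 0 R. c \<le> F h q"
  by (simp add: bounded_below_def)

lemma bounded_below_pos:
  assumes "bounded_below F" "R > 0"
  shows "\<forall>\<^sub>F h in at_right 0. \<forall>q\<in>cball 0 R. 0 < F h q"
proof -
  obtain c where "c > 0" "\<forall>\<^sub>F h in at_right 0. \<forall>q\<in>cball 0 R. c \<le> F h q"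
    using bounded_belowD[OF assms] by blast
  then show ?thesis by (auto elim!: eventually_mono)
qed

lemma bounded_below_shift:
  assumes "bounded_below F" shows "bounded_below (\<lambda>h q. F h (q + h *\<^sub>R c))"
  unfolding bounded_below_def
proof (intro allI impI)
  fix R :: real assume "R > 0"
  then obtain d where "d > 0" "\<forall>\<^sub>F h in at_right 0. \<forall>q\<in>cball 0 (R + 1). d \<le> F h q"
    using bounded_belowD[OF assms, of "R + 1"] by auto
  with eventually_shift[OF this(2)]
  show "\<exists>d>0. \<forall>\<^sub>F h in at_right 0. \<forall>q\<in>cball 0 R. d \<le> F h (q + h *\<^sub>R c)" by blast
qed

lemma bounded_below_sqrt:
  assumes "bounded_below F" shows "bounded_below (\<lambda>h q. sqrt (F h q))"
  unfolding bounded_below_def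
proof (intro allI impI)
  fix R :: real assume "R > 0"
  then obtain d where d: "d > 0" "\<forall>\<^sub>F h in at_right 0. \<forall>q\<in>cball 0 R. d \<le> F h q"
    using bounded_belowD[OF assms, of R] by auto
  from d(2) have "\<forall>\<^sub>F h in at_right 0. \<forall>q\<in>cball 0 R. sqrt d \<le> sqrt (F h q)"
    by (rule eventually_mono) simp
  with d(1) show "\<exists>d>0. \<forall>\<^sub>F h in at_right 0. \<forall>q\<in>cball 0 R. d \<le> sqrt (F h q)"
    by (intro exI[of _ "sqrt d"]) simp
qed

lemma bounded_below_add:
  assumes "bounded_below F" "bounded_below G" shows "bounded_below (\<lambda>h q. F h q + G h q)"
  unfolding bounded_below_def
proof (intro allI impI)
  fix R :: real assume R: "R > 0"
  then obtain d where d: "d > 0" "\<forall>\<^sub>F h in at_right 0. \<forall>q\<in>cball 0 R. d \<le> F h q"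
    using bounded_belowD[OF assms(1), of R] by auto
  have "\<forall>\<^sub>F h in at_right 0. \<forall>q\<in>cball 0 R. d \<le> F h q + G h q"
    using d(2) bounded_below_pos[OF assms(2) R] by eventually_elim force
  with d(1) show "\<exists>d>0. \<forall>\<^sub>F h in at_right 0. \<forall>q\<in>cball 0 R. d \<le> F h q + G h q" by blast
qed

text \<open>For small \<open>h\<close> an \<open>O(h)\<close> perturbation consumes at most half of
  the lower bound. This transfers positivity from the limit at \<open>h = 0\<close>, where it is a
  statement on the Jacobian, to the discrete quantities.\<close>

lemma bounded_below_perturb:
  assumes "bounded_below F" "Oh 1 (\<lambda>h q. G h q - F h q)"
  shows "bounded_below G"
  unfolding bounded_below_def
proof (intro allI impI)
  fix R :: real assume R: "R > 0"
  obtain d where d: "d > 0" "\<forall>\<^sub>F h in at_right 0. \<forall>q\<in>cball 0 R. d \<le> F h q"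
    using bounded_belowD[OF assms(1) R] by auto
  obtain C where C: "C \<ge> 0" "\<forall>\<^sub>F h in at_right 0. \<forall>q\<in>cball 0 R. norm (G h q - F h q) \<le> C * h ^ 1"
    using OhE[OF assms(2)] by blast
  \<comment> \<open>The threshold for \<open>h\<close> that makes \<open>C * h\<close> at most
    \<open>d / 2\<close>; the summand 1 avoids division by zero when \<open>C = 0\<close>.\<close>
  have "d / (2 * (C + 1)) > 0" using d C by simp
  from d(2) C(2) eventually_at_right_0_less[OF this]
  have "\<forall>\<^sub>F h in at_right 0. \<forall>q\<in>cball 0 R. d / 2 \<le> G h q"
  proof eventually_elim
    case (elim h)
    have "C * h \<le> (C + 1) * h" using elim by (intro mult_right_mono) auto
    also have "\<dots> \<le> d / 2" using elim C by (simp add: field_simps)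
    finally have "C * h \<le> d / 2" .
    with elim show ?case by (force simp: abs_le_iff)
  qed
  with d(1) show "\<exists>d>0. \<forall>\<^sub>F h in at_right 0. \<forall>q\<in>cball 0 R. d \<le> G h q"
    by (intro exI[of _ "d / 2"]) simp
qed

lemma Oh_inverse:
  assumes "bounded_below F" shows "Oh 0 (\<lambda>h q. inverse (F h q))"
proof (rule OhI)
  fix R :: real assume R: "R > 0"
  obtain d where d: "d > 0" "\<forall>\<^sub>F h in at_right 0. \<forall>q\<in>cball 0 R. d \<le> F h q"
    using bounded_belowD[OF assms(1) R] by auto
  from d(2) have "\<forall>\<^sub>F h in at_right 0. \<forall>q\<in>cball 0 R. norm (inverse (F h q)) \<le> inverse d * h ^ 0"
    by (rule eventually_mono) (use d(1) in \<open>force intro: le_imp_inverse_le\<close>)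
  then show "\<exists>C. \<forall>\<^sub>F h in at_right 0. \<forall>q\<in>cball 0 R. norm (inverse (F h q)) \<le> C * h ^ 0" ..
qed

subsection \<open>Second differences\<close>

text \<open>\<open>F\<^sub>1\<close> and \<open>F\<^sub>2\<close> stand for the values of a family at two points placed symmetrically, at
  distance proportional to \<open>h\<close>, about the point at which \<open>F\<^sub>0\<close> is taken.\<close>

definition sym_stencil ::
    "nat \<Rightarrow> (real \<Rightarrow> 'a::euclidean_space \<Rightarrow> 'b::real_normed_vector) \<Rightarrow> (real \<Rightarrow> 'a \<Rightarrow> 'b) \<Rightarrow>
     (real \<Rightarrow> 'a \<Rightarrow> 'b) \<Rightarrow> bool" where
  "sym_stencil p F\<^sub>0 F\<^sub>1 F\<^sub>2 \<longleftrightarrow>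
     Oh p F\<^sub>0 \<and> Oh (p + 1) (\<lambda>h q. F\<^sub>1 h q - F\<^sub>0 h q) \<and> Oh (p + 1) (\<lambda>h q. F\<^sub>2 h q - F\<^sub>0 h q) \<and>
     Oh (p + 2) (\<lambda>h q. F\<^sub>1 h q + F\<^sub>2 h q - 2 *\<^sub>R F\<^sub>0 h q)"

lemma sym_stencilD:
  assumes "sym_stencil p F\<^sub>0 F\<^sub>1 F\<^sub>2"
  shows "Oh p F\<^sub>0" "Oh (p + 1) (\<lambda>h q. F\<^sub>1 h q - F\<^sub>0 h q)" "Oh (p + 1) (\<lambda>h q. F\<^sub>2 h q - F\<^sub>0 h q)"
    "Oh (p + 2) (\<lambda>h q. F\<^sub>1 h q + F\<^sub>2 h q - 2 *\<^sub>R F\<^sub>0 h q)" "Oh p F\<^sub>1" "Oh p F\<^sub>2"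
    "Oh (p + 1) (\<lambda>h q. F\<^sub>1 h q - F\<^sub>2 h q)"
proof -
  show *: "Oh p F\<^sub>0" "Oh (p + 1) (\<lambda>h q. F\<^sub>1 h q - F\<^sub>0 h q)" "Oh (p + 1) (\<lambda>h q. F\<^sub>2 h q - F\<^sub>0 h q)"
    "Oh (p + 2) (\<lambda>h q. F\<^sub>1 h q + F\<^sub>2 h q - 2 *\<^sub>R F\<^sub>0 h q)"
    using assms by (auto simp: sym_stencil_def)
  show "Oh p F\<^sub>1" using Oh_add[OF Oh_mono[OF *(2)] *(1)] by simp
  show "Oh p F\<^sub>2" using Oh_add[OF Oh_mono[OF *(3)] *(1)] by simp
  show "Oh (p + 1) (\<lambda>h q. F\<^sub>1 h q - F\<^sub>2 h q)" using Oh_diff[OF *(2,3)] by simp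
qed

text \<open>Serves for data that stay fixed while the other factors move to the two neighbouring
  points: the nodal impedance and deviation in the balance, and the unit normal along an
  edge.\<close>

lemma sym_stencil_frozen: "Oh p F \<Longrightarrow> sym_stencil p F F F"
  by (simp add: sym_stencil_def Oh_zero scaleR_2)

lemma sym_stencil_add:
  assumes "sym_stencil p F\<^sub>0 F\<^sub>1 F\<^sub>2" "sym_stencil p G\<^sub>0 G\<^sub>1 G\<^sub>2"
  shows "sym_stencil p (\<lambda>h q. F\<^sub>0 h q + G\<^sub>0 h q) (\<lambda>h q. F\<^sub>1 h q + G\<^sub>1 h q) (\<lambda>h q. F\<^sub>2 h q + G\<^sub>2 h q)"
  using assms[THEN sym_stencilD(1)] assms[THEN sym_stencilD(2)] assms[THEN sym_stencilD(3)]
    assms[THEN sym_stencilD(4)]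
  unfolding sym_stencil_def
  by (auto dest: Oh_add simp: algebra_simps)

text \<open>The second difference of a product is the sum of four products: the two pairs of first
  differences, and each second difference times the central value of the other factor. All four have
  order at least p + r + 2.\<close>

lemma sym_stencil_bilinear:
  assumes bop: "bounded_bilinear bop" and F: "sym_stencil p F\<^sub>0 F\<^sub>1 F\<^sub>2" and G: "sym_stencil r G\<^sub>0 G\<^sub>1 G\<^sub>2"
    and n: "n = p + r"
  shows "sym_stencil n (\<lambda>h q. bop (F\<^sub>0 h q) (G\<^sub>0 h q)) (\<lambda>h q. bop (F\<^sub>1 h q) (G\<^sub>1 h q))
           (\<lambda>h q. bop (F\<^sub>2 h q) (G\<^sub>2 h q))"
proof -
  interpret bounded_bilinear bop by fact
  note F = sym_stencilD[OF F] and G = sym_stencilD[OF G] and bil = Oh_bilinear[OF bop]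
  have "Oh n (\<lambda>h q. bop (F\<^sub>0 h q) (G\<^sub>0 h q))"
    using bil[OF F(1) G(1) n] .
  moreover have "Oh (n + 1) (\<lambda>h q. bop (F\<^sub>1 h q) (G\<^sub>1 h q) - bop (F\<^sub>0 h q) (G\<^sub>0 h q))"
    using Oh_add[OF bil[OF F(2) G(5), of "n + 1"] bil[OF F(1) G(2), of "n + 1"]] n
    by (simp add: diff_left diff_right)
  moreover have "Oh (n + 1) (\<lambda>h q. bop (F\<^sub>2 h q) (G\<^sub>2 h q) - bop (F\<^sub>0 h q) (G\<^sub>0 h q))"
    using Oh_add[OF bil[OF F(3) G(6), of "n + 1"] bil[OF F(1) G(3), of "n + 1"]] n
    by (simp add: diff_left diff_right)
  moreover have "Oh (n + 2) (\<lambda>h q. bop (F\<^sub>1 h q) (G\<^sub>1 h q) + bop (F\<^sub>2 h q) (G\<^sub>2 h q)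
      - 2 *\<^sub>R bop (F\<^sub>0 h q) (G\<^sub>0 h q))"
    using Oh_add[OF Oh_add[OF bil[OF F(2) G(2), of "n + 2"] bil[OF F(3) G(3), of "n + 2"]]
        Oh_add[OF bil[OF F(4) G(1), of "n + 2"] bil[OF F(1) G(4), of "n + 2"]]] n
    by (simp add: diff_left diff_right add_left add_right scaleR_left scaleR_right scaleR_2
        algebra_simps)
  ultimately show ?thesis by (simp add: sym_stencil_def)
qed

text \<open>Over common denominators the second difference of reciprocals becomes the second
  difference of the family plus a product of two first differences, both times bounded
  factors.\<close>

lemma sym_stencil_inverse:
  fixes F\<^sub>0 :: "real \<Rightarrow> 'a::euclidean_space \<Rightarrow> real"
  assumes F: "sym_stencil 0 F\<^sub>0 F\<^sub>1 F\<^sub>2"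
    and b: "bounded_below F\<^sub>0" "bounded_below F\<^sub>1" "bounded_below F\<^sub>2"
  shows "sym_stencil 0 (\<lambda>h q. inverse (F\<^sub>0 h q)) (\<lambda>h q. inverse (F\<^sub>1 h q)) (\<lambda>h q. inverse (F\<^sub>2 h q))"
proof -
  note F = sym_stencilD[OF F, simplified] and i = b[THEN Oh_inverse]
    and mult = Oh_bilinear[OF bounded_bilinear_mult]
  have pos: "\<forall>\<^sub>F h in at_right 0. \<forall>q\<in>cball 0 R. 0 < F\<^sub>0 h q \<and> 0 < F\<^sub>1 h q \<and> 0 < F\<^sub>2 h q" if "R > 0" for R
    using b[THEN bounded_below_pos, OF that] by eventually_elim auto
  have "Oh 1 (\<lambda>h q. inverse (F\<^sub>1 h q) - inverse (F\<^sub>0 h q))"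
    by (rule Oh_cong[OF Oh_minus[OF mult[OF mult[OF i(2) i(1) refl] F(2), of 1]]])
      (auto elim!: eventually_mono[OF pos] simp: field_simps)
  moreover have "Oh 1 (\<lambda>h q. inverse (F\<^sub>2 h q) - inverse (F\<^sub>0 h q))"
    by (rule Oh_cong[OF Oh_minus[OF mult[OF mult[OF i(3) i(1) refl] F(3), of 1]]])
      (auto elim!: eventually_mono[OF pos] simp: field_simps)
  moreover have "Oh 2 (\<lambda>h q. inverse (F\<^sub>1 h q) + inverse (F\<^sub>2 h q) - 2 *\<^sub>R inverse (F\<^sub>0 h q))"
  proof (rule Oh_cong)
    show "Oh 2 (\<lambda>h q. - ((F\<^sub>1 h q + F\<^sub>2 h q - 2 * F\<^sub>0 h q) * (inverse (F\<^sub>0 h q) * inverse (F\<^sub>1 h q))) -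
      ((F\<^sub>2 h q - F\<^sub>0 h q) * (F\<^sub>1 h q - F\<^sub>2 h q)) * (inverse (F\<^sub>0 h q) * (inverse (F\<^sub>2 h q) * inverse (F\<^sub>1 h q))))"
      by (intro Oh_diff Oh_minus mult[OF F(4)] mult[OF mult[OF F(3) F(7) refl]] mult[OF i(1)]
          mult[OF i(3)] i(2) refl i) (auto intro!: mult i)
  next
    fix R :: real assume "R > 0"
    show "\<forall>\<^sub>F h in at_right 0. \<forall>q\<in>cball 0 R. inverse (F\<^sub>1 h q) + inverse (F\<^sub>2 h q) - 2 *\<^sub>R inverse (F\<^sub>0 h q)
      = - ((F\<^sub>1 h q + F\<^sub>2 h q - 2 * F\<^sub>0 h q) * (inverse (F\<^sub>0 h q) * inverse (F\<^sub>1 h q))) -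
      ((F\<^sub>2 h q - F\<^sub>0 h q) * (F\<^sub>1 h q - F\<^sub>2 h q)) * (inverse (F\<^sub>0 h q) * (inverse (F\<^sub>2 h q) * inverse (F\<^sub>1 h q)))"
    proof (rule eventually_mono[OF pos[OF \<open>R > 0\<close>]], intro ballI)
      fix h :: real and q :: 'a
      assume *: "\<forall>q\<in>cball 0 R. 0 < F\<^sub>0 h q \<and> 0 < F\<^sub>1 h q \<and> 0 < F\<^sub>2 h q" and "q \<in> cball 0 R"
      have "inverse x + inverse y - 2 * inverse z = - ((x + y - 2 * z) * (inverse z * inverse x)) -
        ((y - z) * (x - y)) * (inverse z * (inverse y * inverse x))" if "x > 0" "y > 0" "z > 0" for x y z :: real
        using that by (simp add: field_simps)
      then show "inverse (F\<^sub>1 h q) + inverse (F\<^sub>2 h q) - 2 *\<^sub>R inverse (F\<^sub>0 h q)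
      = - ((F\<^sub>1 h q + F\<^sub>2 h q - 2 * F\<^sub>0 h q) * (inverse (F\<^sub>0 h q) * inverse (F\<^sub>1 h q))) -
      ((F\<^sub>2 h q - F\<^sub>0 h q) * (F\<^sub>1 h q - F\<^sub>2 h q)) * (inverse (F\<^sub>0 h q) * (inverse (F\<^sub>2 h q) * inverse (F\<^sub>1 h q)))"
        using * \<open>q \<in> cball 0 R\<close> by simp
    qed
  qed
  ultimately show ?thesis using i(1) by (simp add: sym_stencil_def numeral_2_eq_2)
qed

text \<open>Conjugation turns a difference of roots into a difference of values over a sum of roots.
  The two halves of the second difference have different denominators; exchanging one for the other
  costs a further first difference, which multiplies a first difference already present.\<close>

lemma sym_stencil_sqrt:
  fixes F\<^sub>0 :: "real \<Rightarrow> 'a::euclidean_space \<Rightarrow> real"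
  assumes F: "sym_stencil 0 F\<^sub>0 F\<^sub>1 F\<^sub>2"
    and b: "bounded_below F\<^sub>0" "bounded_below F\<^sub>1" "bounded_below F\<^sub>2"
  shows "sym_stencil 0 (\<lambda>h q. sqrt (F\<^sub>0 h q)) (\<lambda>h q. sqrt (F\<^sub>1 h q)) (\<lambda>h q. sqrt (F\<^sub>2 h q))"
proof -
  note F' = sym_stencilD[OF F, simplified] and b' = b[THEN bounded_below_sqrt]
    and mult = Oh_bilinear[OF bounded_bilinear_mult]
  have i: "Oh 0 (\<lambda>h q. inverse (sqrt (F\<^sub>1 h q) + sqrt (F\<^sub>0 h q)))"
    "Oh 0 (\<lambda>h q. inverse (sqrt (F\<^sub>2 h q) + sqrt (F\<^sub>0 h q)))"
    "Oh 0 (\<lambda>h q. inverse (sqrt (F\<^sub>1 h q) + sqrt (F\<^sub>2 h q)))"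
    by (intro Oh_inverse bounded_below_add b')+
  have pos: "\<forall>\<^sub>F h in at_right 0. \<forall>q\<in>cball 0 R. 0 < F\<^sub>0 h q \<and> 0 < F\<^sub>1 h q \<and> 0 < F\<^sub>2 h q" if "R > 0" for R
    using b[THEN bounded_below_pos, OF that] by eventually_elim auto
  have s: "sqrt x - sqrt y = (x - y) * inverse (sqrt x + sqrt y)" if "x > 0" "y > 0" for x y
    using that by (simp add: nonzero_eq_divide_eq field_simps add_pos_pos less_imp_neq[symmetric]
        flip: real_sqrt_mult)
  have 1: "Oh 1 (\<lambda>h q. sqrt (F\<^sub>1 h q) - sqrt (F\<^sub>0 h q))"
    by (rule Oh_cong[OF mult[OF F'(2) i(1), of 1]]) (auto elim!: eventually_mono[OF pos] simp: s)
  have 2: "Oh 1 (\<lambda>h q. sqrt (F\<^sub>2 h q) - sqrt (F\<^sub>0 h q))"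
    by (rule Oh_cong[OF mult[OF F'(3) i(2), of 1]]) (auto elim!: eventually_mono[OF pos] simp: s)
  have 3: "Oh 1 (\<lambda>h q. sqrt (F\<^sub>1 h q) - sqrt (F\<^sub>2 h q))"
    by (rule Oh_cong[OF mult[OF F'(7) i(3), of 1]]) (auto elim!: eventually_mono[OF pos] simp: s)
  have "Oh 2 (\<lambda>h q. sqrt (F\<^sub>1 h q) + sqrt (F\<^sub>2 h q) - 2 * sqrt (F\<^sub>0 h q))"
  proof (rule Oh_cong)
    show "Oh 2 (\<lambda>h q. (F\<^sub>1 h q + F\<^sub>2 h q - 2 * F\<^sub>0 h q) * inverse (sqrt (F\<^sub>1 h q) + sqrt (F\<^sub>0 h q)) +
      ((F\<^sub>2 h q - F\<^sub>0 h q) * (sqrt (F\<^sub>1 h q) - sqrt (F\<^sub>2 h q)))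
       * (inverse (sqrt (F\<^sub>1 h q) + sqrt (F\<^sub>0 h q)) * inverse (sqrt (F\<^sub>2 h q) + sqrt (F\<^sub>0 h q))))"
      by (intro Oh_add mult[OF F'(4) i(1)] mult[OF mult[OF F'(3) 3 refl] mult[OF i(1,2) refl]]) auto
  next
    fix R :: real assume "R > 0"
    have i: "inverse (b + c) = inverse (a + c) + (a - b) * (inverse (a + c) * inverse (b + c))"
      if "a + c > 0" "b + c > 0" for a b c :: real
    proof -
      have "inverse y = inverse x + (x - y) * (inverse x * inverse y)" if "x > 0" "y > 0" for x y :: real
        using that by (simp add: field_simps)
      from this[OF that] show ?thesis by simp
    qed
    have s': "sqrt x + sqrt y - 2 * sqrt z = (x + y - 2 * z) * inverse (sqrt x + sqrt z) +
        ((y - z) * (sqrt x - sqrt y)) * (inverse (sqrt x + sqrt z) * inverse (sqrt y + sqrt z))"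
      if "x > 0" "y > 0" "z > 0" for x y z
    proof -
      have nz: "sqrt x + sqrt z > 0" "sqrt y + sqrt z > 0" using that by (auto intro: add_pos_pos)
      have "sqrt x + sqrt y - 2 * sqrt z = (sqrt x - sqrt z) + (sqrt y - sqrt z)" by simp
      also have "\<dots> = (x - z) * inverse (sqrt x + sqrt z) + (y - z) * inverse (sqrt y + sqrt z)"
        using that by (simp add: s)
      also have "inverse (sqrt y + sqrt z) = inverse (sqrt x + sqrt z) +
          (sqrt x - sqrt y) * (inverse (sqrt x + sqrt z) * inverse (sqrt y + sqrt z))"
        using i[OF nz] .
      finally show ?thesis by (simp add: algebra_simps)
    qed
    show "\<forall>\<^sub>F h in at_right 0. \<forall>q\<in>cball 0 R. sqrt (F\<^sub>1 h q) + sqrt (F\<^sub>2 h q) - 2 * sqrt (F\<^sub>0 h q) =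
      (F\<^sub>1 h q + F\<^sub>2 h q - 2 * F\<^sub>0 h q) * inverse (sqrt (F\<^sub>1 h q) + sqrt (F\<^sub>0 h q)) +
      ((F\<^sub>2 h q - F\<^sub>0 h q) * (sqrt (F\<^sub>1 h q) - sqrt (F\<^sub>2 h q)))
       * (inverse (sqrt (F\<^sub>1 h q) + sqrt (F\<^sub>0 h q)) * inverse (sqrt (F\<^sub>2 h q) + sqrt (F\<^sub>0 h q)))"
      by (rule eventually_mono[OF pos[OF \<open>R > 0\<close>]], intro ballI s') auto
  qed
  moreover have "Oh 0 (\<lambda>h q. sqrt (F\<^sub>0 h q))"
  proof (rule Oh_dominate)
    show "Oh 0 (\<lambda>h q. 1 + F\<^sub>0 h q)" by (intro Oh_add Oh_const F')
    fix R :: real assume "R > 0"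
    \<comment> \<open>A crude linear majorant transfers boundedness of the family to its
      root.\<close>
    have "sqrt x \<le> 1 + x" if "x > 0" for x :: real
      using that by (intro real_le_lsqrt) (auto simp: power2_eq_square algebra_simps)
    then show "\<forall>\<^sub>F h in at_right 0. \<forall>q\<in>cball 0 R. norm (sqrt (F\<^sub>0 h q)) \<le> norm (1 + F\<^sub>0 h q)"
      by (intro eventually_mono[OF pos[OF \<open>R > 0\<close>]]) (simp add: less_imp_le)
  qed
  ultimately show ?thesis using 1 2 by (simp add: sym_stencil_def numeral_2_eq_2)
qed

text \<open>With p = 2 this is the property of \<open>D\<close> on which the argument rests: size
  \<open>O(h^2)\<close>, second differences \<open>O(h^4)\<close>. The shift is a multiple of the
  same \<open>h\<close> that is the parameter of the family.\<close>

definition second_order :: "nat \<Rightarrow> (real \<Rightarrow> 'a::euclidean_space \<Rightarrow> 'b::real_normed_vector) \<Rightarrow> bool" where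
  "second_order p F \<longleftrightarrow>
     (\<forall>u. sym_stencil p F (\<lambda>h q. F h (q + h *\<^sub>R u)) (\<lambda>h q. F h (q - h *\<^sub>R u)))"

lemma second_orderD:
  "second_order p F \<Longrightarrow> sym_stencil p F (\<lambda>h q. F h (q + h *\<^sub>R u)) (\<lambda>h q. F h (q - h *\<^sub>R u))"
  by (simp add: second_order_def)

lemma second_order_Oh: "second_order p F \<Longrightarrow> Oh p F"
  by (simp add: second_order_def sym_stencil_def)

lemma second_order_const: "second_order 0 (\<lambda>h q. c)"
  by (simp add: second_order_def sym_stencil_frozen Oh_const)

lemma second_order_add:
  "second_order p F \<Longrightarrow> second_order p G \<Longrightarrow> second_order p (\<lambda>h q. F h q + G h q)"
  by (simp add: second_order_def sym_stencil_add)

lemma second_order_bilinear: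
  assumes "bounded_bilinear bop" "second_order p F" "second_order r G" "n = p + r"
  shows "second_order n (\<lambda>h q. bop (F h q) (G h q))"
  unfolding second_order_def
proof
  fix u
  show "sym_stencil n (\<lambda>h q. bop (F h q) (G h q)) (\<lambda>h q. bop (F h (q + h *\<^sub>R u)) (G h (q + h *\<^sub>R u)))
      (\<lambda>h q. bop (F h (q - h *\<^sub>R u)) (G h (q - h *\<^sub>R u)))"
    using sym_stencil_bilinear[OF assms(1) second_orderD[OF assms(2)] second_orderD[OF assms(3)] assms(4)] .
qed

lemma second_order_scaleR: "second_order p F \<Longrightarrow> second_order p (\<lambda>h q. c *\<^sub>R F h q)"
  using second_order_bilinear[OF bounded_bilinear_scaleR second_order_const] by force

lemma second_order_diff:
  "second_order p F \<Longrightarrow> second_order p G \<Longrightarrow> second_order p (\<lambda>h q. F h q - G h q)"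
  using second_order_add[of p F "\<lambda>h q. (-1) *\<^sub>R G h q"] second_order_scaleR[of p G "-1"] by simp

lemma bounded_below_shift_minus:
  "bounded_below F \<Longrightarrow> bounded_below (\<lambda>h q. F h (q - h *\<^sub>R c))"
  using bounded_below_shift[of F "- c"] by simp

lemma second_order_inverse:
  "second_order 0 F \<Longrightarrow> bounded_below F \<Longrightarrow> second_order 0 (\<lambda>h q. inverse (F h q))"
  by (simp add: second_order_def sym_stencil_inverse bounded_below_shift bounded_below_shift_minus)

lemma second_order_sqrt:
  "second_order 0 F \<Longrightarrow> bounded_below F \<Longrightarrow> second_order 0 (\<lambda>h q. sqrt (F h q))"
  by (simp add: second_order_def sym_stencil_sqrt bounded_below_shift bounded_below_shift_minus)

lemma second_order_linear:
  assumes "bounded_linear L" "second_order p F" shows "second_order p (\<lambda>h q. L (F h q))"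
proof -
  \<comment> \<open>A linear map is treated as a product with the constant scalar 1, so that the
    bilinear rule applies.\<close>
  have "bounded_bilinear (\<lambda>c x. c *\<^sub>R L x)"
    using bounded_bilinear.comp[OF bounded_bilinear_scaleR bounded_linear_ident assms(1)] .
  from second_order_bilinear[OF this second_order_const[of 1] assms(2)] show ?thesis by simp
qed

lemma second_order_divide_step:
  fixes F :: "real \<Rightarrow> 'a::euclidean_space \<Rightarrow> 'b::real_normed_vector"
  assumes "second_order (p + k) F" shows "second_order p (\<lambda>h q. F h q /\<^sub>R h ^ k)"
  unfolding second_order_def sym_stencil_def
proof (intro allI conjI)
  fix u :: 'a
  have ac: "p + k + 1 = p + 1 + k" "p + k + 2 = p + 2 + k" by simp_all
  note F = sym_stencilD[OF second_orderD[OF assms, of u], unfolded ac]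
  show "Oh p (\<lambda>h q. F h q /\<^sub>R h ^ k)" using F(1) by (rule Oh_divide_step)
  show "Oh (p + 1) (\<lambda>h q. F h (q + h *\<^sub>R u) /\<^sub>R h ^ k - F h q /\<^sub>R h ^ k)"
    using Oh_divide_step[OF F(2)] by (simp only: scaleR_diff_right)
  show "Oh (p + 1) (\<lambda>h q. F h (q - h *\<^sub>R u) /\<^sub>R h ^ k - F h q /\<^sub>R h ^ k)"
    using Oh_divide_step[OF F(3)] by (simp only: scaleR_diff_right)
  show "Oh (p + 2) (\<lambda>h q. F h (q + h *\<^sub>R u) /\<^sub>R h ^ k + F h (q - h *\<^sub>R u) /\<^sub>R h ^ k -
      2 *\<^sub>R (F h q /\<^sub>R h ^ k))"
    using Oh_divide_step[OF F(4)]
    unfolding scaleR_diff_right scaleR_add_right scaleR_left_commute[of "inverse (_ ^ k)" 2] .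
qed

subsection \<open>Families given by smooth functions of the point and the step\<close>

text \<open>The displacement \<open>t\<close> of the points is separated from the parameter
  \<open>s\<close> of the family. The bounds can then be integrated in \<open>s\<close> at fixed
  points, and \<open>second_order\<close> results on setting both equal to \<open>h\<close>.\<close>

definition stencil_bound :: "nat \<Rightarrow> ('a::euclidean_space \<times> real \<Rightarrow> 'b::real_normed_vector) \<Rightarrow> bool" where
  "stencil_bound j \<Phi> \<longleftrightarrow> (\<forall>R u. \<exists>C. \<forall>q\<in>cball 0 R. \<forall>t\<in>{0..1}. \<forall>s\<in>{0..1}.
     norm (\<Phi> (q, s)) \<le> C * s ^ j \<and>
     norm (\<Phi> (q + t *\<^sub>R u, s) - \<Phi> (q, s)) \<le> C * s ^ j * t \<and>
     norm (\<Phi> (q + t *\<^sub>R u, s) + \<Phi> (q - t *\<^sub>R u, s) - 2 *\<^sub>R \<Phi> (q, s)) \<le> C * s ^ j * t\<^sup>2)"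

lemma smooth_difference_bound:
  fixes \<Phi> :: "'a::euclidean_space \<times> real \<Rightarrow> 'b::real_normed_vector"
  assumes "smooth \<Phi>"
  obtains C where "C \<ge> 0" "\<And>q t s. q \<in> cball 0 R \<Longrightarrow> t \<in> {0..1} \<Longrightarrow> s \<in> {0..1} \<Longrightarrow>
    norm (\<Phi> (q + t *\<^sub>R u, s) - \<Phi> (q, s)) \<le> C * t"
proof -
  define \<Phi>' where "\<Phi>' x = frechet_derivative \<Phi> (at x) (u, 0)" for x
  obtain C where C: "C \<ge> 0" "\<And>x. x \<in> cball 0 (R + norm u) \<times> {0..1} \<Longrightarrow> norm (\<Phi>' x) \<le> C"
    using smooth_bounded_on[OF smooth_deriv[OF assms], of "cball 0 (R + norm u) \<times> {0..1}"]
    unfolding \<Phi>'_def by (metis compact_Times compact_cball compact_Icc)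
  show thesis
  proof (rule that[OF C(1)])
    fix q :: 'a and t s :: real
    assume q: "q \<in> cball 0 R" and t: "t \<in> {0..1}" and s: "s \<in> {0..1}"
    show "norm (\<Phi> (q + t *\<^sub>R u, s) - \<Phi> (q, s)) \<le> C * t"
    proof (rule zero_start_bound[where f="\<lambda>t. \<Phi> (q + t *\<^sub>R u, s) - \<Phi> (q, s)"
          and f'="\<lambda>x. \<Phi>' (q + x *\<^sub>R u, s)"])
      fix x assume x: "x \<in> {0..t}"
      show "((\<lambda>t. \<Phi> (q + t *\<^sub>R u, s) - \<Phi> (q, s)) has_vector_derivative \<Phi>' (q + x *\<^sub>R u, s)) (at x within {0..t})"
        using smooth_has_vector_derivative_line[OF assms, of "(q, s)" "(u, 0)" x "{0..t}"]
        by (auto simp: \<Phi>'_def intro!: derivative_eq_intros)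
      have "norm (q + x *\<^sub>R u) \<le> norm q + norm (x *\<^sub>R u)" by (rule norm_triangle_ineq)
      also have "norm (x *\<^sub>R u) \<le> norm u" using x t by (auto intro: mult_left_le_one_le)
      finally show "norm (\<Phi>' (q + x *\<^sub>R u, s)) \<le> C" using q s by (intro C(2)) auto
    qed (use t in auto)
  qed
qed

text \<open>As a function of \<open>t\<close>, the symmetric second difference starts at zero and
  has as derivative a difference of directional derivatives at the two points. This is
  \<open>O(t)\<close> by \<open>smooth_difference_bound\<close>, so one more integration yields the
  square of \<open>t\<close>.\<close>

lemma stencil_bound_0:
  fixes \<Phi> :: "'a::euclidean_space \<times> real \<Rightarrow> 'b::real_normed_vector"
  assumes "smooth \<Phi>" shows "stencil_bound 0 \<Phi>"
  unfolding stencil_bound_def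
proof (intro allI)
  fix R :: real and u :: 'a
  define \<Phi>' where "\<Phi>' x = frechet_derivative \<Phi> (at x) (u, 0)" for x
  have sm: "smooth \<Phi>'" unfolding \<Phi>'_def by (rule smooth_deriv[OF assms])
  obtain A where A: "A \<ge> 0" "\<And>x. x \<in> cball 0 R \<times> {0..1} \<Longrightarrow> norm (\<Phi> x) \<le> A"
    using smooth_bounded_on[OF assms, of "cball 0 R \<times> {0..1}"]
    by (metis compact_Times compact_cball compact_Icc)
  obtain B where B: "B \<ge> 0" "\<And>q t s. q \<in> cball 0 R \<Longrightarrow> t \<in> {0..1} \<Longrightarrow> s \<in> {0..1} \<Longrightarrow>
    norm (\<Phi> (q + t *\<^sub>R u, s) - \<Phi> (q, s)) \<le> B * t"
    using smooth_difference_bound[OF assms] by blast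
  obtain C where C: "C \<ge> 0" "\<And>q t s. q \<in> cball 0 R \<Longrightarrow> t \<in> {0..1} \<Longrightarrow> s \<in> {0..1} \<Longrightarrow>
    norm (\<Phi>' (q + t *\<^sub>R u, s) - \<Phi>' (q, s)) \<le> C * t"
    using smooth_difference_bound[OF sm] by blast
  \<comment> \<open>The point \<open>q - t *\<^sub>R u\<close> is reached from \<open>q\<close> in
    the direction \<open>- u\<close>, which needs a constant of its own.\<close>
  obtain D where D: "D \<ge> 0" "\<And>q t s. q \<in> cball 0 R \<Longrightarrow> t \<in> {0..1} \<Longrightarrow> s \<in> {0..1} \<Longrightarrow>
    norm (\<Phi>' (q + t *\<^sub>R (- u), s) - \<Phi>' (q, s)) \<le> D * t"
    using smooth_difference_bound[OF sm] by blast
  have minus: "frechet_derivative \<Phi> (at x) (- u, 0) = - \<Phi>' x" for x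
    using linear_neg[OF bounded_linear.linear[OF has_derivative_bounded_linear[OF
          smooth_has_derivative[OF assms]]], of x "(u, 0)"]
    by (simp add: \<Phi>'_def)
  have *: "norm (\<Phi> (q + t *\<^sub>R u, s) + \<Phi> (q - t *\<^sub>R u, s) - 2 *\<^sub>R \<Phi> (q, s)) \<le> ((C + D) * t) * t"
    if q: "q \<in> cball 0 R" and t: "t \<in> {0..1}" and s: "s \<in> {0..1}" for q t s
  proof (rule zero_start_bound[where f="\<lambda>t. \<Phi> (q + t *\<^sub>R u, s) + \<Phi> (q - t *\<^sub>R u, s) - 2 *\<^sub>R \<Phi> (q, s)"
        and f'="\<lambda>x. \<Phi>' (q + x *\<^sub>R u, s) - \<Phi>' (q - x *\<^sub>R u, s)"])
    fix x assume x: "x \<in> {0..t}"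
    show "((\<lambda>t. \<Phi> (q + t *\<^sub>R u, s) + \<Phi> (q - t *\<^sub>R u, s) - 2 *\<^sub>R \<Phi> (q, s)) has_vector_derivative
       \<Phi>' (q + x *\<^sub>R u, s) - \<Phi>' (q - x *\<^sub>R u, s)) (at x within {0..t})"
      using smooth_has_vector_derivative_line[OF assms, of "(q, s)" "(u, 0)" x "{0..t}"]
        smooth_has_vector_derivative_line[OF assms, of "(q, s)" "(- u, 0)" x "{0..t}"]
      by (auto simp: minus simp flip: \<Phi>'_def intro!: derivative_eq_intros)
    have "norm ((\<Phi>' (q + x *\<^sub>R u, s) - \<Phi>' (q, s)) - (\<Phi>' (q + x *\<^sub>R (- u), s) - \<Phi>' (q, s))) \<le> C * x + D * x"
      using x t by (intro order_trans[OF norm_triangle_ineq4] add_mono C D q s) auto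
    also have "\<dots> \<le> (C + D) * t"
      using x C(1) D(1) by (simp add: add_mono mult_left_mono distrib_right)
    finally show "norm (\<Phi>' (q + x *\<^sub>R u, s) - \<Phi>' (q - x *\<^sub>R u, s)) \<le> (C + D) * t" by simp
  qed (use t in \<open>auto simp: scaleR_2\<close>)
  show "\<exists>C. \<forall>q\<in>cball 0 R. \<forall>t\<in>{0..1}. \<forall>s\<in>{0..1}.
     norm (\<Phi> (q, s)) \<le> C * s ^ 0 \<and>
     norm (\<Phi> (q + t *\<^sub>R u, s) - \<Phi> (q, s)) \<le> C * s ^ 0 * t \<and>
     norm (\<Phi> (q + t *\<^sub>R u, s) + \<Phi> (q - t *\<^sub>R u, s) - 2 *\<^sub>R \<Phi> (q, s)) \<le> C * s ^ 0 * t\<^sup>2"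
  proof (intro exI[of _ "A + B + C + D"] ballI conjI)
    fix q :: 'a and t s :: real
    assume q: "q \<in> cball 0 R" and t: "t \<in> {0..1}" and s: "s \<in> {0..1}"
    show "norm (\<Phi> (q, s)) \<le> (A + B + C + D) * s ^ 0"
      using A(2)[of "(q, s)"] q s B(1) C(1) D(1) by auto
    have "B * t \<le> (A + B + C + D) * t"
      using A(1) C(1) D(1) t by (intro mult_right_mono) auto
    then show "norm (\<Phi> (q + t *\<^sub>R u, s) - \<Phi> (q, s)) \<le> (A + B + C + D) * s ^ 0 * t"
      using B(2)[OF q t s] by simp
    have "(C + D) * t * t \<le> (A + B + C + D) * t * t"
      using A(1) B(1) t by (intro mult_right_mono) auto
    then show "norm (\<Phi> (q + t *\<^sub>R u, s) + \<Phi> (q - t *\<^sub>R u, s) - 2 *\<^sub>R \<Phi> (q, s)) \<le> (A + B + C + D) * s ^ 0 * t\<^sup>2"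
      using *[OF q t s] by (simp add: power2_eq_square mult.assoc)
  qed
qed

text \<open>The three stencil expressions are linear in the family. Hence they vanish at
  \<open>s = 0\<close>, and their derivative in \<open>s\<close> is the same expression for the
  \<open>s\<close>-derivative of the family: each integration in \<open>s\<close> adds one power of
  \<open>s\<close> and leaves the powers of \<open>t\<close> alone.\<close>

lemma stencil_bound_Suc:
  fixes \<Phi> :: "'a::euclidean_space \<times> real \<Rightarrow> 'b::real_normed_vector"
  assumes sm: "smooth \<Phi>" and zero: "\<And>q. \<Phi> (q, 0) = 0"
    and bound: "stencil_bound j (\<lambda>x. frechet_derivative \<Phi> (at x) (0, 1))"
  shows "stencil_bound (Suc j) \<Phi>"
  unfolding stencil_bound_def
proof (intro allI)
  fix R :: real and u :: 'a
  define \<Phi>' where "\<Phi>' x = frechet_derivative \<Phi> (at x) (0, 1)" for x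
  have line: "((\<lambda>s. \<Phi> (q, s)) has_vector_derivative \<Phi>' (q, s)) (at s within S)" for q s S
    using smooth_has_vector_derivative_line[OF sm, of "(q, 0)" "(0, 1)" s S] by (simp add: \<Phi>'_def)
  obtain C where C: "\<forall>q\<in>cball 0 R. \<forall>t\<in>{0..1}. \<forall>s\<in>{0..1}.
     norm (\<Phi>' (q, s)) \<le> C * s ^ j \<and>
     norm (\<Phi>' (q + t *\<^sub>R u, s) - \<Phi>' (q, s)) \<le> C * s ^ j * t \<and>
     norm (\<Phi>' (q + t *\<^sub>R u, s) + \<Phi>' (q - t *\<^sub>R u, s) - 2 *\<^sub>R \<Phi>' (q, s)) \<le> C * s ^ j * t\<^sup>2"
    using bound unfolding stencil_bound_def \<Phi>'_def by meson
  define M where "M = max 0 C"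
  have mono: "C * x ^ j * c \<le> M * s ^ j * c" if "x \<in> {0..s}" "c \<ge> 0" for x s c
    using that unfolding M_def by (intro mult_right_mono mult_mono power_mono) auto
  show "\<exists>C. \<forall>q\<in>cball 0 R. \<forall>t\<in>{0..1}. \<forall>s\<in>{0..1}.
     norm (\<Phi> (q, s)) \<le> C * s ^ Suc j \<and>
     norm (\<Phi> (q + t *\<^sub>R u, s) - \<Phi> (q, s)) \<le> C * s ^ Suc j * t \<and>
     norm (\<Phi> (q + t *\<^sub>R u, s) + \<Phi> (q - t *\<^sub>R u, s) - 2 *\<^sub>R \<Phi> (q, s)) \<le> C * s ^ Suc j * t\<^sup>2"
  proof (intro exI[of _ M] ballI conjI)
    fix q :: 'a and t s :: real
    assume q: "q \<in> cball 0 R" and t: "t \<in> {0..1}" and s: "s \<in> {0..1}"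
    have "norm (\<Phi> (q, s)) \<le> (M * s ^ j) * s"
    proof (rule zero_start_bound[where f="\<lambda>s. \<Phi> (q, s)" and f'="\<lambda>x. \<Phi>' (q, x)"])
      fix x assume x: "x \<in> {0..s}"
      show "norm (\<Phi>' (q, x)) \<le> M * s ^ j"
        using C[rule_format, OF q t, of x] mono[OF x, of 1] x s by auto
    qed (use s zero line in auto)
    then show "norm (\<Phi> (q, s)) \<le> M * s ^ Suc j" by (simp add: mult_ac)
    have "norm (\<Phi> (q + t *\<^sub>R u, s) - \<Phi> (q, s)) \<le> (M * s ^ j * t) * s"
    proof (rule zero_start_bound[where f="\<lambda>s. \<Phi> (q + t *\<^sub>R u, s) - \<Phi> (q, s)"
          and f'="\<lambda>x. \<Phi>' (q + t *\<^sub>R u, x) - \<Phi>' (q, x)"])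
      fix x assume x: "x \<in> {0..s}"
      show "norm (\<Phi>' (q + t *\<^sub>R u, x) - \<Phi>' (q, x)) \<le> M * s ^ j * t"
        using C[rule_format, OF q t, of x] mono[OF x, of t] x s t by auto
    qed (use s zero in \<open>auto intro!: derivative_eq_intros line\<close>)
    then show "norm (\<Phi> (q + t *\<^sub>R u, s) - \<Phi> (q, s)) \<le> M * s ^ Suc j * t" by (simp add: mult_ac)
    have "norm (\<Phi> (q + t *\<^sub>R u, s) + \<Phi> (q - t *\<^sub>R u, s) - 2 *\<^sub>R \<Phi> (q, s)) \<le> (M * s ^ j * t\<^sup>2) * s"
    proof (rule zero_start_bound[where f="\<lambda>s. \<Phi> (q + t *\<^sub>R u, s) + \<Phi> (q - t *\<^sub>R u, s) - 2 *\<^sub>R \<Phi> (q, s)"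
          and f'="\<lambda>x. \<Phi>' (q + t *\<^sub>R u, x) + \<Phi>' (q - t *\<^sub>R u, x) - 2 *\<^sub>R \<Phi>' (q, x)"])
      fix x assume x: "x \<in> {0..s}"
      show "norm (\<Phi>' (q + t *\<^sub>R u, x) + \<Phi>' (q - t *\<^sub>R u, x) - 2 *\<^sub>R \<Phi>' (q, x)) \<le> M * s ^ j * t\<^sup>2"
        using C[rule_format, OF q t, of x] mono[OF x, of "t\<^sup>2"] x s t by auto
    qed (use s zero in \<open>auto intro!: derivative_eq_intros line\<close>)
    then show "norm (\<Phi> (q + t *\<^sub>R u, s) + \<Phi> (q - t *\<^sub>R u, s) - 2 *\<^sub>R \<Phi> (q, s)) \<le> M * s ^ Suc j * t\<^sup>2"
      by (simp add: mult_ac)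
  qed
qed

lemma stencil_bound_second_order:
  fixes \<Phi> :: "'a::euclidean_space \<times> real \<Rightarrow> 'b::real_normed_vector"
  assumes "stencil_bound j \<Phi>" shows "second_order j (\<lambda>h q. \<Phi> (q, h))"
proof -
  have small: "\<forall>\<^sub>F h in at_right (0::real). 0 < h \<and> h < 1" by (rule eventually_at_right_0_less) simp
  have 1: "Oh j (\<lambda>h q. \<Phi> (q, h)) \<and> Oh (j + 1) (\<lambda>h q. \<Phi> (q + h *\<^sub>R u, h) - \<Phi> (q, h)) \<and>
    Oh (j + 2) (\<lambda>h q. \<Phi> (q + h *\<^sub>R u, h) + \<Phi> (q - h *\<^sub>R u, h) - 2 *\<^sub>R \<Phi> (q, h))" for u
  proof (intro conjI OhI)
    fix R :: real
    obtain C where C: "\<forall>q\<in>cball 0 R. \<forall>t\<in>{0..1}. \<forall>s\<in>{0..1}.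
       norm (\<Phi> (q, s)) \<le> C * s ^ j \<and>
       norm (\<Phi> (q + t *\<^sub>R u, s) - \<Phi> (q, s)) \<le> C * s ^ j * t \<and>
       norm (\<Phi> (q + t *\<^sub>R u, s) + \<Phi> (q - t *\<^sub>R u, s) - 2 *\<^sub>R \<Phi> (q, s)) \<le> C * s ^ j * t\<^sup>2"
      using assms unfolding stencil_bound_def by meson
    have "\<forall>\<^sub>F h in at_right 0. \<forall>q\<in>cball 0 R.
       norm (\<Phi> (q, h)) \<le> C * h ^ j \<and>
       norm (\<Phi> (q + h *\<^sub>R u, h) - \<Phi> (q, h)) \<le> C * h ^ (j + 1) \<and>
       norm (\<Phi> (q + h *\<^sub>R u, h) + \<Phi> (q - h *\<^sub>R u, h) - 2 *\<^sub>R \<Phi> (q, h)) \<le> C * h ^ (j + 2)"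
      using small
    proof (rule eventually_mono, intro ballI)
      fix h :: real and q :: 'a assume "0 < h \<and> h < 1" "q \<in> cball 0 R"
      with C[rule_format, of q h h] show "norm (\<Phi> (q, h)) \<le> C * h ^ j \<and>
         norm (\<Phi> (q + h *\<^sub>R u, h) - \<Phi> (q, h)) \<le> C * h ^ (j + 1) \<and>
         norm (\<Phi> (q + h *\<^sub>R u, h) + \<Phi> (q - h *\<^sub>R u, h) - 2 *\<^sub>R \<Phi> (q, h)) \<le> C * h ^ (j + 2)"
        by (simp add: power_add power2_eq_square mult_ac)
    qed
    then show "\<exists>C. \<forall>\<^sub>F h in at_right 0. \<forall>q\<in>cball 0 R. norm (\<Phi> (q, h)) \<le> C * h ^ j"
      and "\<exists>C. \<forall>\<^sub>F h in at_right 0. \<forall>q\<in>cball 0 R. norm (\<Phi> (q + h *\<^sub>R u, h) - \<Phi> (q, h)) \<le> C * h ^ (j + 1)"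
      and "\<exists>C. \<forall>\<^sub>F h in at_right 0. \<forall>q\<in>cball 0 R.
        norm (\<Phi> (q + h *\<^sub>R u, h) + \<Phi> (q - h *\<^sub>R u, h) - 2 *\<^sub>R \<Phi> (q, h)) \<le> C * h ^ (j + 2)"
      by (blast intro: eventually_mono)+
  qed
  \<comment> \<open>The backward first difference is the forward one in the direction
    \<open>- u\<close>.\<close>
  show ?thesis
    unfolding second_order_def sym_stencil_def using 1 1[of "- _"] by simp
qed

lemma smooth_second_order_0: "smooth \<Phi> \<Longrightarrow> second_order 0 (\<lambda>h q. \<Phi> (q, h))"
  by (intro stencil_bound_second_order stencil_bound_0)

lemma smooth_second_order_1:
  assumes "smooth \<Phi>" "\<And>q. \<Phi> (q, 0) = 0"
  shows "second_order 1 (\<lambda>h q. \<Phi> (q, h))"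
  using stencil_bound_second_order[OF stencil_bound_Suc[OF assms
        stencil_bound_0[OF smooth_deriv[OF assms(1)]]]] by simp

lemma smooth_second_order_2:
  assumes "smooth \<Phi>" "\<And>q. \<Phi> (q, 0) = 0"
    and "\<And>q. ((\<lambda>s. \<Phi> (q, s)) has_vector_derivative 0) (at 0)"
  shows "second_order 2 (\<lambda>h q. \<Phi> (q, h))"
proof -
  have "frechet_derivative \<Phi> (at (q, 0)) (0, 1) = 0" for q
    using smooth_has_vector_derivative_line[OF assms(1), of "(q, 0)" "(0, 1)" 0 UNIV]
    by (auto intro: vector_derivative_unique_at assms(3))
  from stencil_bound_second_order[OF stencil_bound_Suc[OF assms(1,2)
      stencil_bound_Suc[OF smooth_deriv[OF assms(1)] this stencil_bound_0[OF smooth_deriv[OF smooth_deriv[OF assms(1)]]]]]]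
  show ?thesis by (simp add: numeral_2_eq_2)
qed

text \<open>An even function of the step has vanishing derivative at zero: differentiating through
  the reflection gives \<open>d = - d\<close>. This is how symmetry about the centre of an edge
  produces two powers of \<open>h\<close> at once.\<close>

lemma smooth_second_order_even:
  fixes \<Phi> :: "'a::euclidean_space \<times> real \<Rightarrow> 'b::real_normed_vector"
  assumes "smooth \<Phi>" "\<And>q. \<Phi> (q, 0) = 0" "\<And>q s. \<Phi> (q, - s) = \<Phi> (q, s)"
  shows "second_order 2 (\<lambda>h q. \<Phi> (q, h))"
proof (rule smooth_second_order_2[OF assms(1,2)])
  fix q
  obtain d where d: "((\<lambda>s. \<Phi> (q, s)) has_vector_derivative d) (at 0)"
    using smooth_has_vector_derivative_line[OF assms(1), of "(q, 0)" "(0, 1)" 0 UNIV] by auto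
  have "(uminus has_vector_derivative (-1::real)) (at 0)"
    by (auto intro!: derivative_eq_intros simp flip: has_real_derivative_iff_has_vector_derivative)
  then have "((\<lambda>s. \<Phi> (q, s)) has_vector_derivative - d) (at 0)"
    using vector_diff_chain_at[of "\<lambda>s. - s" "-1" 0 "\<lambda>s. \<Phi> (q, s)" d] d
    by (simp add: o_def assms(3))
  with d have "d = - d" by (rule vector_derivative_unique_at)
  then have "2 *\<^sub>R d = 0" by (metis add.right_inverse scaleR_2)
  with d show "((\<lambda>s. \<Phi> (q, s)) has_vector_derivative 0) (at 0)" by simp
qed

section \<open>Geometry of the mesh map\<close>

definition rot :: "real^2 \<Rightarrow> real^2" where
  "rot x = vector [x $ 2, - (x $ 1)]"

lemma rot_nth [simp]: "rot x $ 1 = x $ 2" "rot x $ 2 = - (x $ 1)"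
  by (simp_all add: rot_def)

lemma bounded_linear_rot: "bounded_linear rot"
  by (intro linear_conv_bounded_linear[THEN iffD1] linearI) (auto simp: vec_eq_iff forall_2)

lemma inner_real2: "x \<bullet> y = x $ 1 * y $ 1 + x $ 2 * y $ 2" for x y :: "real^2"
  by (simp add: inner_vec_def sum_2)

lemma norm_rot [simp]: "norm (rot x) = norm x"
  by (simp add: norm_eq_sqrt_inner inner_real2 add.commute)

lemma rot_scaleR: "rot (c *\<^sub>R x) = c *\<^sub>R rot x"
  and rot_minus: "rot (- x) = - rot x"
  by (simp_all add: vec_eq_iff forall_2)

definition cross2 :: "real^2 \<Rightarrow> real^2 \<Rightarrow> real" where
  "cross2 x y = x $ 1 * y $ 2 - x $ 2 * y $ 1"

lemma cross2_eq_inner: "cross2 x y = x \<bullet> rot y"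
  by (simp add: cross2_def inner_real2)

lemma bounded_bilinear_cross2: "bounded_bilinear cross2"
  unfolding cross2_eq_inner[abs_def]
  using bounded_bilinear.comp[OF bounded_bilinear_inner bounded_linear_ident bounded_linear_rot] .

lemma cross2_rot [simp]: "cross2 (rot x) (rot y) = cross2 x y"
  by (simp add: cross2_def)

abbreviation ex :: "real^2" where "ex \<equiv> vector [1, 0]"
abbreviation ey :: "real^2" where "ey \<equiv> vector [0, 1]"

lemma real2_decompose: "x = (x $ 1) *\<^sub>R ex + (x $ 2) *\<^sub>R ey" for x :: "real^2"
  by (simp add: vec_eq_iff forall_2)

text \<open>Cramer's rule: a plane vector is recovered from its products with two independent
  vectors. Both the construction of \<open>defect\<close> and the coercivity estimate come from
  it.\<close>

lemma solve_two_directions: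
  fixes x S T :: "real^2"
  shows "cross2 S T *\<^sub>R x = (S \<bullet> x) *\<^sub>R rot T - (T \<bullet> x) *\<^sub>R rot S"
  by (simp add: vec_eq_iff forall_2 cross2_def inner_real2 algebra_simps)

text \<open>Cramer's rule bounds the square of \<open>norm x\<close> by its two squared components,
  which the energy estimate \<open>le\<close> bounds by \<open>norm x * norm y\<close>; one factor
  \<open>norm x\<close> then cancels. The constant is explicit so that it can be estimated uniformly
  in the step and the node.\<close>

lemma coercive_two_directions:
  fixes x y S T :: "real^2"
  assumes "cross2 S T \<noteq> 0" "a > 0" "b > 0"
    and le: "a * (x \<bullet> S)\<^sup>2 + b * (x \<bullet> T)\<^sup>2 \<le> norm x * norm y"
  shows "norm x \<le> (S \<bullet> S + T \<bullet> T) * (inverse a + inverse b) * (inverse (cross2 S T))\<^sup>2 * norm y"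
proof (cases "x = 0")
  case True
  then show ?thesis using assms by (simp add: add_nonneg_nonneg)
next
  case False
  have "(cross2 S T)\<^sup>2 * (norm x)\<^sup>2 = ((S \<bullet> x) *\<^sub>R rot T - (T \<bullet> x) *\<^sub>R rot S) \<bullet> ((S \<bullet> x) *\<^sub>R rot T - (T \<bullet> x) *\<^sub>R rot S)"
    by (simp flip: solve_two_directions power2_norm_eq_inner add: power_mult_distrib)
  also have "\<dots> \<le> (S \<bullet> S + T \<bullet> T) * ((x \<bullet> S)\<^sup>2 + (x \<bullet> T)\<^sup>2)"
  proof -
    \<comment> \<open>The gap in this Cauchy-Schwarz type inequality is exactly the squared length
      of \<open>(x \<bullet> S) *\<^sub>R S + (x \<bullet> T) *\<^sub>R T\<close>.\<close>
    have "(S \<bullet> S + T \<bullet> T) * ((x \<bullet> S)\<^sup>2 + (x \<bullet> T)\<^sup>2) -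
        ((S \<bullet> x) *\<^sub>R rot T - (T \<bullet> x) *\<^sub>R rot S) \<bullet> ((S \<bullet> x) *\<^sub>R rot T - (T \<bullet> x) *\<^sub>R rot S)
      = ((x \<bullet> S) * S $ 1 + (x \<bullet> T) * T $ 1)\<^sup>2 + ((x \<bullet> S) * S $ 2 + (x \<bullet> T) * T $ 2)\<^sup>2"
      unfolding inner_real2 by (simp add: power2_eq_square algebra_simps)
    then show ?thesis by (metis add_nonneg_nonneg diff_ge_0_iff_ge zero_le_power2)
  qed
  also have "\<dots> \<le> (S \<bullet> S + T \<bullet> T) * ((inverse a + inverse b) * (norm x * norm y))"
  proof (intro mult_left_mono)
    have "a * (x \<bullet> S)\<^sup>2 \<le> norm x * norm y" "b * (x \<bullet> T)\<^sup>2 \<le> norm x * norm y"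
    proof -
      have "0 \<le> a * (x \<bullet> S)\<^sup>2" "0 \<le> b * (x \<bullet> T)\<^sup>2" using assms(2,3) by simp_all
      with le show "a * (x \<bullet> S)\<^sup>2 \<le> norm x * norm y" "b * (x \<bullet> T)\<^sup>2 \<le> norm x * norm y"
        by linarith+
    qed
    then have "(x \<bullet> S)\<^sup>2 \<le> inverse a * (norm x * norm y)" "(x \<bullet> T)\<^sup>2 \<le> inverse b * (norm x * norm y)"
      using assms(2,3) by (simp_all add: field_simps)
    then show "(x \<bullet> S)\<^sup>2 + (x \<bullet> T)\<^sup>2 \<le> (inverse a + inverse b) * (norm x * norm y)"
      by (simp add: distrib_right)
  qed simp
  finally have "(cross2 S T)\<^sup>2 * norm x * norm x \<le>
      (S \<bullet> S + T \<bullet> T) * (inverse a + inverse b) * norm y * norm x"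
    by (simp add: power2_eq_square mult_ac)
  then have "(cross2 S T)\<^sup>2 * norm x \<le> (S \<bullet> S + T \<bullet> T) * (inverse a + inverse b) * norm y"
    using False by simp
  then show ?thesis
    using assms(1) by (simp add: field_simps)
qed

lemma bounded_below_continuous:
  fixes f :: "'a::euclidean_space \<times> real \<Rightarrow> real"
  assumes "continuous_on UNIV f" "\<And>x. f x > 0"
  shows "bounded_below (\<lambda>h q. f (q, h))"
  unfolding bounded_below_def
proof (intro allI impI)
  fix R :: real assume "R > 0"
  obtain x where x: "x \<in> cball 0 R \<times> {0..1}" "\<And>y. y \<in> cball 0 R \<times> {0..1} \<Longrightarrow> f x \<le> f y"
    using continuous_attains_inf[of "cball 0 R \<times> {0..1}" f] \<open>R > 0\<close> continuous_on_subset[OF assms(1)]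
    by (auto simp: compact_Times)
  have "\<forall>\<^sub>F h in at_right 0. \<forall>q\<in>cball 0 R. f x \<le> f (q, h)"
    using eventually_at_right_0_less[OF zero_less_one] by eventually_elim (auto intro!: x(2))
  with assms(2) show "\<exists>c>0. \<forall>\<^sub>F h in at_right 0. \<forall>q\<in>cball 0 R. c \<le> f (q, h)" by blast
qed

lemmas second_order_inner = second_order_bilinear[OF bounded_bilinear_inner]
  and second_order_mult = second_order_bilinear[OF bounded_bilinear_mult]
  and second_order_scale = second_order_bilinear[OF bounded_bilinear_scaleR]
  and Oh_inner = Oh_bilinear[OF bounded_bilinear_inner]
  and Oh_mult = Oh_bilinear[OF bounded_bilinear_mult]
  and Oh_scale = Oh_bilinear[OF bounded_bilinear_scaleR]
  and sym_stencil_inner = sym_stencil_bilinear[OF bounded_bilinear_inner]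
  and sym_stencil_mult = sym_stencil_bilinear[OF bounded_bilinear_mult]
  and sym_stencil_scale = sym_stencil_bilinear[OF bounded_bilinear_scaleR]

lemma smooth_shifted:
  fixes f :: "'a::euclidean_space \<Rightarrow> 'b::euclidean_space"
  assumes "smooth f"
  shows "smooth (\<lambda>x. f (fst x + snd x *\<^sub>R u))" "smooth (\<lambda>x. f (fst x - snd x *\<^sub>R u))"
proof -
  have *: "smooth (\<lambda>x. f (fst x + snd x *\<^sub>R u))" for u
    by (intro smooth_compose[OF assms] smooth_add smooth_bounded_linear bounded_linear_fst
        bounded_linear_compose[OF bounded_linear_scaleR_left bounded_linear_snd])
  show "smooth (\<lambda>x. f (fst x + snd x *\<^sub>R u))" "smooth (\<lambda>x. f (fst x - snd x *\<^sub>R u))"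
    using *[of u] *[of "- u"] by simp_all
qed

section \<open>Jacobian, orientation and chords of the mesh map\<close>

locale mesh_map =
  fixes \<phi> \<psi> :: "real^2 \<Rightarrow> real^2"
  assumes smooth_map: "smooth \<phi>" and smooth_inv: "smooth \<psi>" and inv_map: "\<And>x. \<psi> (\<phi> x) = x"
begin

definition jac :: "real^2 \<Rightarrow> real^2 \<Rightarrow> real^2" where
  "jac q u = frechet_derivative \<phi> (at q) u"

lemma linear_jac: "linear (jac q)"
  unfolding jac_def
  by (rule bounded_linear.linear[OF has_derivative_bounded_linear[OF smooth_has_derivative[OF smooth_map]]])

lemma smooth_jac: "smooth (\<lambda>q. jac q u)"
  unfolding jac_def by (rule smooth_deriv[OF smooth_map])

text \<open>The chain rule for \<open>\<psi> (\<phi> x) = x\<close> shows that the derivative of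
  \<open>\<psi>\<close> is a left inverse of \<open>jac q\<close>. The nondegeneracy of the meshes
  rests on this.\<close>

lemma jac_eq_0_iff: "jac q u = 0 \<longleftrightarrow> u = 0"
proof
  assume "jac q u = 0"
  have "((\<lambda>x. \<psi> (\<phi> x)) has_derivative (\<lambda>d. frechet_derivative \<psi> (at (\<phi> q)) (jac q d))) (at q)"
    unfolding jac_def
    by (rule has_derivative_compose[OF smooth_has_derivative[OF smooth_map] smooth_has_derivative[OF smooth_inv]])
  then have "((\<lambda>x. x) has_derivative (\<lambda>d. frechet_derivative \<psi> (at (\<phi> q)) (jac q d))) (at q)"
    by (simp add: inv_map)
  then have "(\<lambda>d. frechet_derivative \<psi> (at (\<phi> q)) (jac q d)) = (\<lambda>d. d)"
    using has_derivative_unique[OF _ has_derivative_ident] by blast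
  then have "frechet_derivative \<psi> (at (\<phi> q)) (jac q u) = u" by meson
  moreover have "frechet_derivative \<psi> (at (\<phi> q)) 0 = 0"
    by (rule linear_0[OF bounded_linear.linear[OF has_derivative_bounded_linear[OF smooth_has_derivative[OF smooth_inv]]]])
  ultimately show "u = 0" using \<open>jac q u = 0\<close> by simp
qed (simp add: linear_0[OF linear_jac])

definition jac_det :: "real^2 \<Rightarrow> real" where
  "jac_det q = cross2 (jac q ex) (jac q ey)"

lemma cross2_jac: "cross2 (jac q u) (jac q w) = cross2 u w * jac_det q"
proof -
  have "jac q x = (x $ 1) *\<^sub>R jac q ex + (x $ 2) *\<^sub>R jac q ey" for x
    by (subst real2_decompose[of x]) (simp only: linear_add[OF linear_jac] linear_scale[OF linear_jac])
  from this[of u] this[of w] show ?thesis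
    unfolding jac_det_def by (simp add: cross2_def algebra_simps)
qed

lemma det_nonzero: "jac_det q \<noteq> 0"
proof
  assume 0: "jac_det q = 0"
  define a b where "a = jac q ex" and "b = jac q ey"
  have ab: "a \<noteq> 0" "cross2 a b = 0"
    using 0 jac_eq_0_iff[of q ex] by (auto simp: a_def b_def jac_det_def vec_eq_iff forall_2)
  \<comment> \<open>If the cross product of the two columns vanishes, their coordinates provide the
    coefficients of a linear relation between them; injectivity then forces
    \<open>a = 0\<close>.\<close>
  have "jac q ((b $ i) *\<^sub>R ex - (a $ i) *\<^sub>R ey) = (b $ i) *\<^sub>R a - (a $ i) *\<^sub>R b" for i
    by (simp add: linear_diff[OF linear_jac] linear_scale[OF linear_jac] a_def b_def)
  moreover have "(b $ 1) *\<^sub>R a - (a $ 1) *\<^sub>R b = 0" "(b $ 2) *\<^sub>R a - (a $ 2) *\<^sub>R b = 0"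
    using ab(2) by (simp_all add: vec_eq_iff forall_2 cross2_def algebra_simps)
  ultimately have "(b $ 1) *\<^sub>R ex - (a $ 1) *\<^sub>R ey = 0" "(b $ 2) *\<^sub>R ex - (a $ 2) *\<^sub>R ey = 0"
    using jac_eq_0_iff by metis+
  then have "a = 0" by (simp add: vec_eq_iff forall_2)
  with ab show False by simp
qed

lemma continuous_det: "continuous_on S jac_det"
  unfolding jac_det_def
  by (intro bounded_bilinear.continuous_on[OF bounded_bilinear_cross2] smooth_continuous_on smooth_jac)

text \<open>One sign serves the whole plane, since the determinant is continuous and never zero on a
  connected set; the point 0 is an arbitrary representative.\<close>

definition orient :: real where "orient = sgn (jac_det 0)"

lemma orient_cases: "orient = 1 \<or> orient = - 1"
  using det_nonzero[of 0] by (auto simp: orient_def sgn_if)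

lemma orient_det_pos: "orient * jac_det q > 0"
proof (rule ccontr)
  assume *: "\<not> orient * jac_det q > 0"
  have conn: "connected (range (\<lambda>q. orient * jac_det q))"
    by (intro connected_continuous_image continuous_intros continuous_det connected_UNIV)
  have "orient * jac_det 0 > 0"
    using det_nonzero[of 0] by (simp add: orient_def sgn_if)
  with * have "0 \<in> range (\<lambda>q. orient * jac_det q)"
    using connectedD_interval[OF conn, of "orient * jac_det q" "orient * jac_det 0" 0] by auto
  then show False using det_nonzero orient_cases by auto
qed

text \<open>Divided by \<open>h\<close>, so that the limit at \<open>h = 0\<close> is twice the
  directional derivative rather than zero. The numerator vanishes at \<open>h = 0\<close>, which
  pays for the division.\<close>

definition chord :: "real^2 \<Rightarrow> real \<Rightarrow> real^2 \<Rightarrow> real^2" where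
  "chord u h q = (\<phi> (q + h *\<^sub>R u) - \<phi> (q - h *\<^sub>R u)) /\<^sub>R h"

lemma second_order_chord: "second_order 0 (chord u)"
proof -
  have "second_order 1 (\<lambda>h q. (\<lambda>x. \<phi> (fst x + snd x *\<^sub>R u) - \<phi> (fst x - snd x *\<^sub>R u)) (q, h))"
    by (rule smooth_second_order_1) (auto intro!: smooth_diff smooth_shifted smooth_map)
  with second_order_divide_step[of 0 1 "\<lambda>h q. \<phi> (q + h *\<^sub>R u) - \<phi> (q - h *\<^sub>R u)"]
  show ?thesis by (simp add: chord_def[abs_def])
qed

lemma chord_jac: "Oh 1 (\<lambda>h q. chord u h q - 2 *\<^sub>R jac q u)"
proof -
  let ?\<Phi> = "\<lambda>x. \<phi> (fst x + snd x *\<^sub>R u) - \<phi> (fst x - snd x *\<^sub>R u) - snd x *\<^sub>R (2 *\<^sub>R jac (fst x) u)"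
  have "second_order 2 (\<lambda>h q. ?\<Phi> (q, h))"
  proof (rule smooth_second_order_2)
    show "smooth ?\<Phi>"
      by (intro smooth_diff smooth_shifted smooth_map smooth_scaleR smooth_bounded_linear[OF bounded_linear_snd]
          smooth_const smooth_compose[OF smooth_jac] smooth_bounded_linear[OF bounded_linear_fst])
    show "?\<Phi> (q, 0) = 0" for q by simp
    show "((\<lambda>s. ?\<Phi> (q, s)) has_vector_derivative 0) (at 0)" for q
    proof -
      \<comment> \<open>The backward point is written as a point on the line in the direction
        \<open>- u\<close>; the two derivatives add up to \<open>2 *\<^sub>R jac q u\<close> and
        cancel the subtracted linear term.\<close>
      have "((\<lambda>s. \<phi> (q + s *\<^sub>R u) - \<phi> (q + s *\<^sub>R (- u)) - s *\<^sub>R (2 *\<^sub>R jac q u)) has_vector_derivative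
          jac (q + 0 *\<^sub>R u) u - jac (q + 0 *\<^sub>R (- u)) (- u) - 1 *\<^sub>R (2 *\<^sub>R jac q u)) (at 0)"
        unfolding jac_def
        by (intro has_vector_derivative_diff smooth_has_vector_derivative_line[OF smooth_map])
          (auto intro!: derivative_eq_intros)
      then show ?thesis by (simp add: linear_neg[OF linear_jac] scaleR_2)
    qed
  qed
  from second_order_Oh[OF this] have "Oh (1 + 1) (\<lambda>h q. ?\<Phi> (q, h))" unfolding one_add_one .
  from Oh_divide_step[OF this] show ?thesis
  proof (rule Oh_cong)
    show "\<forall>\<^sub>F h in at_right 0. \<forall>q\<in>cball 0 R. chord u h q - 2 *\<^sub>R jac q u = ?\<Phi> (q, h) /\<^sub>R h ^ 1" for R
      using eventually_at_right_less[of "0::real"]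
      by eventually_elim (auto simp: chord_def scaleR_diff_right)
  qed
qed

text \<open>The cross product of two chords tends to \<open>4 * cross2 u w * jac_det q\<close>,
  whose sign is that of \<open>orient\<close>; the convergence is \<open>O(h)\<close>, so a lower
  bound survives for small \<open>h\<close>.\<close>

lemma bounded_below_cross2_chord:
  assumes "cross2 u w > 0"
  shows "bounded_below (\<lambda>h q. orient * cross2 (chord u h q) (chord w h q))"
proof (rule bounded_below_perturb)
  have "continuous_on UNIV (\<lambda>x::(real^2) \<times> real. jac_det (fst x))"
    by (rule continuous_on_compose2[OF continuous_det continuous_on_fst]) (auto intro: continuous_intros)
  then show "bounded_below (\<lambda>h q. (\<lambda>x. 4 * cross2 u w * (orient * jac_det (fst x))) (q, h))"
    by (intro bounded_below_continuous continuous_intros) (use assms orient_det_pos in auto)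
  interpret c: bounded_bilinear cross2 by (rule bounded_bilinear_cross2)
  have J: "Oh 0 (\<lambda>h q. 2 *\<^sub>R jac q u)" for u
    using Oh_scaleR[OF second_order_Oh[OF smooth_second_order_0[OF smooth_compose[OF smooth_jac
            smooth_bounded_linear[OF bounded_linear_fst]]]]] by simp
  have "Oh 1 (\<lambda>h q. cross2 (chord u h q - 2 *\<^sub>R jac q u) (chord w h q) +
      cross2 (2 *\<^sub>R jac q u) (chord w h q - 2 *\<^sub>R jac q w))"
    by (intro Oh_add Oh_bilinear[OF bounded_bilinear_cross2 chord_jac second_order_Oh[OF second_order_chord]]
        Oh_bilinear[OF bounded_bilinear_cross2 J chord_jac]) auto
  then have "Oh 1 (\<lambda>h q. cross2 (chord u h q) (chord w h q) - 4 * cross2 u w * jac_det q)"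
    by (simp add: c.diff_left c.diff_right c.scaleR_left c.scaleR_right cross2_jac mult.assoc)
  from Oh_scaleR[OF this, of orient]
  show "Oh 1 (\<lambda>h q. orient * cross2 (chord u h q) (chord w h q) - (\<lambda>x. 4 * cross2 u w * (orient * jac_det (fst x))) (q, h))"
    by (simp add: right_diff_distrib mult_ac)
qed

end

section \<open>The nodal velocity\<close>

lemma Oh_norm: "Oh p F \<Longrightarrow> Oh p (\<lambda>h q. norm (F h q))"
  by (rule Oh_dominate) auto

lemma sym_stencil_scaleR:
  "sym_stencil p F\<^sub>0 F\<^sub>1 F\<^sub>2 \<Longrightarrow>
    sym_stencil p (\<lambda>h q. c *\<^sub>R F\<^sub>0 h q) (\<lambda>h q. c *\<^sub>R F\<^sub>1 h q) (\<lambda>h q. c *\<^sub>R F\<^sub>2 h q)"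
  using sym_stencil_scale[OF sym_stencil_frozen[OF Oh_const[of c]], of p F\<^sub>0 F\<^sub>1 F\<^sub>2 p] by simp

lemma sym_stencil_diff:
  assumes "sym_stencil p F\<^sub>0 F\<^sub>1 F\<^sub>2" "sym_stencil p G\<^sub>0 G\<^sub>1 G\<^sub>2"
  shows "sym_stencil p (\<lambda>h q. F\<^sub>0 h q - G\<^sub>0 h q) (\<lambda>h q. F\<^sub>1 h q - G\<^sub>1 h q) (\<lambda>h q. F\<^sub>2 h q - G\<^sub>2 h q)"
  using sym_stencil_add[OF assms(1) sym_stencil_scaleR[OF assms(2), of "-1"]] by simp

text \<open>Needed because the midpoint of a straight edge is not the image of its parameter centre:
  the two differ by \<open>O(h^2)\<close>, which a stencil of order 0 tolerates.\<close>

lemma sym_stencil_recentre: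
  assumes "sym_stencil p F\<^sub>0 F\<^sub>1 F\<^sub>2" "Oh (p + 2) (\<lambda>h q. G h q - F\<^sub>0 h q)"
  shows "sym_stencil p G F\<^sub>1 F\<^sub>2"
proof -
  note F = sym_stencilD[OF assms(1)]
  have 1: "Oh (p + 1) (\<lambda>h q. G h q - F\<^sub>0 h q)" "Oh p (\<lambda>h q. G h q - F\<^sub>0 h q)"
    by (rule Oh_mono[OF assms(2)], simp)+
  show ?thesis
    unfolding sym_stencil_def
    using Oh_add[OF 1(2) F(1)] Oh_diff[OF F(2) 1(1)] Oh_diff[OF F(3) 1(1)]
      Oh_diff[OF F(4) Oh_scaleR[OF assms(2), of 2]]
    by (simp add: scaleR_diff_right algebra_simps)
qed

section \<open>The nodal solver expressed through the centres of edges\<close>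

locale lagrangian_scheme = mesh_map +
  fixes v :: "real^2 \<Rightarrow> real^2" and P \<alpha> :: "real^2 \<Rightarrow> real"
  assumes smooth_v: "smooth v" and smooth_P: "smooth P" and smooth_\<alpha>: "smooth \<alpha>"
    and \<alpha>_pos: "\<And>x. \<alpha> x > 0"
begin

text \<open>The edge centred at the parameter point \<open>q\<close> with direction \<open>u\<close>
  joins the images of \<open>q - h *\<^sub>R u\<close> and \<open>q + h *\<^sub>R u\<close>; this is
  the midpoint of the straight segment between these images.\<close>

definition mid :: "real^2 \<Rightarrow> real \<Rightarrow> real^2 \<Rightarrow> real^2" where
  "mid u h q = midpoint (\<phi> (q - h *\<^sub>R u)) (\<phi> (q + h *\<^sub>R u))"

text \<open>Its normal component is the quantity \<open>w\<close> of the jump condition. It is also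
  Simpson's rule minus the trapezoidal rule for the velocity: the weights 2/3, -1/3, -1/3 are the
  differences between 1/6, 2/3, 1/6 and 1/2, 0, 1/2. Correcting nodal velocities by it therefore
  turns their mean into Simpson's value.\<close>

definition curv :: "real^2 \<Rightarrow> real \<Rightarrow> real^2 \<Rightarrow> real^2" where
  "curv u h q = (2/3) *\<^sub>R (v (mid u h q) - (1/2) *\<^sub>R v (\<phi> (q - h *\<^sub>R u)) - (1/2) *\<^sub>R v (\<phi> (q + h *\<^sub>R u)))"

text \<open>Not normalised: its length is the edge length divided by \<open>h\<close>, so for a
  fixed nonzero direction it stays bounded and away from zero, locally uniformly for small
  \<open>h\<close>.\<close>

definition nrm :: "real^2 \<Rightarrow> real \<Rightarrow> real^2 \<Rightarrow> real^2" where
  "nrm u h q = rot (chord u h q)"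

lemma mid_minus: "mid (- u) h q = mid u h q"
  by (simp add: mid_def midpoint_sym)

lemma curv_minus: "curv (- u) h q = curv u h q"
  by (simp add: curv_def mid_minus algebra_simps)

lemma nrm_minus: "nrm (- u) h q = - nrm u h q"
  by (simp add: nrm_def chord_def flip: rot_minus) (simp flip: scaleR_minus_right)

lemma mid_neg_step: "mid u (- h) q = mid u h q"
  by (simp add: mid_def midpoint_sym)

lemma mid_0: "mid u 0 q = \<phi> q"
  by (simp add: mid_def)

lemma smooth_mid: "smooth (\<lambda>x. mid u (snd x) (fst x))"
  unfolding mid_def midpoint_def
  by (intro smooth_cscaleR smooth_add smooth_shifted smooth_map)

lemma second_order_smooth_mid:
  "smooth f \<Longrightarrow> second_order 0 (\<lambda>h q. f (mid u h q))"
  using smooth_second_order_0[OF smooth_compose[OF _ smooth_mid]] by simp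

lemma second_order_smooth_node:
  "smooth f \<Longrightarrow> second_order 0 (\<lambda>h q. f (\<phi> q))"
  using smooth_second_order_0[OF smooth_compose[OF smooth_compose[OF _ smooth_map] smooth_bounded_linear[OF bounded_linear_fst]]]
  by simp

text \<open>The difference is even in \<open>h\<close>, because reversing the step swaps the
  endpoints of the edge, and it vanishes at \<open>h = 0\<close>.\<close>

lemma mid_node: "smooth f \<Longrightarrow> Oh 2 (\<lambda>h q. f (mid u h q) - f (\<phi> q))"
  for f :: "real^2 \<Rightarrow> 'b::real_normed_vector"
proof -
  assume f: "smooth f"
  have "second_order 2 (\<lambda>h q. (\<lambda>x. f (mid u (snd x) (fst x)) - f (\<phi> (fst x))) (q, h))"
    by (rule smooth_second_order_even)
      (auto simp: mid_neg_step mid_0 intro!: smooth_diff smooth_compose[OF f] smooth_mid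
        smooth_compose[OF smooth_map] smooth_bounded_linear[OF bounded_linear_fst])
  from second_order_Oh[OF this] show ?thesis by simp
qed

lemma second_order_curv: "second_order 2 (curv u)"
proof -
  have "second_order 2 (\<lambda>h q. (\<lambda>x. curv u (snd x) (fst x)) (q, h))"
  proof (rule smooth_second_order_even)
    show "smooth (\<lambda>x. curv u (snd x) (fst x))"
      unfolding curv_def
      by (intro smooth_cscaleR smooth_diff smooth_compose[OF smooth_v] smooth_mid smooth_shifted smooth_map)
  qed (auto simp: curv_def mid_neg_step mid_0 algebra_simps simp flip: scaleR_add_left)
  then show ?thesis by simp
qed

lemma second_order_nrm: "second_order 0 (nrm u)"
  unfolding nrm_def[abs_def] by (rule second_order_linear[OF bounded_linear_rot second_order_chord])

lemma bounded_below_cross2_nrm: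
  "cross2 u w > 0 \<Longrightarrow> bounded_below (\<lambda>h q. orient * cross2 (nrm u h q) (nrm w h q))"
  using bounded_below_cross2_chord by (simp add: nrm_def)

lemma bounded_below_nrm:
  assumes "u \<noteq> 0" shows "bounded_below (\<lambda>h q. nrm u h q \<bullet> nrm u h q)"
proof -
  define C where "C h q = nrm u h q \<bullet> nrm u h q - (2 *\<^sub>R rot (jac q u)) \<bullet> (2 *\<^sub>R rot (jac q u))" for h q
  have J: "second_order 0 (\<lambda>h q. 2 *\<^sub>R rot (jac q u))"
    using smooth_second_order_0[OF smooth_compose[OF smooth_jac smooth_bounded_linear[OF bounded_linear_fst]]]
    by (intro second_order_scaleR second_order_linear[OF bounded_linear_rot]) simp
  have d: "Oh 1 (\<lambda>h q. nrm u h q - 2 *\<^sub>R rot (jac q u))"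
    using Oh_bilinear[OF bounded_bilinear.comp[OF bounded_bilinear_scaleR bounded_linear_ident bounded_linear_rot]
      Oh_const[of 1] chord_jac[of u], of 1]
    by (simp add: nrm_def linear_diff[OF bounded_linear.linear[OF bounded_linear_rot]] rot_scaleR)
  show ?thesis
  proof (rule bounded_below_perturb)
    show "bounded_below (\<lambda>h q. (\<lambda>x. (2 *\<^sub>R rot (jac (fst x) u)) \<bullet> (2 *\<^sub>R rot (jac (fst x) u))) (q, h))"
    proof (rule bounded_below_continuous)
      show "continuous_on UNIV (\<lambda>x::(real^2)\<times>real. 2 *\<^sub>R rot (jac (fst x) u) \<bullet> 2 *\<^sub>R rot (jac (fst x) u))"
        by (intro smooth_continuous_on smooth_inner smooth_cscaleR smooth_linear_compose[OF bounded_linear_rot]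
            smooth_compose[OF smooth_jac] smooth_bounded_linear[OF bounded_linear_fst])
      have "rot (jac q u) \<noteq> 0" for q
        using jac_eq_0_iff[of q u] assms by (metis norm_eq_zero norm_rot)
      then show "2 *\<^sub>R rot (jac (fst x) u) \<bullet> 2 *\<^sub>R rot (jac (fst x) u) > 0" for x by simp
    qed
    \<comment> \<open>The difference of the squared lengths is factored as difference times sum; the
      first factor is \<open>O(h)\<close>.\<close>
    have "Oh 1 (\<lambda>h q. (nrm u h q - 2 *\<^sub>R rot (jac q u)) \<bullet> (nrm u h q + 2 *\<^sub>R rot (jac q u)))"
      by (rule Oh_inner[OF d Oh_add[OF second_order_Oh[OF second_order_nrm] second_order_Oh[OF J]]]) simp
    then show "Oh 1 (\<lambda>h q. nrm u h q \<bullet> nrm u h q - (\<lambda>x. (2 *\<^sub>R rot (jac (fst x) u)) \<bullet> (2 *\<^sub>R rot (jac (fst x) u))) (q, h))"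
      by (simp add: inner_diff_left inner_add_right inner_commute algebra_simps)
  qed
qed

lemma second_order_inverse_norm_nrm:
  assumes "u \<noteq> 0" shows "second_order 0 (\<lambda>h q. inverse (norm (nrm u h q)))"
  unfolding norm_eq_sqrt_inner
  by (intro second_order_inverse second_order_sqrt bounded_below_sqrt bounded_below_nrm assms
      second_order_inner[OF second_order_nrm second_order_nrm]) simp

text \<open>The vector \<open>D\<close> of the introduction.\<close>

definition defect :: "real \<Rightarrow> real^2 \<Rightarrow> real^2" where
  "defect h q = inverse (orient * cross2 (nrm ex h q) (nrm ey h q)) *\<^sub>R
     (orient *\<^sub>R ((nrm ex h q \<bullet> curv ex h q) *\<^sub>R rot (nrm ey h q) - (nrm ey h q \<bullet> curv ey h q) *\<^sub>R rot (nrm ex h q)))"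

text \<open>The factor \<open>orient\<close> makes the cross product positive, as the reciprocal
  rule for families requires. In \<open>defect\<close> it occurs twice and cancels.\<close>

lemma bounded_below_cross2_nrm_ex_ey: "bounded_below (\<lambda>h q. orient * cross2 (nrm ex h q) (nrm ey h q))"
  by (rule bounded_below_cross2_nrm) (simp add: cross2_def)

lemma second_order_defect: "second_order 2 defect"
proof -
  have "second_order 2 (\<lambda>h q. (nrm u h q \<bullet> curv u h q) *\<^sub>R rot (nrm w h q))" for u w
    by (rule second_order_scale[OF second_order_inner[OF second_order_nrm second_order_curv refl]
          second_order_linear[OF bounded_linear_rot second_order_nrm]]) simp
  moreover have "second_order 0 (\<lambda>h q. orient * cross2 (nrm ex h q) (nrm ey h q))"
    by (rule second_order_mult[OF second_order_const
          second_order_bilinear[OF bounded_bilinear_cross2 second_order_nrm second_order_nrm refl]]) simp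
  ultimately show ?thesis
    unfolding defect_def[abs_def]
    by (intro second_order_scale[OF second_order_inverse[OF _ bounded_below_cross2_nrm_ex_ey]]
        second_order_scaleR second_order_diff) simp_all
qed

text \<open>Cramer's rule with the normals in the directions \<open>ex\<close> and
  \<open>ey\<close>. Reversing a direction changes the sign of the normal on both sides, so the
  opposite directions follow.\<close>

lemma defect_normal:
  assumes "R > 0" "u \<in> {ex, - ex, ey, - ey}"
  shows "\<forall>\<^sub>F h in at_right 0. \<forall>q\<in>cball 0 R. nrm u h q \<bullet> defect h q = nrm u h q \<bullet> curv u h q"
proof (rule eventually_mono[OF bounded_below_pos[OF bounded_below_cross2_nrm_ex_ey assms(1)]], intro ballI)
  fix h :: real and q :: "real^2"
  assume *: "\<forall>q\<in>cball 0 R. 0 < orient * cross2 (nrm ex h q) (nrm ey h q)" and "q \<in> cball 0 R"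
  then have "orient * cross2 (nrm ex h q) (nrm ey h q) \<noteq> 0" by fastforce
  then have nz: "orient \<noteq> 0" "cross2 (nrm ex h q) (nrm ey h q) \<noteq> 0" by auto
  have "S \<bullet> (inverse (orient * cross2 S T) *\<^sub>R (orient *\<^sub>R (a *\<^sub>R rot T - b *\<^sub>R rot S))) = a"
    "T \<bullet> (inverse (orient * cross2 S T) *\<^sub>R (orient *\<^sub>R (a *\<^sub>R rot T - b *\<^sub>R rot S))) = b"
    if "cross2 S T \<noteq> 0" for S T a b
  proof -
    have *: "S \<bullet> (a *\<^sub>R rot T - b *\<^sub>R rot S) = a * cross2 S T" "T \<bullet> (a *\<^sub>R rot T - b *\<^sub>R rot S) = b * cross2 S T"
      by (simp_all add: inner_real2 cross2_def algebra_simps)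
    from nz(1) that show
      "S \<bullet> (inverse (orient * cross2 S T) *\<^sub>R (orient *\<^sub>R (a *\<^sub>R rot T - b *\<^sub>R rot S))) = a"
      "T \<bullet> (inverse (orient * cross2 S T) *\<^sub>R (orient *\<^sub>R (a *\<^sub>R rot T - b *\<^sub>R rot S))) = b"
      unfolding inner_scaleR_right * by (simp_all add: field_simps)
  qed
  from this[OF nz(2)] have "nrm ex h q \<bullet> defect h q = nrm ex h q \<bullet> curv ex h q"
    "nrm ey h q \<bullet> defect h q = nrm ey h q \<bullet> curv ey h q"
    unfolding defect_def by simp_all
  with assms(2) show "nrm u h q \<bullet> defect h q = nrm u h q \<bullet> curv u h q"
    by (auto simp: nrm_minus curv_minus)
qed

text \<open>Up to the factor \<open>h\<close>, the contribution to the balance at a node with impedance \<open>a\<close> and velocity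
  deviation \<open>d\<close> of the half edge whose edge is centred at \<open>q\<close>.\<close>

definition contrib :: "real^2 \<Rightarrow> real \<Rightarrow> real^2 \<Rightarrow> real \<Rightarrow> real^2 \<Rightarrow> real^2" where
  "contrib u h q a d = inverse (norm (nrm u h q)) *\<^sub>R
     ((\<alpha> (mid u h q) * (curv u h q \<bullet> nrm u h q) - (1/3 * a + 2/3 * \<alpha> (mid u h q)) * (d \<bullet> nrm u h q)) *\<^sub>R nrm u h q)"

text \<open>The normal enters each term twice, so its sign cancels and both half edges along one
  grid line can be described with the same direction.\<close>

lemma contrib_minus: "contrib (- u) h q a d = contrib u h q a d"
  by (simp add: contrib_def mid_minus curv_minus nrm_minus algebra_simps)

text \<open>The stencil is centred at a fictitious edge whose parameter centre is the node itself.
  There \<open>defect_normal\<close> replaces \<open>curv\<close> by \<open>defect\<close>; as 1/3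
  and 2/3 sum to 1, only a third of the difference between midpoint and nodal impedance is left. It
  is \<open>O(h^2)\<close> and multiplies a deviation that is \<open>O(h^2)\<close>.\<close>

lemma contrib_defect:
  assumes u: "u \<in> {ex, ey}"
  shows "Oh 4 (\<lambda>h p. contrib u h (p + h *\<^sub>R u) (\<alpha> (\<phi> p)) (defect h p) + contrib u h (p - h *\<^sub>R u) (\<alpha> (\<phi> p)) (defect h p))"
proof -
  have "u \<noteq> 0" using u by (auto simp: vec_eq_iff forall_2)
  note st = second_orderD[where u=u]
  note N = st[OF second_order_nrm] and W = st[OF second_order_inverse_norm_nrm[OF \<open>u \<noteq> 0\<close>]]
    and A = st[OF second_order_smooth_mid[OF smooth_\<alpha>]] and C = st[OF second_order_curv]
    and D = sym_stencil_frozen[OF second_order_Oh[OF second_order_defect]]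
    and a = sym_stencil_frozen[OF second_order_Oh[OF second_order_smooth_node[OF smooth_\<alpha>]]]
  note const = sym_stencil_frozen[OF Oh_const]
  have S: "sym_stencil 2 (\<lambda>h p. contrib u h p (\<alpha> (\<phi> p)) (defect h p))
    (\<lambda>h p. contrib u h (p + h *\<^sub>R u) (\<alpha> (\<phi> p)) (defect h p)) (\<lambda>h p. contrib u h (p - h *\<^sub>R u) (\<alpha> (\<phi> p)) (defect h p))"
    unfolding contrib_def
    by (rule sym_stencil_scale[OF W sym_stencil_scale[OF sym_stencil_diff[OF
        sym_stencil_mult[OF A sym_stencil_inner[OF C N refl] refl]
        sym_stencil_mult[OF sym_stencil_add[OF sym_stencil_mult[OF const a refl] sym_stencil_mult[OF const A refl]]
          sym_stencil_inner[OF D N refl]]] N refl]]) simp_all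
  have "Oh 4 (\<lambda>h p. contrib u h p (\<alpha> (\<phi> p)) (defect h p))"
  proof (rule Oh_cong)
    show "Oh 4 (\<lambda>h p. inverse (norm (nrm u h p)) *\<^sub>R
       (((1/3) *\<^sub>R (\<alpha> (mid u h p) - \<alpha> (\<phi> p)) * (defect h p \<bullet> nrm u h p)) *\<^sub>R nrm u h p))"
      by (rule Oh_scale[OF sym_stencilD(1)[OF W] Oh_scale[OF Oh_mult[OF Oh_scaleR[OF mid_node[OF smooth_\<alpha>]]
              Oh_inner[OF sym_stencilD(1)[OF D] sym_stencilD(1)[OF N] refl] refl] sym_stencilD(1)[OF N] refl]]) simp
    show "\<forall>\<^sub>F h in at_right 0. \<forall>p\<in>cball 0 R. contrib u h p (\<alpha> (\<phi> p)) (defect h p) = inverse (norm (nrm u h p)) *\<^sub>R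
       (((1/3) *\<^sub>R (\<alpha> (mid u h p) - \<alpha> (\<phi> p)) * (defect h p \<bullet> nrm u h p)) *\<^sub>R nrm u h p)" if "R > 0" for R
    proof (rule eventually_mono[OF defect_normal[OF that, of u]], use u in blast, intro ballI)
      fix h :: real and q :: "real^2"
      assume "\<forall>q\<in>cball 0 R. nrm u h q \<bullet> defect h q = nrm u h q \<bullet> curv u h q" "q \<in> cball 0 R"
      then have "curv u h q \<bullet> nrm u h q = defect h q \<bullet> nrm u h q" by (simp add: inner_commute)
      then show "contrib u h q (\<alpha> (\<phi> q)) (defect h q) = inverse (norm (nrm u h q)) *\<^sub>R
       (((1/3) *\<^sub>R (\<alpha> (mid u h q) - \<alpha> (\<phi> q)) * (defect h q \<bullet> nrm u h q)) *\<^sub>R nrm u h q)"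
        unfolding contrib_def by (simp add: algebra_simps)
    qed
  qed
  moreover have "(2::nat) + 2 = 4" by simp
  ultimately have "Oh (2 + 2) (\<lambda>h p. contrib u h p (\<alpha> (\<phi> p)) (defect h p))" by simp
  from Oh_add[OF sym_stencilD(4)[OF S] Oh_scaleR[OF this, of 2]]
  show ?thesis by simp
qed

text \<open>The predicate \<open>N\<close> marks the points where the balance is known; elsewhere
  the difference is set to zero. At a marked point the balance is affine in the deviation, so
  \<open>x = d - defect\<close> solves the same system with the residual \<open>Q\<close> of
  \<open>defect\<close> as right-hand side, and testing with \<open>x\<close> itself gives the
  estimate.\<close>

lemma nodal_deviation:
  assumes bal: "\<And>h p. h > 0 \<Longrightarrow> N h p \<Longrightarrow>
      (\<Sum>u\<in>{ex, - ex, ey, - ey}. contrib u h (p + h *\<^sub>R u) (\<alpha> (\<phi> p)) (d h p)) = 0"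
  shows "Oh 4 (\<lambda>h p. if N h p then d h p - defect h p else 0)"
proof -
  define Q where "Q h p = (\<Sum>u\<in>{ex, ey}. contrib u h (p + h *\<^sub>R u) (\<alpha> (\<phi> p)) (defect h p) +
      contrib u h (p - h *\<^sub>R u) (\<alpha> (\<phi> p)) (defect h p))" for h p
  define A where "A u h p = 1/3 * \<alpha> (\<phi> p) + 2/3 * \<alpha> (mid u h (p + h *\<^sub>R u))" for u h p
  define T where "T u h p = nrm u h (p + h *\<^sub>R u)" for u h p
  have "ex \<noteq> 0" "ey \<noteq> 0" "ex \<noteq> - ex" "ey \<noteq> - ey" "ex \<noteq> ey" "ex \<noteq> - ey" "ey \<noteq> - ex"
    by (simp_all add: vec_eq_iff forall_2)
  note distinct = this
  have Q: "Oh 4 Q" unfolding Q_def by (intro Oh_sum contrib_defect) auto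
  have T: "Oh 0 (T u)" for u
    unfolding T_def[abs_def] by (intro Oh_shift second_order_Oh second_order_nrm)
  have A: "bounded_below (A u)" for u
    unfolding A_def[abs_def]
  proof (rule bounded_below_add)
    have "bounded_below (\<lambda>h q. (\<lambda>x. 1/3 * \<alpha> (\<phi> (fst x))) (q, h))"
      by (intro bounded_below_continuous continuous_on_mult continuous_on_const smooth_continuous_on
          smooth_compose[OF smooth_\<alpha>] smooth_compose[OF smooth_map] smooth_bounded_linear[OF bounded_linear_fst])
        (simp add: \<alpha>_pos)
    then show "bounded_below (\<lambda>h q. 1/3 * \<alpha> (\<phi> q))" by simp
    have "bounded_below (\<lambda>h q. (\<lambda>x. 2/3 * \<alpha> (mid u (snd x) (fst x))) (q, h))"
      by (intro bounded_below_continuous continuous_on_mult continuous_on_const smooth_continuous_on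
          smooth_compose[OF smooth_\<alpha>] smooth_mid) (simp add: \<alpha>_pos)
    from bounded_below_shift[OF this]
    show "bounded_below (\<lambda>h q. 2/3 * \<alpha> (mid u h (q + h *\<^sub>R u)))" by simp
  qed
  \<comment> \<open>The normals are taken at the edge centres \<open>p + h *\<^sub>R u\<close>, not
    at the node; moving there changes them by \<open>O(h)\<close> only, so the cross product keeps
    its lower bound.\<close>
  have cross: "bounded_below (\<lambda>h p. orient * cross2 (T ex h p) (T ey h p))"
  proof (rule bounded_below_perturb[OF bounded_below_cross2_nrm_ex_ey])
    interpret c: bounded_bilinear cross2 by (rule bounded_bilinear_cross2)
    have d: "Oh 1 (\<lambda>h p. T u h p - nrm u h p)" for u
      using sym_stencilD(2)[OF second_orderD[OF second_order_nrm, of u u]] by (simp add: T_def)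
    have "Oh 1 (\<lambda>h p. cross2 (T ex h p - nrm ex h p) (T ey h p) + cross2 (nrm ex h p) (T ey h p - nrm ey h p))"
      by (intro Oh_add Oh_bilinear[OF bounded_bilinear_cross2 d T]
          Oh_bilinear[OF bounded_bilinear_cross2 second_order_Oh[OF second_order_nrm] d]) auto
    from Oh_scaleR[OF this, of orient]
    show "Oh 1 (\<lambda>h p. orient * cross2 (T ex h p) (T ey h p) - orient * cross2 (nrm ex h p) (nrm ey h p))"
      by (simp add: c.diff_left c.diff_right algebra_simps)
  qed
  show ?thesis
  proof (rule Oh_dominate)
    \<comment> \<open>The constant of \<open>coercive_two_directions\<close> with coefficients
      \<open>A / norm T\<close>, whose reciprocals are \<open>norm T * inverse A\<close>; it is
      bounded, so the order is that of \<open>Q\<close>.\<close>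
    show "Oh 4 (\<lambda>h p. ((T ex h p \<bullet> T ex h p + T ey h p \<bullet> T ey h p) *
        (norm (T ex h p) * inverse (A ex h p) + norm (T ey h p) * inverse (A ey h p)) *
        (inverse (orient * cross2 (T ex h p) (T ey h p)) * inverse (orient * cross2 (T ex h p) (T ey h p)))) * norm (Q h p))"
      by (rule Oh_mult[OF Oh_mult[OF Oh_mult[OF Oh_add[OF Oh_inner[OF T T refl] Oh_inner[OF T T refl]]
          Oh_add[OF Oh_mult[OF Oh_norm[OF T] Oh_inverse[OF A] refl] Oh_mult[OF Oh_norm[OF T] Oh_inverse[OF A] refl]] refl]
          Oh_mult[OF Oh_inverse[OF cross] Oh_inverse[OF cross] refl]] Oh_norm[OF Q]]) simp_all
    fix R :: real assume "R > 0"
    show "\<forall>\<^sub>F h in at_right 0. \<forall>p\<in>cball 0 R. norm (if N h p then d h p - defect h p else 0) \<le>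
       norm (((T ex h p \<bullet> T ex h p + T ey h p \<bullet> T ey h p) *
        (norm (T ex h p) * inverse (A ex h p) + norm (T ey h p) * inverse (A ey h p)) *
        (inverse (orient * cross2 (T ex h p) (T ey h p)) * inverse (orient * cross2 (T ex h p) (T ey h p)))) * norm (Q h p))"
      using bounded_below_pos[OF cross \<open>R > 0\<close>] eventually_at_right_less[of "0::real"]
    proof (eventually_elim, intro ballI)
      fix h :: real and p :: "real^2"
      assume "\<forall>p\<in>cball 0 R. 0 < orient * cross2 (T ex h p) (T ey h p)" "0 < h" "p \<in> cball 0 R"
      then have "orient * cross2 (T ex h p) (T ey h p) > 0" by blast
      then have c: "cross2 (T ex h p) (T ey h p) \<noteq> 0" by auto
      then have nz: "norm (T ex h p) > 0" "norm (T ey h p) > 0" by (auto simp: cross2_def)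
      have Apos: "1/3 * \<alpha> x + 2/3 * \<alpha> y > 0" for x y by (simp add: \<alpha>_pos add_pos_pos)
      then have Apos': "A u h p > 0" for u by (simp add: A_def)
      let ?rhs = "((T ex h p \<bullet> T ex h p + T ey h p \<bullet> T ey h p) *
        (norm (T ex h p) * inverse (A ex h p) + norm (T ey h p) * inverse (A ey h p)) *
        (inverse (orient * cross2 (T ex h p) (T ey h p)) * inverse (orient * cross2 (T ex h p) (T ey h p)))) * norm (Q h p)"
      show "norm (if N h p then d h p - defect h p else 0) \<le> norm ?rhs"
      proof (cases "N h p")
        case False
        then show ?thesis by simp
      next
        case True
        define x where "x = d h p - defect h p"
        \<comment> \<open>The contribution is affine in the deviation; the part linear in
          \<open>x\<close> is a nonnegative multiple of the projection onto the normal.\<close>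
        have lin: "contrib u h q a (d h p) = contrib u h q a (defect h p) -
            (inverse (norm (nrm u h q)) * (1/3 * a + 2/3 * \<alpha> (mid u h q)) * (x \<bullet> nrm u h q)) *\<^sub>R nrm u h q" for u q a
        proof -
          have d: "d h p = defect h p + x" by (simp add: x_def)
          show ?thesis by (simp add: contrib_def d inner_add_left algebra_simps add_divide_distrib)
        qed
        define f where "f u q = (inverse (norm (nrm u h q)) * (1/3 * \<alpha> (\<phi> p) + 2/3 * \<alpha> (mid u h q)) * (x \<bullet> nrm u h q)) *\<^sub>R nrm u h q"
          for u q
        have f: "x \<bullet> f u q = inverse (norm (nrm u h q)) * (1/3 * \<alpha> (\<phi> p) + 2/3 * \<alpha> (mid u h q)) * (x \<bullet> nrm u h q)\<^sup>2" for u q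
          by (simp add: f_def power2_eq_square)
        then have f0: "x \<bullet> f u q \<ge> 0" for u q
          using Apos[of "\<phi> p" "mid u h q"] by (simp add: zero_le_mult_iff)
        have "Q h p = f ex (p + h *\<^sub>R ex) + f ex (p - h *\<^sub>R ex) + f ey (p + h *\<^sub>R ey) + f ey (p - h *\<^sub>R ey)"
        proof -
          have sum4: "(\<Sum>u\<in>{ex, - ex, ey, - ey}. g u) = g ex + g (- ex) + (g ey + g (- ey))"
            for g :: "real^2 \<Rightarrow> real^2"
            using distinct by (auto simp: add.assoc)
          have "contrib u h (p + h *\<^sub>R u) (\<alpha> (\<phi> p)) (d h p) + contrib (- u) h (p + h *\<^sub>R (- u)) (\<alpha> (\<phi> p)) (d h p) =
              (contrib u h (p + h *\<^sub>R u) (\<alpha> (\<phi> p)) (defect h p) + contrib u h (p - h *\<^sub>R u) (\<alpha> (\<phi> p)) (defect h p))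
              - (f u (p + h *\<^sub>R u) + f u (p - h *\<^sub>R u))" for u
            unfolding contrib_minus lin f_def by (simp add: nrm_minus mid_minus)
          then have "(\<Sum>u\<in>{ex, - ex, ey, - ey}. contrib u h (p + h *\<^sub>R u) (\<alpha> (\<phi> p)) (d h p)) =
              Q h p - (f ex (p + h *\<^sub>R ex) + f ex (p - h *\<^sub>R ex) + (f ey (p + h *\<^sub>R ey) + f ey (p - h *\<^sub>R ey)))"
            using distinct by (simp add: sum4 Q_def)
          then show ?thesis
            using bal[OF \<open>0 < h\<close> True] by (simp add: add.assoc)
        qed
        then have "x \<bullet> Q h p = x \<bullet> f ex (p + h *\<^sub>R ex) + x \<bullet> f ex (p - h *\<^sub>R ex) +
            x \<bullet> f ey (p + h *\<^sub>R ey) + x \<bullet> f ey (p - h *\<^sub>R ey)"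
          by (simp add: inner_add_right)
        \<comment> \<open>Each half edge contributes a nonnegative amount because impedances are
          positive. The two backward half edges are dropped, since two independent normals already
          control \<open>x\<close>.\<close>
        then have "x \<bullet> f ex (p + h *\<^sub>R ex) + x \<bullet> f ey (p + h *\<^sub>R ey) \<le> x \<bullet> Q h p"
          using f0[of ex "p - h *\<^sub>R ex"] f0[of ey "p - h *\<^sub>R ey"] by linarith
        also have "\<dots> \<le> norm x * norm (Q h p)" by (rule norm_cauchy_schwarz)
        finally have "norm x \<le> (T ex h p \<bullet> T ex h p + T ey h p \<bullet> T ey h p) *
          (inverse (inverse (norm (T ex h p)) * A ex h p) + inverse (inverse (norm (T ey h p)) * A ey h p)) *
          (inverse (cross2 (T ex h p) (T ey h p)))\<^sup>2 * norm (Q h p)"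
          using nz Apos' by (intro coercive_two_directions[OF c]) (auto simp: f T_def A_def)
        also have "\<dots> = ?rhs"
          using orient_cases by (auto simp: power2_eq_square)
        finally show ?thesis using True by (simp add: x_def)
      qed
    qed
  qed
qed

end

section \<open>Fluxes through one edge\<close>

text \<open>Here \<open>y\<close> stands for normal velocities, \<open>d\<close> for normal
  deviations at the ends, \<open>E\<close> for the velocity error and \<open>E2\<close> for the
  pressure error. The right-hand sides are arranged so that every product has total order four:
  \<open>E\<close> and \<open>E2\<close> have order 4, second differences and \<open>da + db\<close>
  order 2, first differences of field values order 1, and \<open>da - db\<close> order 3.\<close>

lemma edge_flux_identities:
  fixes Pa Pb Pm \<alpha>a \<alpha>b \<alpha>m ya yb ym da db :: real
  defines "k \<equiv> 2/3 * (ym - 1/2 * ya - 1/2 * yb)"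
  defines "E \<equiv> 1/2 * (da + db) - k"
  defines "pa \<equiv> 1/3 * Pa + 2/3 * Pm + \<alpha>m * k - (1/3 * \<alpha>a + 2/3 * \<alpha>m) * da"
    and "pb \<equiv> 1/3 * Pb + 2/3 * Pm + \<alpha>m * k - (1/3 * \<alpha>b + 2/3 * \<alpha>m) * db"
  defines "E2 \<equiv> 1/2 * (pa + pb) - (1/6 * Pa + 2/3 * Pm + 1/6 * Pb)"
  shows "E2 = - (\<alpha>m * E) - 1/12 * ((\<alpha>a + \<alpha>b - 2 *\<^sub>R \<alpha>m) * (da + db)) - 1/12 * ((\<alpha>a - \<alpha>b) * (da - db))"
    and "1/2 * (pa * (ya + da) + pb * (yb + db)) - (1/6 * (Pa * ya) + 2/3 * (Pm * ym) + 1/6 * (Pb * yb)) =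
      - (1/18) * ((Pa + Pb - 2 *\<^sub>R Pm) * (ya + yb - 2 *\<^sub>R ym)) + (1/6 * Pa + 2/3 * Pm + 1/6 * Pb) * E
      + E2 * (1/6 * ya + 2/3 * ym + 1/6 * yb + E) + 1/12 * ((Pa - Pb) * (da - db))
      - 1/24 * ((\<alpha>a - \<alpha>b) * (da + db) * (ya - yb + (da - db)))
      - 1/24 * ((\<alpha>a + \<alpha>b + 4 * \<alpha>m) * (da - db) * (ya - yb + (da - db)))"
  unfolding E2_def pa_def pb_def E_def k_def by (simp_all add: field_simps)

lemma edge_flux_order:
  fixes Pa Pb Pm \<alpha>a \<alpha>b \<alpha>m ya yb ym da db :: "real \<Rightarrow> 'a::euclidean_space \<Rightarrow> real"
  defines "k h q \<equiv> 2/3 * (ym h q - 1/2 * ya h q - 1/2 * yb h q)"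
  defines "pa h q \<equiv> 1/3 * Pa h q + 2/3 * Pm h q + \<alpha>m h q * k h q - (1/3 * \<alpha>a h q + 2/3 * \<alpha>m h q) * da h q"
    and "pb h q \<equiv> 1/3 * Pb h q + 2/3 * Pm h q + \<alpha>m h q * k h q - (1/3 * \<alpha>b h q + 2/3 * \<alpha>m h q) * db h q"
  assumes P: "sym_stencil 0 Pm Pa Pb" and \<alpha>: "sym_stencil 0 \<alpha>m \<alpha>a \<alpha>b" and y: "sym_stencil 0 ym ya yb"
    and da: "Oh 2 da" and db: "Oh 2 db" and dd: "Oh 3 (\<lambda>h q. da h q - db h q)"
    and E: "Oh 4 (\<lambda>h q. 1/2 * (da h q + db h q) - k h q)"
  shows "Oh 4 (\<lambda>h q. 1/2 * (pa h q + pb h q) - (1/6 * Pa h q + 2/3 * Pm h q + 1/6 * Pb h q))"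
    and "Oh 4 (\<lambda>h q. 1/2 * (pa h q * (ya h q + da h q) + pb h q * (yb h q + db h q)) -
      (1/6 * (Pa h q * ya h q) + 2/3 * (Pm h q * ym h q) + 1/6 * (Pb h q * yb h q)))"
proof -
  note P = sym_stencilD[OF P, simplified] and \<alpha> = sym_stencilD[OF \<alpha>, simplified]
    and y = sym_stencilD[OF y, simplified]
  have c: "Oh p (\<lambda>h q. c * F h q)" if "Oh p F" for c :: real and p and F :: "real \<Rightarrow> 'a \<Rightarrow> real"
    using Oh_scaleR[OF that, of c] by simp
  note mult = Oh_mult
  have s: "Oh 2 (\<lambda>h q. da h q + db h q)" by (rule Oh_add[OF da db])
  have dy: "Oh 1 (\<lambda>h q. ya h q - yb h q + (da h q - db h q))"
    using Oh_add[OF y(7) Oh_mono[OF dd, of "Suc 0"]] by simp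
  have E0: "Oh 0 (\<lambda>h q. 1/2 * (da h q + db h q) - k h q)" by (rule Oh_mono[OF E]) simp
  show *: "Oh 4 (\<lambda>h q. 1/2 * (pa h q + pb h q) - (1/6 * Pa h q + 2/3 * Pm h q + 1/6 * Pb h q))"
    unfolding pa_def pb_def k_def edge_flux_identities(1)
    by (intro Oh_diff Oh_minus c mult[OF \<alpha>(1) E[unfolded k_def]] mult[OF \<alpha>(4)[folded real_scaleR_def] s] mult[OF \<alpha>(7) dd])
      simp_all
  show "Oh 4 (\<lambda>h q. 1/2 * (pa h q * (ya h q + da h q) + pb h q * (yb h q + db h q)) -
      (1/6 * (Pa h q * ya h q) + 2/3 * (Pm h q * ym h q) + 1/6 * (Pb h q * yb h q)))"
    unfolding pa_def pb_def k_def edge_flux_identities(2)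
    by (intro Oh_diff Oh_add c mult[OF P(4)[folded real_scaleR_def] y(4)[folded real_scaleR_def]]
        mult[OF Oh_add[OF Oh_add[OF c[OF P(5)] c[OF P(1)]] c[OF P(6)]] E[unfolded k_def]]
        mult[OF *[unfolded pa_def pb_def k_def]
          Oh_add[OF Oh_add[OF Oh_add[OF c[OF y(5)] c[OF y(1)]] c[OF y(6)]] E0[unfolded k_def]]]
        mult[OF P(7) dd] mult[OF mult[OF \<alpha>(7) s refl] dy]
        mult[OF mult[OF Oh_add[OF Oh_add[OF \<alpha>(5,6)] c[OF \<alpha>(1)]] dd refl] dy]) simp_all
qed

lemma sym_stencil_swap: "sym_stencil p F\<^sub>0 F\<^sub>1 F\<^sub>2 \<Longrightarrow> sym_stencil p F\<^sub>0 F\<^sub>2 F\<^sub>1"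
  by (simp add: sym_stencil_def add.commute)

context lagrangian_scheme
begin

definition unit_nrm :: "real^2 \<Rightarrow> real \<Rightarrow> real^2 \<Rightarrow> real^2" where
  "unit_nrm u h q = inverse (norm (nrm u h q)) *\<^sub>R nrm u h q"

text \<open>The jump condition on the half edge at the parameter node \<open>p\<close> of the edge
  centred at \<open>q\<close>, with the nodal velocity written as field velocity plus
  \<open>d\<close>.\<close>

definition press :: "(real \<Rightarrow> real^2 \<Rightarrow> real^2) \<Rightarrow> real^2 \<Rightarrow> real \<Rightarrow> real^2 \<Rightarrow> real^2 \<Rightarrow> real" where
  "press d u h q p = 1/3 * P (\<phi> p) + 2/3 * P (mid u h q) + \<alpha> (mid u h q) * (curv u h q \<bullet> unit_nrm u h q)
     - (1/3 * \<alpha> (\<phi> p) + 2/3 * \<alpha> (mid u h q)) * (d h p \<bullet> unit_nrm u h q)"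

context
  fixes d :: "real \<Rightarrow> real^2 \<Rightarrow> real^2" and u :: "real^2"
  assumes d: "Oh 4 (\<lambda>h p. d h p - defect h p)" and u: "u \<in> {ex, - ex, ey, - ey}"
begin

lemma Oh_unit_nrm: "Oh 0 (unit_nrm u)"
proof -
  have "u \<noteq> 0" using u by (auto simp: vec_eq_iff forall_2)
  then show ?thesis
    unfolding unit_nrm_def[abs_def]
    using second_order_Oh[OF second_order_scale[OF second_order_inverse_norm_nrm second_order_nrm]] by auto
qed

lemma edge_stencil:
  fixes f :: "real^2 \<Rightarrow> 'b::real_normed_vector"
  assumes "smooth f"
  shows "sym_stencil 0 (\<lambda>h q. f (mid u h q)) (\<lambda>h q. f (\<phi> (q - h *\<^sub>R u))) (\<lambda>h q. f (\<phi> (q + h *\<^sub>R u)))"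
  by (rule sym_stencil_recentre[OF sym_stencil_swap[OF second_orderD[OF second_order_smooth_node[OF assms]]]])
    (use mid_node[OF assms] in \<open>simp add: numeral_2_eq_2\<close>)

text \<open>The sum of three small pieces: the fourth-order errors of \<open>d\<close> against
  \<open>defect\<close> at the two ends, half the second difference of \<open>defect\<close> across
  the edge, and the normal component of \<open>defect - curv\<close> at the centre, which vanishes
  for small \<open>h\<close>.\<close>

lemma edge_velocity:
  "Oh 4 (\<lambda>h q. 1/2 * (d h (q - h *\<^sub>R u) \<bullet> unit_nrm u h q + d h (q + h *\<^sub>R u) \<bullet> unit_nrm u h q)
    - curv u h q \<bullet> unit_nrm u h q)"
proof -
  note D = sym_stencilD[OF second_orderD[OF second_order_defect, of u], simplified]
  have "Oh 4 (\<lambda>h q. (defect h q - curv u h q) \<bullet> unit_nrm u h q)"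
  proof (rule Oh_cong[OF Oh_zero])
    show "\<forall>\<^sub>F h in at_right 0. \<forall>q\<in>cball 0 R. (defect h q - curv u h q) \<bullet> unit_nrm u h q = 0" if "R > 0" for R
      using defect_normal[OF that u]
      by (rule eventually_mono) (simp add: unit_nrm_def inner_diff_left inner_diff_right inner_commute)
  qed
  moreover have "Oh 4 (\<lambda>h q. (1/2) *\<^sub>R ((d h (q - h *\<^sub>R u) - defect h (q - h *\<^sub>R u)) \<bullet> unit_nrm u h q +
      (d h (q + h *\<^sub>R u) - defect h (q + h *\<^sub>R u)) \<bullet> unit_nrm u h q))"
    by (intro Oh_scaleR Oh_add Oh_inner[OF Oh_shift[OF d] Oh_unit_nrm] Oh_inner[OF Oh_shift_minus[OF d] Oh_unit_nrm]) auto
  moreover have "Oh 4 (\<lambda>h q. (1/2) *\<^sub>R ((defect h (q + h *\<^sub>R u) + defect h (q - h *\<^sub>R u) - 2 *\<^sub>R defect h q) \<bullet> unit_nrm u h q))"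
    by (intro Oh_scaleR Oh_inner[OF D(4) Oh_unit_nrm]) auto
  ultimately show ?thesis
    by (rule Oh_cong[OF Oh_add[OF Oh_add]]) (simp add: inner_add_left inner_diff_left field_simps)
qed

lemma edge_order:
  shows "Oh 4 (\<lambda>h q. 1/2 * (press d u h q (q - h *\<^sub>R u) + press d u h q (q + h *\<^sub>R u)) -
      (1/6 * P (\<phi> (q - h *\<^sub>R u)) + 2/3 * P (mid u h q) + 1/6 * P (\<phi> (q + h *\<^sub>R u))))" (is ?mom)
    and "Oh 4 (\<lambda>h q. 1/2 * (press d u h q (q - h *\<^sub>R u) * ((v (\<phi> (q - h *\<^sub>R u)) + d h (q - h *\<^sub>R u)) \<bullet> unit_nrm u h q) +
          press d u h q (q + h *\<^sub>R u) * ((v (\<phi> (q + h *\<^sub>R u)) + d h (q + h *\<^sub>R u)) \<bullet> unit_nrm u h q)) -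
      (1/6 * (P (\<phi> (q - h *\<^sub>R u)) * (v (\<phi> (q - h *\<^sub>R u)) \<bullet> unit_nrm u h q)) +
       2/3 * (P (mid u h q) * (v (mid u h q) \<bullet> unit_nrm u h q)) +
       1/6 * (P (\<phi> (q + h *\<^sub>R u)) * (v (\<phi> (q + h *\<^sub>R u)) \<bullet> unit_nrm u h q))))" (is ?en)
proof -
  note D = sym_stencilD[OF second_orderD[OF second_order_defect, of u], simplified]
  have d2: "Oh 2 d"
    using Oh_add[OF Oh_mono[OF d, of 2] second_order_Oh[OF second_order_defect]] by simp
  have a: "Oh 2 (\<lambda>h q. d h (q - h *\<^sub>R u) \<bullet> unit_nrm u h q)" "Oh 2 (\<lambda>h q. d h (q + h *\<^sub>R u) \<bullet> unit_nrm u h q)"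
    by (rule Oh_inner[OF Oh_shift_minus[OF d2] Oh_unit_nrm] Oh_inner[OF Oh_shift[OF d2] Oh_unit_nrm], simp)+
  \<comment> \<open>Across the edge the deviation varies by one order less than its size, as
    \<open>defect\<close> does; the fourth-order error between the two is negligible here.\<close>
  have dd: "Oh 3 (\<lambda>h q. d h (q - h *\<^sub>R u) - d h (q + h *\<^sub>R u))"
    using Oh_diff[OF Oh_mono[OF Oh_diff[OF Oh_shift_minus[OF d, of u] Oh_shift[OF d, of u]]], of 3, OF _ D(7)]
    by simp
  have b: "Oh 3 (\<lambda>h q. d h (q - h *\<^sub>R u) \<bullet> unit_nrm u h q - d h (q + h *\<^sub>R u) \<bullet> unit_nrm u h q)"
    using Oh_inner[OF dd Oh_unit_nrm, of 3] by (simp add: inner_diff_left)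
  have y: "sym_stencil 0 (\<lambda>h q. v (mid u h q) \<bullet> unit_nrm u h q) (\<lambda>h q. v (\<phi> (q - h *\<^sub>R u)) \<bullet> unit_nrm u h q)
      (\<lambda>h q. v (\<phi> (q + h *\<^sub>R u)) \<bullet> unit_nrm u h q)"
    by (rule sym_stencil_inner[OF edge_stencil[OF smooth_v] sym_stencil_frozen[OF Oh_unit_nrm]]) simp
  have k: "curv u h q \<bullet> unit_nrm u h q = 2/3 * (v (mid u h q) \<bullet> unit_nrm u h q
      - 1/2 * (v (\<phi> (q - h *\<^sub>R u)) \<bullet> unit_nrm u h q) - 1/2 * (v (\<phi> (q + h *\<^sub>R u)) \<bullet> unit_nrm u h q))" for h q
    by (simp add: curv_def inner_diff_left)
  note * = edge_flux_order[OF edge_stencil[OF smooth_P] edge_stencil[OF smooth_\<alpha>] y a b edge_velocity[unfolded k]]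
  show ?mom using *(1) unfolding press_def k .
  show ?en using *(2) unfolding press_def k inner_add_left .
qed

end

end

section \<open>Simpson's rule\<close>

lemma smooth_Pair:
  assumes "smooth f" "smooth g" shows "smooth (\<lambda>x. (f x, g x))"
proof -
  have "bounded_linear (\<lambda>x. (x, 0))" "bounded_linear (\<lambda>x. (0, x))"
    by (intro bounded_linear_Pair bounded_linear_ident bounded_linear_zero)+
  from smooth_add[OF smooth_linear_compose[OF this(1) assms(1)] smooth_linear_compose[OF this(2) assms(2)]]
  show ?thesis by simp
qed

text \<open>Simpson's rule is exact for cubics, so only the remainder counts. It contributes at most
  \<open>M\<close> to the integral over the unit interval and at most \<open>M\<close> to the
  weighted sum, because the positive weights add up to 1.\<close>

lemma simpson_cubic_remainder:
  fixes g :: "real \<Rightarrow> 'b::euclidean_space"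
  assumes g: "continuous_on {0..1} g"
    and r: "\<And>t. t \<in> {0..1} \<Longrightarrow> norm (g t - (c0 + t *\<^sub>R c1 + t\<^sup>2 *\<^sub>R c2 + t ^ 3 *\<^sub>R c3)) \<le> M"
  shows "norm ((1/6) *\<^sub>R g 0 + (2/3) *\<^sub>R g (1/2) + (1/6) *\<^sub>R g 1 - integral {0..1} g) \<le> 2 * M"
proof -
  define p where "p t = c0 + t *\<^sub>R c1 + t\<^sup>2 *\<^sub>R c2 + t ^ 3 *\<^sub>R c3" for t
  have "(p has_integral (1 *\<^sub>R c0 + (1\<^sup>2 / 2) *\<^sub>R c1 + (1 ^ 3 / 3) *\<^sub>R c2 + (1 ^ 4 / 4) *\<^sub>R c3) -
      (0 *\<^sub>R c0 + (0\<^sup>2 / 2) *\<^sub>R c1 + (0 ^ 3 / 3) *\<^sub>R c2 + (0 ^ 4 / 4) *\<^sub>R c3)) {0..1}"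
    unfolding p_def
    by (rule fundamental_theorem_of_calculus) (auto intro!: derivative_eq_intros)
  then have p: "(p has_integral c0 + (1/2) *\<^sub>R c1 + (1/3) *\<^sub>R c2 + (1/4) *\<^sub>R c3) {0..1}" by simp
  have gi: "(g has_integral integral {0..1} g) {0..1}"
    by (intro integrable_integral integrable_continuous_interval g)
  have "norm (integral {0..1} g - (c0 + (1/2) *\<^sub>R c1 + (1/3) *\<^sub>R c2 + (1/4) *\<^sub>R c3)) \<le> M * measure lborel {0..1::real}"
    by (rule has_integral_bound_real[OF _ finite.emptyI has_integral_diff[OF gi p]])
      (use r order_trans[OF norm_ge_zero r[of 0]] in \<open>auto simp: p_def\<close>)
  then have "norm (integral {0..1} g - (c0 + (1/2) *\<^sub>R c1 + (1/3) *\<^sub>R c2 + (1/4) *\<^sub>R c3)) \<le> M" by simp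
  moreover have "norm ((1/6) *\<^sub>R (g 0 - p 0) + (2/3) *\<^sub>R (g (1/2) - p (1/2)) + (1/6) *\<^sub>R (g 1 - p 1))
      \<le> 1/6 * M + 2/3 * M + 1/6 * M"
    by (intro norm_triangle_mono) (use r[of 0] r[of "1/2"] r[of 1] in \<open>simp_all add: p_def\<close>)
  moreover have "(1/6) *\<^sub>R p 0 + (2/3) *\<^sub>R p (1/2) + (1/6) *\<^sub>R p 1 = c0 + (1/2) *\<^sub>R c1 + (1/3) *\<^sub>R c2 + (1/4) *\<^sub>R c3"
    by (rule euclidean_eqI) (simp add: p_def inner_add_left power2_eq_square power3_eq_cube field_simps)
  then have eq: "(1/6) *\<^sub>R g 0 + (2/3) *\<^sub>R g (1/2) + (1/6) *\<^sub>R g 1 - integral {0..1} g =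
      ((1/6) *\<^sub>R (g 0 - p 0) + (2/3) *\<^sub>R (g (1/2) - p (1/2)) + (1/6) *\<^sub>R (g 1 - p 1)) -
      (integral {0..1} g - (c0 + (1/2) *\<^sub>R c1 + (1/3) *\<^sub>R c2 + (1/4) *\<^sub>R c3))"
    by (simp add: algebra_simps)
  ultimately show ?thesis
    unfolding eq using norm_triangle_ineq4[of "(1/6) *\<^sub>R (g 0 - p 0) + (2/3) *\<^sub>R (g (1/2) - p (1/2)) + (1/6) *\<^sub>R (g 1 - p 1)"
        "integral {0..1} g - (c0 + (1/2) *\<^sub>R c1 + (1/3) *\<^sub>R c2 + (1/4) *\<^sub>R c3)"]
    by linarith
qed

lemma cubic_taylor_bound:
  fixes g :: "real \<Rightarrow> 'b::real_normed_vector"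
  assumes "s \<ge> 0"
    and "\<And>x. (g has_vector_derivative g1 x) (at x within {0..s})"
    and "\<And>x. (g1 has_vector_derivative g2 x) (at x within {0..s})"
    and "\<And>x. (g2 has_vector_derivative g3 x) (at x within {0..s})"
    and "\<And>x. (g3 has_vector_derivative g4 x) (at x within {0..s})"
    and M: "\<And>x. x \<in> {0..s} \<Longrightarrow> norm (g4 x) \<le> M"
  shows "norm (g s - (g 0 + s *\<^sub>R g1 0 + s\<^sup>2 *\<^sub>R ((1/2) *\<^sub>R g2 0) + s ^ 3 *\<^sub>R ((1/6) *\<^sub>R g3 0))) \<le> M * s ^ 4"
proof -
  have "M \<ge> 0" using M[of 0] assms(1) order_trans[OF norm_ge_zero] by auto
  \<comment> \<open>One integration, with the length \<open>x\<close> enlarged to \<open>s\<close>,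
    so that the bound is constant on the interval and can be used in the next integration. The
    factorials of the sharp remainder are given up.\<close>
  have step: "norm (f x) \<le> B * s" if "x \<in> {0..s}" "f 0 = 0"
    "\<And>y. y \<in> {0..s} \<Longrightarrow> (f has_vector_derivative f' y) (at y within {0..s})"
    "\<And>y. y \<in> {0..s} \<Longrightarrow> norm (f' y) \<le> B" for f f' :: "real \<Rightarrow> 'b" and B x
  proof -
    have "B \<ge> 0" using that(4)[of 0] assms(1) order_trans[OF norm_ge_zero] by auto
    have "norm (f x) \<le> B * x"
    proof (rule zero_start_bound[where f'=f'])
      fix y assume "y \<in> {0..x}"
      then have "y \<in> {0..s}" "{0..x} \<subseteq> {0..s}" using that(1) by auto
      then show "(f has_vector_derivative f' y) (at y within {0..x})" "norm (f' y) \<le> B"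
        using that(3,4) has_vector_derivative_within_subset by blast+
    qed (use that in auto)
    also have "\<dots> \<le> B * s" using that(1) \<open>B \<ge> 0\<close> by (auto intro: mult_left_mono)
    finally show ?thesis by simp
  qed
  have 3: "norm (g3 x - g3 0) \<le> M * s" if "x \<in> {0..s}" for x
    by (rule step[OF that, of "\<lambda>x. g3 x - g3 0" g4 M])
      (use M in \<open>auto intro!: derivative_eq_intros assms\<close>)
  have 2: "norm (g2 x - g2 0 - x *\<^sub>R g3 0) \<le> M * s * s" if "x \<in> {0..s}" for x
    by (rule step[OF that, of "\<lambda>x. g2 x - g2 0 - x *\<^sub>R g3 0" "\<lambda>x. g3 x - g3 0" "M * s"])
      (use 3 in \<open>auto intro!: derivative_eq_intros assms\<close>)
  have 1: "norm (g1 x - g1 0 - x *\<^sub>R g2 0 - (x\<^sup>2 / 2) *\<^sub>R g3 0) \<le> M * s * s * s" if "x \<in> {0..s}" for x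
    by (rule step[OF that, of "\<lambda>x. g1 x - g1 0 - x *\<^sub>R g2 0 - (x\<^sup>2 / 2) *\<^sub>R g3 0"
        "\<lambda>x. g2 x - g2 0 - x *\<^sub>R g3 0" "M * s * s"])
      (use 2 in \<open>auto intro!: derivative_eq_intros assms\<close>)
  have "norm (g s - g 0 - s *\<^sub>R g1 0 - (s\<^sup>2 / 2) *\<^sub>R g2 0 - (s ^ 3 / 6) *\<^sub>R g3 0) \<le> M * s * s * s * s"
    by (rule step[of s "\<lambda>s. g s - g 0 - s *\<^sub>R g1 0 - (s\<^sup>2 / 2) *\<^sub>R g2 0 - (s ^ 3 / 6) *\<^sub>R g3 0"
        "\<lambda>x. g1 x - g1 0 - x *\<^sub>R g2 0 - (x\<^sup>2 / 2) *\<^sub>R g3 0" "M * s * s * s"])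
      (use 1 assms(1) in \<open>auto intro!: derivative_eq_intros assms\<close>)
  then show ?thesis by (simp add: power4_eq_xxxx mult.assoc diff_diff_eq)
qed

text \<open>Restricting \<open>f\<close> to a segment is a smooth function of base point, direction
  and arc length jointly. Its fourth derivative in arc length is bounded on a compact set of all
  three, which makes the constant uniform over the segments.\<close>

lemma simpson_error:
  fixes f :: "'a::euclidean_space \<Rightarrow> 'b::euclidean_space"
  assumes f: "smooth f"
  shows "\<exists>C\<ge>0. \<forall>a\<in>cball 0 R. \<forall>b\<in>cball 0 R.
    norm ((1/6) *\<^sub>R f a + (2/3) *\<^sub>R f (midpoint a b) + (1/6) *\<^sub>R f b - integral {0..1} (\<lambda>t. f (linepath a b t)))
      \<le> C * dist a b ^ 4"
proof -
  define G where "G x = f (fst (fst x) + snd x *\<^sub>R snd (fst x))" for x :: "('a \<times> 'a) \<times> real"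
  define D where "D H x = frechet_derivative H (at x) ((0, 0), 1)" for H :: "('a \<times> 'a) \<times> real \<Rightarrow> 'b" and x
  have G: "smooth G"
    unfolding G_def
    by (intro smooth_compose[OF f] smooth_add smooth_scaleR smooth_bounded_linear bounded_linear_compose[OF bounded_linear_fst]
        bounded_linear_compose[OF bounded_linear_snd] bounded_linear_fst bounded_linear_snd)
  have D: "smooth (D H)" if "smooth H" for H
    unfolding D_def[abs_def] by (rule smooth_deriv[OF that])
  have line: "((\<lambda>s. H (z, s)) has_vector_derivative D H (z, s)) (at s within S)" if "smooth H" for H z s S
    using smooth_has_vector_derivative_line[OF that, of "(z, 0)" "((0, 0), 1)" s S]
    by (cases z) (simp add: D_def)
  obtain M where M: "M \<ge> 0" "\<And>x. x \<in> (cball 0 R \<times> cball 0 1) \<times> {0..2 * R} \<Longrightarrow> norm (D (D (D (D G))) x) \<le> M"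
    using smooth_bounded_on[of "D (D (D (D G)))" "(cball 0 R \<times> cball 0 1) \<times> {0..2 * R}"] D G
    by (metis compact_Times compact_cball compact_Icc)
  show ?thesis
  proof (intro exI[of _ "2 * M"] conjI ballI)
    fix a b :: 'a assume ab: "a \<in> cball 0 R" "b \<in> cball 0 R"
    define l where "l = dist a b"
    \<comment> \<open>For \<open>a = b\<close> this is zero, as the inverse of zero is zero. Hence
      \<open>d\<close> lies in the closed unit ball, not only on the sphere.\<close>
    define d where "d = (b - a) /\<^sub>R l"
    have ld: "l *\<^sub>R d = b - a" by (cases "a = b") (simp_all add: d_def l_def)
    have d: "d \<in> cball 0 1" by (cases "a = b") (simp_all add: d_def l_def dist_norm norm_minus_commute)
    have l: "l \<ge> 0" "l \<le> 2 * R"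
      using ab norm_triangle_ineq4[of a b] by (auto simp: l_def dist_norm)
    define g where "g t = f (linepath a b t)" for t
    have gG: "g t = G ((a, d), t * l)" for t
    proof -
      have "linepath a b t = a + t *\<^sub>R (b - a)" by (simp add: linepath_def algebra_simps)
      then show ?thesis by (simp add: g_def G_def flip: ld)
    qed
    let ?z = "((a, d), 0)"
    have "norm ((1/6) *\<^sub>R g 0 + (2/3) *\<^sub>R g (1/2) + (1/6) *\<^sub>R g 1 - integral {0..1} g) \<le> 2 * (M * l ^ 4)"
    proof (rule simpson_cubic_remainder)
      show "continuous_on {0..1} g"
        unfolding g_def linepath_def
        by (intro continuous_on_compose2[OF smooth_continuous_on[OF f, of UNIV]] continuous_intros) auto
      fix t :: real assume t: "t \<in> {0..1}"
      have tl: "0 \<le> t * l" "t * l \<le> l" using t l by (auto intro: mult_left_le_one_le)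
      have "norm (G ((a, d), t * l) - (G ?z + (t * l) *\<^sub>R D G ?z + (t * l)\<^sup>2 *\<^sub>R ((1/2) *\<^sub>R D (D G) ?z) +
          (t * l) ^ 3 *\<^sub>R ((1/6) *\<^sub>R D (D (D G)) ?z))) \<le> M * (t * l) ^ 4"
        by (rule cubic_taylor_bound[where g="\<lambda>s. G ((a, d), s)" and ?g1.0="\<lambda>s. D G ((a, d), s)"
              and ?g2.0="\<lambda>s. D (D G) ((a, d), s)" and ?g3.0="\<lambda>s. D (D (D G)) ((a, d), s)"
              and ?g4.0="\<lambda>s. D (D (D (D G))) ((a, d), s)"])
          (use tl l ab d in \<open>auto intro!: line D G M(2) simp del: mem_cball\<close>)
      also have "\<dots> \<le> M * l ^ 4" using tl M(1) by (intro mult_left_mono power_mono) auto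
      finally show "norm (g t - (G ?z + t *\<^sub>R (l *\<^sub>R D G ?z) + t\<^sup>2 *\<^sub>R (l\<^sup>2 *\<^sub>R (1/2) *\<^sub>R D (D G) ?z) +
          t ^ 3 *\<^sub>R (l ^ 3 *\<^sub>R (1/6) *\<^sub>R D (D (D G)) ?z))) \<le> M * l ^ 4"
        by (simp add: gG power_mult_distrib mult_ac)
    qed
    moreover have "g 0 = f a" "g 1 = f b" "g (1/2) = f (midpoint a b)"
      by (simp_all add: g_def linepath_def midpoint_def scaleR_add_right)
    ultimately show "norm ((1/6) *\<^sub>R f a + (2/3) *\<^sub>R f (midpoint a b) + (1/6) *\<^sub>R f b -
        integral {0..1} (\<lambda>t. f (linepath a b t))) \<le> 2 * M * dist a b ^ 4"
      by (simp add: g_def[abs_def] l_def)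
  qed (use M in simp)
qed

section \<open>The half edges at a node\<close>

text \<open>Grid indices of the vertices of a cell, where \<open>pos\<close> tells whether the mesh map preserves the
  orientation.\<close>

definition vertex_index :: "bool \<Rightarrow> cell \<Rightarrow> nat \<Rightarrow> int \<times> int" where
  "vertex_index pos i r =
     (let c = (if pos then r else 3 * r) mod 4
      in (fst i + (if c \<in> {1, 2} then 1 else 0), snd i + (if c \<in> {2, 3} then 1 else 0)))"

lemma vertex_eq_node:
  "vertex \<phi> h i r = node \<phi> h (fst (vertex_index (signed_area \<phi> h i > 0) i r))
     (snd (vertex_index (signed_area \<phi> h i > 0) i r))"
  by (simp add: vertex_def corner_def vertex_index_def Let_def)

text \<open>The four cells with the node \<open>(k, l)\<close> as a corner; membership does not
  depend on the direction in which vertices are numbered.\<close>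

definition cells_at :: "int \<Rightarrow> int \<Rightarrow> cell set" where
  "cells_at k l = {k - 1, k} \<times> {l - 1, l}"

lemma vertex_index_cells_at: "vertex_index pos i r = (k, l) \<Longrightarrow> i \<in> cells_at k l"
  by (cases i) (auto simp: vertex_index_def cells_at_def Let_def split: if_splits)

text \<open>Listed in the order of the directions east, north, west, south.\<close>

definition half_edge_list :: "bool \<Rightarrow> int \<Rightarrow> int \<Rightarrow> (cell \<times> nat \<times> cell \<times> nat) list" where
  "half_edge_list pos k l =
    (if pos then
       [((k, l), 0, (k, l - 1), 2), ((k - 1, l), 1, (k, l), 3),
        ((k - 1, l - 1), 2, (k - 1, l), 0), ((k, l - 1), 3, (k - 1, l - 1), 1)]
     else
       [((k, l - 1), 1, (k, l), 3), ((k, l), 0, (k - 1, l), 2),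
        ((k - 1, l), 3, (k - 1, l - 1), 1), ((k - 1, l - 1), 2, (k, l - 1), 0)])"

lemma vertex_index_values:
  "vertex_index True i 0 = i" "vertex_index True i 1 = (fst i + 1, snd i)"
  "vertex_index True i 2 = (fst i + 1, snd i + 1)" "vertex_index True i 3 = (fst i, snd i + 1)"
  "vertex_index True i 4 = i"
  "vertex_index False i 0 = i" "vertex_index False i 1 = (fst i, snd i + 1)"
  "vertex_index False i 2 = (fst i + 1, snd i + 1)" "vertex_index False i 3 = (fst i + 1, snd i)"
  "vertex_index False i 4 = i"
  by (simp_all add: vertex_index_def)

lemma Suc_values: "Suc 0 = 1" "Suc 1 = 2" "Suc 2 = 3" "Suc 3 = 4"
  by simp_all

text \<open>Once \<open>r\<close>, \<open>s\<close> and the orientation are fixed, all grid indices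
  are explicit and the claim is linear integer arithmetic; hence the exhaustive case split.\<close>

lemma half_edge_list_iff:
  "(i, r, j, s) \<in> set (half_edge_list pos k l) \<longleftrightarrow>
     r < 4 \<and> s < 4 \<and> vertex_index pos i r = (k, l) \<and> vertex_index pos j (Suc s) = (k, l) \<and>
     vertex_index pos i (Suc r) = vertex_index pos j s"
proof -
  obtain a b c d where ij: "i = (a, b)" "j = (c, d)" by (cases i, cases j)
  consider "r = 0" | "r = 1" | "r = 2" | "r = 3" | "r \<ge> 4" by linarith
  then show ?thesis
  proof cases
    case 1
    consider "s = 0" | "s = 1" | "s = 2" | "s = 3" | "s \<ge> 4" by linarith
    then show ?thesis
      by cases (cases pos; simp only: ij 1 Suc_values vertex_index_values; simp add: half_edge_list_def; linarith?)+
  next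
    case 2
    consider "s = 0" | "s = 1" | "s = 2" | "s = 3" | "s \<ge> 4" by linarith
    then show ?thesis
      by cases (cases pos; simp only: ij 2 Suc_values vertex_index_values; simp add: half_edge_list_def; linarith?)+
  next
    case 3
    consider "s = 0" | "s = 1" | "s = 2" | "s = 3" | "s \<ge> 4" by linarith
    then show ?thesis
      by cases (cases pos; simp only: ij 3 Suc_values vertex_index_values; simp add: half_edge_list_def; linarith?)+
  next
    case 4
    consider "s = 0" | "s = 1" | "s = 2" | "s = 3" | "s \<ge> 4" by linarith
    then show ?thesis
      by cases (cases pos; simp only: ij 4 Suc_values vertex_index_values; simp add: half_edge_list_def; linarith?)+
  next
    case 5
    then show ?thesis by (auto simp: half_edge_list_def)
  qed
qed

text \<open>The far ends come in the same order for both orientations. After this point the balance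
  at a node no longer depends on how vertices are numbered.\<close>

lemma half_edge_list_neighbours:
  "map (\<lambda>(i, r, j, s). vertex_index pos i (Suc r)) (half_edge_list pos k l) =
     [(k + 1, l), (k, l + 1), (k - 1, l), (k, l - 1)]"
  by (cases pos) (simp_all add: half_edge_list_def Suc_values vertex_index_values del: One_nat_def)

lemma distinct_half_edge_list: "distinct (half_edge_list pos k l)"
  by (simp add: half_edge_list_def)

text \<open>Each edge of a cell is met from both of its ends, in the first and in the second role of
  a half edge. So the jump condition fixes both \<open>PA\<close> and \<open>PB\<close> on
  it.\<close>

lemma half_edge_list_total:
  assumes "r < 4"
  shows "\<exists>j s. (i, r, j, s) \<in> set (case vertex_index pos i r of (k, l) \<Rightarrow> half_edge_list pos k l)"
    and "\<exists>j s. (j, s, i, r) \<in> set (case vertex_index pos i (Suc r) of (k, l) \<Rightarrow> half_edge_list pos k l)"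
proof -
  consider "r = 0" | "r = 1" | "r = 2" | "r = 3" using assms by linarith
  note r = this
  show "\<exists>j s. (i, r, j, s) \<in> set (case vertex_index pos i r of (k, l) \<Rightarrow> half_edge_list pos k l)"
    using r by cases (cases i; cases pos; simp only: vertex_index_values; simp add: half_edge_list_def)+
  show "\<exists>j s. (j, s, i, r) \<in> set (case vertex_index pos i (Suc r) of (k, l) \<Rightarrow> half_edge_list pos k l)"
    using r by cases (cases i; cases pos; simp only: Suc_values vertex_index_values; simp add: half_edge_list_def)+
qed

lemma edge_direction:
  assumes "r < 4"
  shows "(fst (vertex_index pos i (Suc r)) - fst (vertex_index pos i r),
     snd (vertex_index pos i (Suc r)) - snd (vertex_index pos i r)) \<in> {(1, 0), (- 1, 0), (0, 1), (0, - 1)}"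
proof -
  consider "r = 0" | "r = 1" | "r = 2" | "r = 3" using assms by linarith
  then show ?thesis by cases (cases pos; simp only: Suc_values vertex_index_values; simp)+
qed

section \<open>Orientation of the cells and identification of the half edges\<close>

definition grid :: "real \<Rightarrow> int \<Rightarrow> int \<Rightarrow> real^2" where
  "grid h k l = vector [of_int k * (2 * h), of_int l * (2 * h)]"

lemma node_grid: "node \<phi> (2 * h) k l = \<phi> (grid h k l)"
  by (simp add: node_def grid_def)

lemma grid_inject: "h > 0 \<Longrightarrow> grid h k l = grid h k' l' \<longleftrightarrow> k = k' \<and> l = l'"
  by (auto simp: grid_def vec_eq_iff forall_2)

context mesh_map
begin

lemma map_inject: "\<phi> x = \<phi> y \<longleftrightarrow> x = y"
  using inv_map by metis

text \<open>The shoelace formula for a quadrilateral is half the cross product of its diagonals, and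
  both diagonals are chords about the common parameter centre of the cell.\<close>

lemma signed_area_chords:
  assumes "h > 0"
  shows "signed_area \<phi> (2 * h) (k, l) = 1/2 * h\<^sup>2 *
    cross2 (chord (ex + ey) h (grid h k l + h *\<^sub>R (ex + ey))) (chord (ey - ex) h (grid h k l + h *\<^sub>R (ex + ey)))"
proof -
  let ?q = "grid h k l + h *\<^sub>R (ex + ey)"
  have g: "grid h k l = ?q - h *\<^sub>R (ex + ey)" "grid h (k + 1) l = ?q - h *\<^sub>R (ey - ex)"
    "grid h (k + 1) (l + 1) = ?q + h *\<^sub>R (ex + ey)" "grid h k (l + 1) = ?q + h *\<^sub>R (ey - ex)"
    by (simp_all add: grid_def vec_eq_iff forall_2 algebra_simps)
  have c: "corner \<phi> (2 * h) (k, l) 0 = \<phi> (?q - h *\<^sub>R (ex + ey))" "corner \<phi> (2 * h) (k, l) 1 = \<phi> (?q - h *\<^sub>R (ey - ex))"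
    "corner \<phi> (2 * h) (k, l) 2 = \<phi> (?q + h *\<^sub>R (ex + ey))" "corner \<phi> (2 * h) (k, l) 3 = \<phi> (?q + h *\<^sub>R (ey - ex))"
    "corner \<phi> (2 * h) (k, l) 4 = \<phi> (?q - h *\<^sub>R (ex + ey))"
    unfolding corner_def node_grid using g by simp_all
  have sum4: "(\<Sum>r<4. f r (Suc r)) = f 0 1 + f 1 2 + f 2 3 + f 3 4" for f :: "nat \<Rightarrow> nat \<Rightarrow> real"
    by (simp add: eval_nat_numeral)
  have "signed_area \<phi> (2 * h) (k, l) = 1/2 * cross2 (corner \<phi> (2 * h) (k, l) 2 - corner \<phi> (2 * h) (k, l) 0)
      (corner \<phi> (2 * h) (k, l) 3 - corner \<phi> (2 * h) (k, l) 1)"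
    unfolding signed_area_def sum4[of "\<lambda>r s. corner _ _ _ r $ 1 * corner _ _ _ s $ 2 - corner _ _ _ r $ 2 * corner _ _ _ s $ 1"]
      c cross2_def by (simp add: algebra_simps)
  moreover have "corner \<phi> (2 * h) (k, l) 2 - corner \<phi> (2 * h) (k, l) 0 = h *\<^sub>R chord (ex + ey) h ?q"
    "corner \<phi> (2 * h) (k, l) 3 - corner \<phi> (2 * h) (k, l) 1 = h *\<^sub>R chord (ey - ex) h ?q"
    unfolding c chord_def using assms by simp_all
  moreover have "cross2 (h *\<^sub>R x) (h *\<^sub>R y) = h\<^sup>2 * cross2 x y" for x y
    by (simp add: cross2_def power2_eq_square algebra_simps)
  ultimately show ?thesis by simp
qed

definition oriented :: "real \<Rightarrow> cell \<Rightarrow> bool" where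
  "oriented h i \<longleftrightarrow> (signed_area \<phi> (2 * h) i > 0 \<longleftrightarrow> orient = 1)"

lemma eventually_oriented:
  "\<forall>\<^sub>F h in at_right 0. \<forall>k l. grid h k l \<in> cball 0 R \<longrightarrow> (\<forall>i\<in>cells_at k l. oriented h i)"
proof -
  have b: "bounded_below (\<lambda>h q. orient * cross2 (chord (ex + ey) h q) (chord (ey - ex) h q))"
    by (rule bounded_below_cross2_chord) (simp add: cross2_def)
  have "\<forall>\<^sub>F h in at_right 0. \<forall>q\<in>cball 0 (\<bar>R\<bar> + 1). 0 < orient * cross2 (chord (ex + ey) h q) (chord (ey - ex) h q)"
    by (rule bounded_below_pos[OF b]) simp
  moreover have "\<forall>\<^sub>F h in at_right (0::real). 0 < h \<and> h < 1/2"
    by (rule eventually_at_right_0_less) simp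
  ultimately show ?thesis
  proof (eventually_elim, intro allI impI ballI)
    fix h :: real and k l :: int and i :: cell
    assume pos: "\<forall>q\<in>cball 0 (\<bar>R\<bar> + 1). 0 < orient * cross2 (chord (ex + ey) h q) (chord (ey - ex) h q)"
      and h: "0 < h \<and> h < 1/2" and g: "grid h k l \<in> cball 0 R" and i: "i \<in> cells_at k l"
    let ?c = "grid h (fst i) (snd i) + h *\<^sub>R (ex + ey)"
    \<comment> \<open>The centres of the four cells around a node lie at diagonal displacements of
      size \<open>h\<close>, hence within distance 1 of the node when \<open>h < 1/2\<close>; the
      radius is enlarged accordingly.\<close>
    obtain w :: "real^2" where w: "?c = grid h k l + h *\<^sub>R w" "norm w \<le> 2"
    proof (rule that)
      define w :: "real^2" where
        "w = vector [if fst i = k then 1 else -1, if snd i = l then 1 else -1]"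
      show "?c = grid h k l + h *\<^sub>R w"
        using i by (auto simp: cells_at_def w_def grid_def vec_eq_iff forall_2 algebra_simps)
      have "(norm w)\<^sup>2 = 2"
        unfolding power2_norm_eq_inner by (simp add: w_def inner_real2)
      then have "(norm w)\<^sup>2 \<le> 2\<^sup>2" by simp
      then show "norm w \<le> 2" by (rule power2_le_imp_le) simp
    qed
    have "norm (h *\<^sub>R w) \<le> 1"
      using mult_mono[of h "1/2" "norm w" 2] h w(2) by simp
    then have "?c \<in> cball 0 (\<bar>R\<bar> + 1)"
      unfolding w(1) using g norm_triangle_ineq[of "grid h k l" "h *\<^sub>R w"] by simp
    with pos have "0 < orient * cross2 (chord (ex + ey) h ?c) (chord (ey - ex) h ?c)" by blast
    then have "0 < (1/2 * h\<^sup>2) * (orient * cross2 (chord (ex + ey) h ?c) (chord (ey - ex) h ?c))"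
      using h by (intro mult_pos_pos[of "1/2 * h\<^sup>2"]) auto
    then have "0 < orient * signed_area \<phi> (2 * h) i"
      using signed_area_chords[of h "fst i" "snd i"] h by (simp only: prod.collapse mult.left_commute)
    then show "oriented h i"
      unfolding oriented_def using orient_cases by auto
  qed
qed

text \<open>Injectivity of the mesh map and of the grid reduces coincidence of vertices to
  coincidence of grid indices, so the geometric set becomes the explicit list.\<close>

lemma half_edges_oriented:
  assumes "h > 0" and o: "\<forall>i\<in>cells_at k l. oriented h i"
  shows "half_edges \<phi> (2 * h) (\<phi> (grid h k l)) = set (half_edge_list (orient = 1) k l)"
proof -
  have vert: "vertex \<phi> (2 * h) i r = \<phi> (grid h k' l') \<longleftrightarrow>
      vertex_index (signed_area \<phi> (2 * h) i > 0) i r = (k', l')" for i r k' l'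
    unfolding vertex_eq_node node_grid map_inject grid_inject[OF assms(1)] by (auto simp: prod_eq_iff)
  \<comment> \<open>Cells not adjacent to the node may have either orientation, but the node is a
    vertex of none of them in either numbering.\<close>
  have A: "vertex \<phi> (2 * h) i r = \<phi> (grid h k l) \<longleftrightarrow> vertex_index (orient = 1) i r = (k, l)" for i r
  proof (cases "i \<in> cells_at k l")
    case True
    with o show ?thesis unfolding vert by (simp add: oriented_def)
  next
    case False
    then show ?thesis unfolding vert using vertex_index_cells_at by blast
  qed
  have B: "vertex \<phi> (2 * h) i r = vertex \<phi> (2 * h) j s \<longleftrightarrow> vertex_index (orient = 1) i r = vertex_index (orient = 1) j s"
    if "i \<in> cells_at k l" "j \<in> cells_at k l" for i j r s
  proof -
    have "vertex \<phi> (2 * h) i r = vertex \<phi> (2 * h) j s \<longleftrightarrow> vertex_index (signed_area \<phi> (2 * h) i > 0) i r =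
      vertex_index (signed_area \<phi> (2 * h) j > 0) j s"
      unfolding vertex_eq_node[of \<phi> "2 * h" j s] node_grid vert by simp
    with that o show ?thesis by (simp add: oriented_def)
  qed
  have "(i, r, j, s) \<in> half_edges \<phi> (2 * h) (\<phi> (grid h k l)) \<longleftrightarrow>
      (i, r, j, s) \<in> set (half_edge_list (orient = 1) k l)" for i r j s
  proof (cases "vertex_index (orient = 1) i r = (k, l) \<and> vertex_index (orient = 1) j (Suc s) = (k, l)")
    case True
    then have "i \<in> cells_at k l" "j \<in> cells_at k l" using vertex_index_cells_at by blast+
    from B[OF this] show ?thesis
      unfolding half_edges_def half_edge_list_iff mem_Collect_eq prod.case A by simp
  next
    case False
    then show ?thesis
      unfolding half_edges_def half_edge_list_iff mem_Collect_eq prod.case A by blast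
  qed
  then show ?thesis by (intro set_eqI) (metis prod_cases4)
qed

lemma vertex_oriented:
  "oriented h i \<Longrightarrow> vertex \<phi> (2 * h) i r = \<phi> (case vertex_index (orient = 1) i r of (k, l) \<Rightarrow> grid h k l)"
  by (simp add: vertex_eq_node node_grid oriented_def case_prod_beta)

end

lemma right_normal_rot: "right_normal a b = rot (b - a) /\<^sub>R dist a b"
  by (simp add: right_normal_def rot_def)

section \<open>The scheme for an ideal gas\<close>

context
  fixes \<gamma> :: real and U :: "real^2 \<Rightarrow> state"
  assumes \<gamma>: "\<gamma> > 1" and U: "smooth U" and phys: "physical_field \<gamma> U"
begin

lemma density_pos: "density (U x) > 0" and pressure_pos: "pressure \<gamma> (U x) > 0"
  using phys by (simp_all add: physical_field_def)

lemma smooth_density: "smooth (\<lambda>x. density (U x))"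
  unfolding density_def by (rule smooth_linear_compose[OF bounded_linear_fst U])

lemma smooth_inverse_density: "smooth (\<lambda>x. inverse (density (U x)))"
  using density_pos by (intro smooth_inverse smooth_density) (simp add: less_imp_neq[symmetric])

lemma smooth_velocity: "smooth (\<lambda>x. velocity (U x))"
  unfolding velocity_def
  by (intro smooth_scaleR smooth_inverse_density smooth_linear_compose[OF bounded_linear_fst]
      smooth_linear_compose[OF bounded_linear_snd] U)

lemma smooth_pressure: "smooth (\<lambda>x. pressure \<gamma> (U x))"
  unfolding pressure_def energy_def divide_inverse[of "snd _"] power2_norm_eq_inner
  by (intro smooth_mult smooth_diff smooth_inner smooth_velocity smooth_density smooth_inverse_density
      smooth_const smooth_linear_compose[OF bounded_linear_snd] U)

lemma smooth_impedance: "smooth (\<lambda>x. impedance \<gamma> (U x))"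
  unfolding impedance_def sound_speed_def divide_inverse
  using density_pos pressure_pos \<gamma>
  by (intro smooth_mult smooth_sqrt smooth_density smooth_const smooth_pressure smooth_inverse_density)
    (simp add: zero_less_mult_iff)

lemma impedance_pos: "impedance \<gamma> (U x) > 0"
  using density_pos[of x] pressure_pos[of x] \<gamma> by (simp add: impedance_def sound_speed_def)

end

text \<open>Passage from the mesh size to its half, in terms of which all families are written; the
  constant changes by the factor \<open>(1/2) ^ p\<close>.\<close>

lemma edge_error_order_halfI:
  assumes "\<And>K. compact K \<Longrightarrow> \<exists>C. \<forall>\<^sub>F h in at_right 0. \<forall>i. \<forall>r<4. vertex \<phi> (2 * h) i r \<in> K \<longrightarrow>
    norm (err (2 * h) i r) \<le> C * h ^ p"
  shows "edge_error_order p \<phi> err"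
  unfolding edge_error_order_def
proof (intro allI impI)
  fix K :: "(real^2) set" assume "compact K"
  then obtain C b where b: "b > 0" and C: "\<And>h. h > 0 \<Longrightarrow> h < b \<Longrightarrow> \<forall>i. \<forall>r<4. vertex \<phi> (2 * h) i r \<in> K \<longrightarrow>
    norm (err (2 * h) i r) \<le> C * h ^ p"
    using assms unfolding eventually_at_right_field by blast
  have "\<forall>i. \<forall>r<4. vertex \<phi> h i r \<in> K \<longrightarrow> norm (err h i r) \<le> (C * (1/2) ^ p) * h ^ p" if "h > 0" "h < 2 * b" for h
    using C[of "h / 2"] that by (simp add: power_divide)
  then have "\<forall>\<^sub>F h in at_right 0. \<forall>i. \<forall>r<4. vertex \<phi> h i r \<in> K \<longrightarrow> norm (err h i r) \<le> (C * (1/2) ^ p) * h ^ p"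
    unfolding eventually_at_right_field using b by (intro exI[of _ "2 * b"]) auto
  then show "\<exists>C. \<forall>\<^sub>F h in at_right 0. \<forall>i. \<forall>r<4. vertex \<phi> h i r \<in> K \<longrightarrow> norm (err h i r) \<le> C * h ^ p" ..
qed

section \<open>The solver for the gas, rewritten at edge centres\<close>

locale gas_scheme = mesh_map +
  fixes \<gamma> :: real and U :: "real^2 \<Rightarrow> state" and vt :: "real \<Rightarrow> real^2 \<Rightarrow> real^2"
    and PA PB :: "real \<Rightarrow> cell \<Rightarrow> nat \<Rightarrow> real"
  assumes \<gamma>: "\<gamma> > 1" and smooth_U: "smooth U" and physical: "physical_field \<gamma> U"
    and jump: "\<And>h. h > 0 \<Longrightarrow> jump_condition \<gamma> U \<phi> h (vt h) (PA h) (PB h)"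
    and balance: "\<And>h. h > 0 \<Longrightarrow> balance_condition \<phi> h (PA h) (PB h)"

sublocale gas_scheme \<subseteq> lagrangian_scheme \<phi> \<psi> "\<lambda>x. velocity (U x)" "\<lambda>x. pressure \<gamma> (U x)" "\<lambda>x. impedance \<gamma> (U x)"
  by unfold_locales
    (use smooth_velocity smooth_pressure smooth_impedance impedance_pos \<gamma> smooth_U physical in blast)+

context gas_scheme
begin

abbreviation dirs :: "(real^2) set" where "dirs \<equiv> {ex, - ex, ey, - ey}"

lemma dist_edge: "h > 0 \<Longrightarrow> dist (\<phi> (q - h *\<^sub>R u)) (\<phi> (q + h *\<^sub>R u)) = h * norm (nrm u h q)"
  by (simp add: nrm_def chord_def dist_norm norm_minus_commute)

lemma right_normal_edge:
  assumes "h > 0"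
  shows "right_normal (\<phi> (q - h *\<^sub>R u)) (\<phi> (q + h *\<^sub>R u)) = unit_nrm u h q"
    and "right_normal (\<phi> (q + h *\<^sub>R u)) (\<phi> (q - h *\<^sub>R u)) = - unit_nrm u h q"
proof -
  have "right_normal b a = - right_normal a b" for a b
    by (simp add: right_normal_rot dist_commute flip: scaleR_minus_right rot_minus)
  moreover have "right_normal (\<phi> (q - h *\<^sub>R u)) (\<phi> (q + h *\<^sub>R u)) = unit_nrm u h q"
    unfolding right_normal_rot dist_edge[OF assms] unit_nrm_def
    using assms by (simp add: nrm_def chord_def rot_scaleR)
  ultimately show "right_normal (\<phi> (q - h *\<^sub>R u)) (\<phi> (q + h *\<^sub>R u)) = unit_nrm u h q"
    "right_normal (\<phi> (q + h *\<^sub>R u)) (\<phi> (q - h *\<^sub>R u)) = - unit_nrm u h q" by metis+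
qed

lemma jump_pressure_edge:
  shows "jump_pressure \<gamma> U (\<phi> (q - h *\<^sub>R u)) (\<phi> (q + h *\<^sub>R u)) n V =
     1/3 * pressure \<gamma> (U (\<phi> (q - h *\<^sub>R u))) + 2/3 * pressure \<gamma> (U (mid u h q)) + impedance \<gamma> (U (mid u h q)) * (curv u h q \<bullet> n)
     - (1/3 * impedance \<gamma> (U (\<phi> (q - h *\<^sub>R u))) + 2/3 * impedance \<gamma> (U (mid u h q))) * ((V - velocity (U (\<phi> (q - h *\<^sub>R u)))) \<bullet> n)"
    and "jump_pressure \<gamma> U (\<phi> (q + h *\<^sub>R u)) (\<phi> (q - h *\<^sub>R u)) n V =
     1/3 * pressure \<gamma> (U (\<phi> (q + h *\<^sub>R u))) + 2/3 * pressure \<gamma> (U (mid u h q)) + impedance \<gamma> (U (mid u h q)) * (curv u h q \<bullet> n)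
     - (1/3 * impedance \<gamma> (U (\<phi> (q + h *\<^sub>R u))) + 2/3 * impedance \<gamma> (U (mid u h q))) * ((V - velocity (U (\<phi> (q + h *\<^sub>R u)))) \<bullet> n)"
  unfolding jump_pressure_def Let_def mid_def curv_def midpoint_sym[of "\<phi> (q + h *\<^sub>R u)"]
  by (simp_all add: algebra_simps inner_diff_left)

text \<open>The normals of the two sides are opposite, so in the pressure jump the pressures cancel
  and the velocity terms double. This 2 cancels against the half edge being half as long as the
  edge, which leaves the factor \<open>h\<close>.\<close>

lemma balance_term:
  fixes q u :: "real^2"
  assumes "h > 0"
  defines "x \<equiv> \<phi> (q - h *\<^sub>R u)" and "y \<equiv> \<phi> (q + h *\<^sub>R u)"
  shows "(dist x (midpoint x y) * (jump_pressure \<gamma> U x y (right_normal x y) V - jump_pressure \<gamma> U x y (right_normal y x) V))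
      *\<^sub>R right_normal x y = h *\<^sub>R contrib u h q (impedance \<gamma> (U x)) (V - velocity (U x))"
proof -
  define A c \<alpha>m n where "A = 1/3 * impedance \<gamma> (U x) + 2/3 * impedance \<gamma> (U (mid u h q))"
    and "c = curv u h q" and "\<alpha>m = impedance \<gamma> (U (mid u h q))" and "n = nrm u h q"
  have j: "jump_pressure \<gamma> U x y (right_normal x y) V - jump_pressure \<gamma> U x y (right_normal y x) V =
      2 * (\<alpha>m * (c \<bullet> unit_nrm u h q) - A * ((V - velocity (U x)) \<bullet> unit_nrm u h q))"
    unfolding x_def y_def jump_pressure_edge right_normal_edge[OF assms(1)]
    by (simp add: A_def c_def \<alpha>m_def x_def algebra_simps)
  have dm: "dist x (midpoint x y) = h * norm n / 2"
    using dist_midpoint(1)[of x y] dist_edge[OF assms(1), of q u] by (simp add: x_def y_def n_def)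
  have rn: "right_normal x y = unit_nrm u h q"
    unfolding x_def y_def by (rule right_normal_edge(1)[OF assms(1)])
  have un: "unit_nrm u h q = inverse (norm n) *\<^sub>R n" by (simp add: unit_nrm_def n_def)
  have alg: "(h * norm n / 2 * (2 * (\<alpha>m * (c \<bullet> (inverse (norm n) *\<^sub>R n)) - A * (w \<bullet> (inverse (norm n) *\<^sub>R n)))))
      *\<^sub>R (inverse (norm n) *\<^sub>R n) = h *\<^sub>R (inverse (norm n) *\<^sub>R ((\<alpha>m * (c \<bullet> n) - A * (w \<bullet> n)) *\<^sub>R n))" for w
  \<comment> \<open>For a degenerate edge both sides are zero, since the inverse of zero is
    zero.\<close>
  proof (cases "n = 0")
    case False
    then show ?thesis
      unfolding inner_scaleR_right scaleR_scaleR
      by (intro arg_cong[where f="\<lambda>c. c *\<^sub>R n"]) (simp add: field_simps)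
  qed simp
  show ?thesis
    unfolding j dm
    unfolding rn un alg
    unfolding contrib_def A_def c_def \<alpha>m_def n_def ..
qed

definition regular :: "real \<Rightarrow> real^2 \<Rightarrow> bool" where
  "regular h p \<longleftrightarrow> (\<exists>k l. p = grid h k l \<and> (\<forall>i\<in>cells_at k l. oriented h i))"

text \<open>At a well-oriented node the sum over half edges becomes a sum over the four grid
  directions. The neighbour in the direction \<open>u\<close> is at
  \<open>p + (2 * h) *\<^sub>R u\<close>, so the edge is centred at
  \<open>p + h *\<^sub>R u\<close>.\<close>

lemma balance_contrib:
  assumes h: "h > 0" and "regular h p"
  shows "(\<Sum>u\<in>dirs. contrib u h (p + h *\<^sub>R u) (impedance \<gamma> (U (\<phi> p))) (vt (2 * h) (\<phi> p) - velocity (U (\<phi> p)))) = 0"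
proof -
  obtain k l where p: "p = grid h k l" and o: "\<forall>i\<in>cells_at k l. oriented h i"
    using assms(2) by (auto simp: regular_def)
  define V where "V = vt (2 * h) (\<phi> p)"
  define G where "G y = (dist (\<phi> p) (midpoint (\<phi> p) y) * (jump_pressure \<gamma> U (\<phi> p) y (right_normal (\<phi> p) y) V -
      jump_pressure \<gamma> U (\<phi> p) y (right_normal y (\<phi> p)) V)) *\<^sub>R right_normal (\<phi> p) y" for y
  define T where "T = (\<lambda>(i, r, j, s). (dist (\<phi> p) (midpoint (vertex \<phi> (2 * h) i r) (vertex \<phi> (2 * h) i (Suc r))) *
      (PA (2 * h) i r - PB (2 * h) j s)) *\<^sub>R edge_normal \<phi> (2 * h) i r)"
  have node: "\<phi> p \<in> nodes \<phi> (2 * h)"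
    unfolding nodes_def p by (auto simp flip: node_grid)
  let ?L = "half_edge_list (orient = 1) k l"
  have hl: "half_edges \<phi> (2 * h) (\<phi> p) = set ?L"
    unfolding p by (rule half_edges_oriented[OF h o])
  have G: "T e = G (case case e of (i, r, j, s) \<Rightarrow> vertex_index (orient = 1) i (Suc r) of (k', l') \<Rightarrow> \<phi> (grid h k' l'))"
    if "e \<in> set ?L" for e
  proof -
    obtain i r j s where e: "e = (i, r, j, s)" by (cases e)
    have mem: "(i, r, j, s) \<in> half_edges \<phi> (2 * h) (\<phi> p)" using that hl e by simp
    then have v: "vertex \<phi> (2 * h) i r = \<phi> p" "vertex \<phi> (2 * h) j (Suc s) = \<phi> p"
        "vertex \<phi> (2 * h) i (Suc r) = vertex \<phi> (2 * h) j s"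
      by (auto simp: half_edges_def)
    have "\<forall>(i, r, j, s)\<in>half_edges \<phi> (2 * h) (\<phi> p).
        PA (2 * h) i r = jump_pressure \<gamma> U (vertex \<phi> (2 * h) i r) (vertex \<phi> (2 * h) i (Suc r))
                   (edge_normal \<phi> (2 * h) i r) V \<and>
        PB (2 * h) j s = jump_pressure \<gamma> U (vertex \<phi> (2 * h) j (Suc s)) (vertex \<phi> (2 * h) j s)
                   (edge_normal \<phi> (2 * h) j s) V"
      using jump[of "2 * h"] h node unfolding jump_condition_def V_def by simp
    from bspec[OF this mem] v have "PA (2 * h) i r = jump_pressure \<gamma> U (vertex \<phi> (2 * h) i r) (vertex \<phi> (2 * h) i (Suc r))
                   (edge_normal \<phi> (2 * h) i r) V"
        "PB (2 * h) j s = jump_pressure \<gamma> U (vertex \<phi> (2 * h) j (Suc s)) (vertex \<phi> (2 * h) j s)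
                   (edge_normal \<phi> (2 * h) j s) V"
      by simp_all
    with v have "T e = G (vertex \<phi> (2 * h) i (Suc r))"
      by (simp add: e T_def G_def edge_normal_def)
    moreover have "i \<in> cells_at k l"
      using that unfolding e half_edge_list_iff by (blast dest: vertex_index_cells_at)
    ultimately show ?thesis
      using o by (simp add: vertex_oriented e case_prod_beta)
  qed
  have "0 = (\<Sum>e\<in>half_edges \<phi> (2 * h) (\<phi> p). T e)"
    using balance[of "2 * h"] h node unfolding balance_condition_def T_def by auto
  also have "\<dots> = sum_list (map T ?L)"
    unfolding hl by (rule sum_list_distinct_conv_sum_set[OF distinct_half_edge_list, symmetric])
  also have "map T ?L = map (\<lambda>(k', l'). G (\<phi> (grid h k' l'))) (map (\<lambda>(i, r, j, s). vertex_index (orient = 1) i (Suc r)) ?L)"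
    using G by (auto simp: case_prod_beta)
  also have "sum_list \<dots> = G (\<phi> (grid h (k + 1) l)) + G (\<phi> (grid h k (l + 1))) + G (\<phi> (grid h (k - 1) l)) + G (\<phi> (grid h k (l - 1)))"
    unfolding half_edge_list_neighbours by (simp add: add.assoc)
  also have "\<dots> = G (\<phi> (p + (2 * h) *\<^sub>R ex)) + G (\<phi> (p + (2 * h) *\<^sub>R ey)) + G (\<phi> (p + (2 * h) *\<^sub>R (- ex))) + G (\<phi> (p + (2 * h) *\<^sub>R (- ey)))"
  proof -
    have "grid h (k + 1) l = p + (2 * h) *\<^sub>R ex" "grid h k (l + 1) = p + (2 * h) *\<^sub>R ey"
      "grid h (k - 1) l = p + (2 * h) *\<^sub>R (- ex)" "grid h k (l - 1) = p + (2 * h) *\<^sub>R (- ey)"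
      by (simp_all add: p grid_def vec_eq_iff forall_2 algebra_simps)
    then show ?thesis by simp
  qed
  also have "\<dots> = (\<Sum>u\<in>dirs. G (\<phi> (p + (2 * h) *\<^sub>R u)))"
  proof -
    have "ex \<noteq> - ex" "ey \<noteq> - ey" "ex \<noteq> ey" "ex \<noteq> - ey" "- ex \<noteq> ey" "- ex \<noteq> - ey"
      by (simp_all add: vec_eq_iff forall_2)
    then show ?thesis by (simp add: add_ac)
  qed
  also have "\<dots> = (\<Sum>u\<in>dirs. h *\<^sub>R contrib u h (p + h *\<^sub>R u) (impedance \<gamma> (U (\<phi> p))) (V - velocity (U (\<phi> p))))"
  proof (intro sum.cong refl)
    fix u :: "real^2"
    have e: "p + h *\<^sub>R u - h *\<^sub>R u = p" "p + h *\<^sub>R u + h *\<^sub>R u = p + (2 * h) *\<^sub>R u"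
      by (simp_all add: scaleR_2 flip: scaleR_scaleR)
    show "G (\<phi> (p + (2 * h) *\<^sub>R u)) = h *\<^sub>R contrib u h (p + h *\<^sub>R u) (impedance \<gamma> (U (\<phi> p))) (V - velocity (U (\<phi> p)))"
      using balance_term[OF h, of "p + h *\<^sub>R u" u V] unfolding e G_def .
  qed
  finally show ?thesis using h by (simp add: V_def flip: scaleR_sum_right)
qed

text \<open>Outside the regular nodes, in particular at points off the grid, it takes the value
  \<open>defect\<close>, so that its difference from \<open>defect\<close> is zero there and the
  order estimate extends to the whole plane.\<close>

definition deviation :: "real \<Rightarrow> real^2 \<Rightarrow> real^2" where
  "deviation h p = (if regular h p then vt (2 * h) (\<phi> p) - velocity (U (\<phi> p)) else defect h p)"

lemma deviation_order: "Oh 4 (\<lambda>h p. deviation h p - defect h p)"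
  by (rule Oh_cong[OF nodal_deviation[OF balance_contrib]]) (auto simp: deviation_def)

text \<open>The inverse map carries the compact set to a bounded set of parameters. The radius
  leaves a margin that covers the centre and the other end of an edge, and for small
  \<open>h\<close> every grid node in that ball is regular.\<close>

lemma edges_near_compact:
  assumes "compact K"
  obtains R where "R > 0" "\<forall>\<^sub>F h in at_right 0. \<forall>i. \<forall>r<4. vertex \<phi> (2 * h) i r \<in> K \<longrightarrow> h > 0 \<and>
    (\<exists>u\<in>dirs. \<exists>q\<in>cball 0 R. vertex \<phi> (2 * h) i r = \<phi> (q - h *\<^sub>R u) \<and> vertex \<phi> (2 * h) i (Suc r) = \<phi> (q + h *\<^sub>R u) \<and>
      q - h *\<^sub>R u \<in> cball 0 R \<and> q + h *\<^sub>R u \<in> cball 0 R \<and>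
      regular h (q - h *\<^sub>R u) \<and> regular h (q + h *\<^sub>R u))"
proof -
  have "bounded (\<psi> ` K)"
    by (intro compact_imp_bounded compact_continuous_image assms smooth_continuous_on smooth_inv)
  then obtain B where B: "\<And>x. x \<in> K \<Longrightarrow> norm (\<psi> x) \<le> B" by (auto simp: bounded_iff)
  define R where "R = max B 0 + 2"
  show thesis
  proof (rule that[of R])
    show "R > 0" by (simp add: R_def)
    have "\<forall>\<^sub>F h in at_right (0::real). 0 < h \<and> h < 1/2"
      by (rule eventually_at_right_0_less) simp
    with eventually_oriented[of R]
    show "\<forall>\<^sub>F h in at_right 0. \<forall>i. \<forall>r<4. vertex \<phi> (2 * h) i r \<in> K \<longrightarrow> h > 0 \<and>
    (\<exists>u\<in>dirs. \<exists>q\<in>cball 0 R. vertex \<phi> (2 * h) i r = \<phi> (q - h *\<^sub>R u) \<and> vertex \<phi> (2 * h) i (Suc r) = \<phi> (q + h *\<^sub>R u) \<and>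
      q - h *\<^sub>R u \<in> cball 0 R \<and> q + h *\<^sub>R u \<in> cball 0 R \<and>
      regular h (q - h *\<^sub>R u) \<and> regular h (q + h *\<^sub>R u))"
    proof (eventually_elim, intro allI impI)
      fix h :: real and i :: cell and r :: nat
      assume o: "\<forall>k l. grid h k l \<in> cball 0 R \<longrightarrow> (\<forall>i\<in>cells_at k l. oriented h i)"
        and h: "0 < h \<and> h < 1/2" and r: "r < 4" and K: "vertex \<phi> (2 * h) i r \<in> K"
      \<comment> \<open>The indices are first read off with the actual sign of the area, since the
        orientation of the cell is not known yet. They locate a node in the ball, which yields the
        orientation; then the indices are taken again in the common numbering.\<close>
      obtain k0 l0 where kl0: "vertex_index (signed_area \<phi> (2 * h) i > 0) i r = (k0, l0)" by (meson surj_pair)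
      then have "vertex \<phi> (2 * h) i r = \<phi> (grid h k0 l0)" by (simp add: vertex_eq_node node_grid)
      then have "norm (grid h k0 l0) \<le> B" using B[OF K] by (simp add: inv_map)
      then have "grid h k0 l0 \<in> cball 0 R" by (simp add: R_def)
      then have "oriented h i"
        using o vertex_index_cells_at[OF kl0] by blast
      note v = vertex_oriented[OF this]
      obtain k l where kl: "vertex_index (orient = 1) i r = (k, l)" by (meson surj_pair)
      obtain k' l' where kl': "vertex_index (orient = 1) i (Suc r) = (k', l')" by (meson surj_pair)
      define u :: "real^2" where "u = vector [of_int (k' - k), of_int (l' - l)]"
      define q where "q = grid h k l + h *\<^sub>R u"
      have "(k' - k, l' - l) \<in> {(1, 0), (- 1, 0), (0, 1), (0, - 1)}"
        using edge_direction[OF r, of "orient = 1" i] by (simp add: kl kl')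
      then have u: "u \<in> dirs" unfolding u_def by (auto simp: vec_eq_iff forall_2)
      then have "norm u = 1" by (auto simp: norm_eq_sqrt_inner inner_real2)
      then have nu: "norm (h *\<^sub>R u) \<le> 1/2" using h by simp
      have a: "q - h *\<^sub>R u = grid h k l" by (simp add: q_def)
      have b: "q + h *\<^sub>R u = grid h k' l'"
        unfolding q_def u_def by (simp add: grid_def vec_eq_iff forall_2 algebra_simps)
      have va: "vertex \<phi> (2 * h) i r = \<phi> (q - h *\<^sub>R u)" and vb: "vertex \<phi> (2 * h) i (Suc r) = \<phi> (q + h *\<^sub>R u)"
        unfolding v kl kl' a b by simp_all
      have na: "norm (q - h *\<^sub>R u) \<le> B" using B[OF K] by (simp add: va inv_map)
      have "norm q \<le> norm (q - h *\<^sub>R u) + norm (h *\<^sub>R u)"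
        using norm_triangle_ineq[of "q - h *\<^sub>R u" "h *\<^sub>R u"] by simp
      then have nq: "norm q \<le> B + 1/2" using na nu by linarith
      have nb: "norm (q + h *\<^sub>R u) \<le> B + 1"
        using norm_triangle_ineq[of q "h *\<^sub>R u"] nq nu by linarith
      have "q \<in> cball 0 R" "q - h *\<^sub>R u \<in> cball 0 R" "q + h *\<^sub>R u \<in> cball 0 R"
        using na nq nb by (auto simp: R_def)
      moreover from this(2,3) have "regular h (q - h *\<^sub>R u)" "regular h (q + h *\<^sub>R u)"
        unfolding a b regular_def using o by blast+
      ultimately show "h > 0 \<and> (\<exists>u\<in>dirs. \<exists>q\<in>cball 0 R. vertex \<phi> (2 * h) i r = \<phi> (q - h *\<^sub>R u) \<and>
          vertex \<phi> (2 * h) i (Suc r) = \<phi> (q + h *\<^sub>R u) \<and> q - h *\<^sub>R u \<in> cball 0 R \<and> q + h *\<^sub>R u \<in> cball 0 R \<and>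
          regular h (q - h *\<^sub>R u) \<and> regular h (q + h *\<^sub>R u))"
        using u va vb h by blast
    qed
  qed
qed

text \<open>The jump condition at the two ends: the half edge at \<open>p\<close> has
  \<open>i\<close> as its first cell and gives \<open>PA\<close>, the one at \<open>p'\<close> has
  \<open>i\<close> as its second cell and gives \<open>PB\<close>.\<close>

lemma edge_pressures:
  assumes h: "h > 0" and r: "r < 4"
    and a: "vertex \<phi> (2 * h) i r = \<phi> p" "regular h p" and b: "vertex \<phi> (2 * h) i (Suc r) = \<phi> p'" "regular h p'"
  shows "PA (2 * h) i r = jump_pressure \<gamma> U (\<phi> p) (\<phi> p') (edge_normal \<phi> (2 * h) i r) (vt (2 * h) (\<phi> p))"
    and "PB (2 * h) i r = jump_pressure \<gamma> U (\<phi> p') (\<phi> p) (edge_normal \<phi> (2 * h) i r) (vt (2 * h) (\<phi> p'))"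
proof -
  obtain k l where kl: "p = grid h k l" "\<forall>i\<in>cells_at k l. oriented h i" using a(2) by (auto simp: regular_def)
  obtain k' l' where kl': "p' = grid h k' l'" "\<forall>i\<in>cells_at k' l'. oriented h i" using b(2) by (auto simp: regular_def)
  have "vertex_index (signed_area \<phi> (2 * h) i > 0) i r = (k, l)"
    using a(1) h unfolding kl(1) vertex_eq_node node_grid map_inject by (simp add: grid_inject prod_eq_iff)
  then have o: "oriented h i" using kl(2) vertex_index_cells_at by blast
  have "vertex_index (orient = 1) i r = (k, l)" "vertex_index (orient = 1) i (Suc r) = (k', l')"
    using a(1) b(1) h unfolding kl(1) kl'(1) vertex_oriented[OF o] map_inject
    by (simp_all add: grid_inject prod_eq_iff case_prod_beta)
  with half_edge_list_total[OF r, of i "orient = 1"] obtain j s j' s' where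
    "(i, r, j, s) \<in> half_edges \<phi> (2 * h) (\<phi> p)" "(j', s', i, r) \<in> half_edges \<phi> (2 * h) (\<phi> p')"
    unfolding kl(1) kl'(1) half_edges_oriented[OF h kl(2)] half_edges_oriented[OF h kl'(2)] by auto
  moreover have "\<phi> p \<in> nodes \<phi> (2 * h)" "\<phi> p' \<in> nodes \<phi> (2 * h)"
    unfolding nodes_def kl(1) kl'(1) by (auto simp flip: node_grid)
  ultimately show "PA (2 * h) i r = jump_pressure \<gamma> U (\<phi> p) (\<phi> p') (edge_normal \<phi> (2 * h) i r) (vt (2 * h) (\<phi> p))"
    and "PB (2 * h) i r = jump_pressure \<gamma> U (\<phi> p') (\<phi> p) (edge_normal \<phi> (2 * h) i r) (vt (2 * h) (\<phi> p'))"
    using jump[of "2 * h"] h a(1) b(1) unfolding jump_condition_def by fastforce+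
qed

section \<open>Comparison of the numerical flux with the Simpson flux\<close>

definition err1 :: "real^2 \<Rightarrow> real \<Rightarrow> real^2 \<Rightarrow> real" where
  "err1 u h q = 1/2 * (deviation h (q - h *\<^sub>R u) \<bullet> unit_nrm u h q + deviation h (q + h *\<^sub>R u) \<bullet> unit_nrm u h q)
    - curv u h q \<bullet> unit_nrm u h q"

definition err2 :: "real^2 \<Rightarrow> real \<Rightarrow> real^2 \<Rightarrow> real" where
  "err2 u h q = 1/2 * (press deviation u h q (q - h *\<^sub>R u) + press deviation u h q (q + h *\<^sub>R u)) -
      (1/6 * pressure \<gamma> (U (\<phi> (q - h *\<^sub>R u))) + 2/3 * pressure \<gamma> (U (mid u h q)) + 1/6 * pressure \<gamma> (U (\<phi> (q + h *\<^sub>R u))))"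

definition err3 :: "real^2 \<Rightarrow> real \<Rightarrow> real^2 \<Rightarrow> real" where
  "err3 u h q = 1/2 * (press deviation u h q (q - h *\<^sub>R u) * ((velocity (U (\<phi> (q - h *\<^sub>R u))) + deviation h (q - h *\<^sub>R u)) \<bullet> unit_nrm u h q) +
          press deviation u h q (q + h *\<^sub>R u) * ((velocity (U (\<phi> (q + h *\<^sub>R u))) + deviation h (q + h *\<^sub>R u)) \<bullet> unit_nrm u h q)) -
      (1/6 * (pressure \<gamma> (U (\<phi> (q - h *\<^sub>R u))) * (velocity (U (\<phi> (q - h *\<^sub>R u))) \<bullet> unit_nrm u h q)) +
       2/3 * (pressure \<gamma> (U (mid u h q)) * (velocity (U (mid u h q)) \<bullet> unit_nrm u h q)) +
       1/6 * (pressure \<gamma> (U (\<phi> (q + h *\<^sub>R u))) * (velocity (U (\<phi> (q + h *\<^sub>R u))) \<bullet> unit_nrm u h q)))"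

lemma flux_difference:
  assumes h: "h > 0" and r: "r < 4"
    and a: "vertex \<phi> (2 * h) i r = \<phi> (q - h *\<^sub>R u)" "regular h (q - h *\<^sub>R u)"
    and b: "vertex \<phi> (2 * h) i (Suc r) = \<phi> (q + h *\<^sub>R u)" "regular h (q + h *\<^sub>R u)"
  shows "numerical_flux \<phi> (2 * h) (vt (2 * h)) (PA (2 * h)) (PB (2 * h)) i r - simpson_flux \<gamma> U \<phi> (2 * h) i r =
    (- err1 u h q, err2 u h q *\<^sub>R unit_nrm u h q, err3 u h q)"
proof -
  have n: "edge_normal \<phi> (2 * h) i r = unit_nrm u h q"
    unfolding edge_normal_def a b by (rule right_normal_edge(1)[OF h])
  have V: "vt (2 * h) (\<phi> p) = velocity (U (\<phi> p)) + deviation h p" if "regular h p" for p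
    using that by (simp add: deviation_def)
  have p: "PA (2 * h) i r = press deviation u h q (q - h *\<^sub>R u)" "PB (2 * h) i r = press deviation u h q (q + h *\<^sub>R u)"
    unfolding edge_pressures[OF h r a b] n jump_pressure_edge press_def V[OF a(2)] V[OF b(2)] by simp_all
  have m: "midpoint (\<phi> (q - h *\<^sub>R u)) (\<phi> (q + h *\<^sub>R u)) = mid u h q" by (simp add: mid_def)
  show ?thesis
    unfolding numerical_flux_def simpson_flux_def Let_def n p a b m V[OF a(2)] V[OF b(2)] diff_Pair prod.inject
    by (intro conjI, goal_cases)
      (simp add: err1_def curv_def inner_add_left inner_diff_left field_simps,
        simp only: err2_def scaleR_diff_left,
        simp add: err3_def inner_add_left inner_diff_left field_simps)
qed

text \<open>The errors for the four grid directions are added into one family \<open>e\<close>, so a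
  single constant and a single threshold for \<open>h\<close> serve all edges, whatever their
  direction.\<close>

lemma numerical_flux_order:
  "edge_error_order 4 \<phi> (\<lambda>h i r. numerical_flux \<phi> h (vt h) (PA h) (PB h) i r - simpson_flux \<gamma> U \<phi> h i r)"
proof (rule edge_error_order_halfI)
  fix K :: "(real^2) set" assume "compact K"
  then obtain R where "R > 0" and R: "\<forall>\<^sub>F h in at_right 0. \<forall>i. \<forall>r<4. vertex \<phi> (2 * h) i r \<in> K \<longrightarrow> h > 0 \<and>
    (\<exists>u\<in>dirs. \<exists>q\<in>cball 0 R. vertex \<phi> (2 * h) i r = \<phi> (q - h *\<^sub>R u) \<and> vertex \<phi> (2 * h) i (Suc r) = \<phi> (q + h *\<^sub>R u) \<and>
      q - h *\<^sub>R u \<in> cball 0 R \<and> q + h *\<^sub>R u \<in> cball 0 R \<and>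
      regular h (q - h *\<^sub>R u) \<and> regular h (q + h *\<^sub>R u))"
    using edges_near_compact by blast
  define e where "e u h q = norm (err1 u h q) + norm (err2 u h q) * norm (unit_nrm u h q) + norm (err3 u h q)" for u h q
  have "Oh 4 (\<lambda>h q. \<Sum>u\<in>dirs. e u h q)"
    unfolding e_def err1_def err2_def err3_def
    by (intro Oh_sum Oh_add Oh_norm edge_velocity[OF deviation_order] edge_order[OF deviation_order]
        Oh_mult[OF Oh_norm[OF edge_order(1)[OF deviation_order]] Oh_norm[OF Oh_unit_nrm[OF deviation_order]]]) simp_all
  then obtain C where C: "\<forall>\<^sub>F h in at_right 0. \<forall>q\<in>cball 0 R. norm (\<Sum>u\<in>dirs. e u h q) \<le> C * h ^ 4"
    using OhE by blast
  have "\<forall>\<^sub>F h in at_right 0. \<forall>i. \<forall>r<4. vertex \<phi> (2 * h) i r \<in> K \<longrightarrow>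
    norm (numerical_flux \<phi> (2 * h) (vt (2 * h)) (PA (2 * h)) (PB (2 * h)) i r - simpson_flux \<gamma> U \<phi> (2 * h) i r) \<le> C * h ^ 4"
    using C R
  proof (eventually_elim, intro allI impI)
    fix h :: real and i :: cell and r :: nat
    assume C: "\<forall>q\<in>cball 0 R. norm (\<Sum>u\<in>dirs. e u h q) \<le> C * h ^ 4"
      and R: "\<forall>i. \<forall>r<4. vertex \<phi> (2 * h) i r \<in> K \<longrightarrow> h > 0 \<and>
    (\<exists>u\<in>dirs. \<exists>q\<in>cball 0 R. vertex \<phi> (2 * h) i r = \<phi> (q - h *\<^sub>R u) \<and> vertex \<phi> (2 * h) i (Suc r) = \<phi> (q + h *\<^sub>R u) \<and>
      q - h *\<^sub>R u \<in> cball 0 R \<and> q + h *\<^sub>R u \<in> cball 0 R \<and>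
      regular h (q - h *\<^sub>R u) \<and> regular h (q + h *\<^sub>R u))" and r: "r < 4" and K: "vertex \<phi> (2 * h) i r \<in> K"
    then obtain u q where u: "u \<in> dirs" and q: "q \<in> cball 0 R" and h: "h > 0"
      and v: "vertex \<phi> (2 * h) i r = \<phi> (q - h *\<^sub>R u)" "regular h (q - h *\<^sub>R u)"
        "vertex \<phi> (2 * h) i (Suc r) = \<phi> (q + h *\<^sub>R u)" "regular h (q + h *\<^sub>R u)"
      by blast
    have "norm (numerical_flux \<phi> (2 * h) (vt (2 * h)) (PA (2 * h)) (PB (2 * h)) i r - simpson_flux \<gamma> U \<phi> (2 * h) i r)
        \<le> norm (err1 u h q) + (norm (err2 u h q *\<^sub>R unit_nrm u h q) + norm (err3 u h q))"
      unfolding flux_difference[OF h r v]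
      using norm_Pair_le[of "- err1 u h q" "(err2 u h q *\<^sub>R unit_nrm u h q, err3 u h q)"]
        norm_Pair_le[of "err2 u h q *\<^sub>R unit_nrm u h q" "err3 u h q"] by simp
    also have "\<dots> = e u h q" by (simp add: e_def)
    also have "\<dots> \<le> (\<Sum>u\<in>dirs. e u h q)"
      by (rule member_le_sum[OF u]) (simp_all add: e_def)
    also have "\<dots> \<le> C * h ^ 4" using C q by force
    finally show "norm (numerical_flux \<phi> (2 * h) (vt (2 * h)) (PA (2 * h)) (PB (2 * h)) i r - simpson_flux \<gamma> U \<phi> (2 * h) i r) \<le> C * h ^ 4" .
  qed
  then show "\<exists>C. \<forall>\<^sub>F h in at_right 0. \<forall>i. \<forall>r<4. vertex \<phi> (2 * h) i r \<in> K \<longrightarrow>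
    norm (numerical_flux \<phi> (2 * h) (vt (2 * h)) (PA (2 * h)) (PB (2 * h)) i r - simpson_flux \<gamma> U \<phi> (2 * h) i r) \<le> C * h ^ 4" ..
qed

section \<open>Comparison of the Simpson flux with the exact flux\<close>

text \<open>For a fixed normal the flux is linear in the triple of velocity, pressure and their
  product. Simpson's error can thus be estimated once for this smooth triple, independently of the
  edge and its normal.\<close>

definition normal_flux :: "real^2 \<Rightarrow> (real^2) \<times> real \<times> (real^2) \<Rightarrow> flux" where
  "normal_flux n z = (- (fst z \<bullet> n), fst (snd z) *\<^sub>R n, snd (snd z) \<bullet> n)"

lemma bounded_linear_normal_flux: "bounded_linear (normal_flux n)"
  unfolding normal_flux_def[abs_def]
  by (intro bounded_linear_Pair bounded_linear_minus
      bounded_linear_compose[OF bounded_linear_inner_left] bounded_linear_compose[OF bounded_linear_scaleR_left]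
      bounded_linear_fst bounded_linear_snd bounded_linear_compose[OF bounded_linear_fst] bounded_linear_compose[OF bounded_linear_snd])

lemma norm_normal_flux: "norm n \<le> 1 \<Longrightarrow> norm (normal_flux n z) \<le> 3 * norm z"
proof -
  assume n: "norm n \<le> 1"
  have "\<bar>x \<bullet> n\<bar> \<le> norm x" for x
    using Cauchy_Schwarz_ineq2[of x n] mult_left_mono[OF n norm_ge_zero[of x]] by simp
  moreover have "\<bar>c\<bar> * norm n \<le> \<bar>c\<bar>" for c
    using mult_left_mono[OF n abs_ge_zero[of c]] by simp
  ultimately have "norm (normal_flux n z) \<le> norm (fst z) + (norm (fst (snd z)) + norm (snd (snd z)))"
    unfolding normal_flux_def
    by (intro order_trans[OF norm_Pair_le] add_mono) auto
  also have "\<dots> \<le> 3 * norm z"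
    using norm_fst_le[of "fst z" "snd z"] norm_snd_le[of "snd z" "fst z"]
      norm_fst_le[of "fst (snd z)" "snd (snd z)"] norm_snd_le[of "snd (snd z)" "fst (snd z)"] by simp
  finally show ?thesis .
qed

text \<open>The Simpson error is bounded by the fourth power of the edge length, which is
  \<open>h\<close> times the length of \<open>nrm\<close> and hence at most \<open>h * M\<close> on
  the ball. The factor 3 counts the components of the flux.\<close>

lemma simpson_flux_order:
  "edge_error_order 4 \<phi> (\<lambda>h i r. simpson_flux \<gamma> U \<phi> h i r - exact_flux \<gamma> U \<phi> h i r)"
proof (rule edge_error_order_halfI)
  fix K :: "(real^2) set" assume "compact K"
  then obtain R where "R > 0" and R: "\<forall>\<^sub>F h in at_right 0. \<forall>i. \<forall>r<4. vertex \<phi> (2 * h) i r \<in> K \<longrightarrow> h > 0 \<and>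
    (\<exists>u\<in>dirs. \<exists>q\<in>cball 0 R. vertex \<phi> (2 * h) i r = \<phi> (q - h *\<^sub>R u) \<and> vertex \<phi> (2 * h) i (Suc r) = \<phi> (q + h *\<^sub>R u) \<and>
      q - h *\<^sub>R u \<in> cball 0 R \<and> q + h *\<^sub>R u \<in> cball 0 R \<and>
      regular h (q - h *\<^sub>R u) \<and> regular h (q + h *\<^sub>R u))"
    using edges_near_compact by blast
  define F where "F x = (velocity (U x), pressure \<gamma> (U x), pressure \<gamma> (U x) *\<^sub>R velocity (U x))" for x
  have F: "smooth F"
    unfolding F_def by (intro smooth_Pair smooth_scaleR smooth_v smooth_P)
  obtain B where B: "\<And>p. p \<in> cball 0 R \<Longrightarrow> \<phi> p \<in> cball 0 B"
    using smooth_bounded_on[OF smooth_map compact_cball, of 0 R] by (metis mem_cball_0)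
  obtain C where C: "C \<ge> 0" "\<forall>a\<in>cball 0 B. \<forall>b\<in>cball 0 B.
    norm ((1/6) *\<^sub>R F a + (2/3) *\<^sub>R F (midpoint a b) + (1/6) *\<^sub>R F b - integral {0..1} (\<lambda>t. F (linepath a b t)))
      \<le> C * dist a b ^ 4"
    using simpson_error[OF F] by blast
  have "Oh 0 (\<lambda>h q. \<Sum>u\<in>dirs. norm (nrm u h q))"
    by (intro Oh_sum Oh_norm second_order_Oh[OF second_order_nrm]) simp
  then obtain M where M: "M \<ge> 0" "\<forall>\<^sub>F h in at_right 0. \<forall>q\<in>cball 0 R. norm (\<Sum>u\<in>dirs. norm (nrm u h q)) \<le> M * h ^ 0"
    using OhE by blast
  have "\<forall>\<^sub>F h in at_right 0. \<forall>i. \<forall>r<4. vertex \<phi> (2 * h) i r \<in> K \<longrightarrow>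
    norm (simpson_flux \<gamma> U \<phi> (2 * h) i r - exact_flux \<gamma> U \<phi> (2 * h) i r) \<le> (3 * C * M ^ 4) * h ^ 4"
    using M(2) R
  proof (eventually_elim, intro allI impI)
    fix h :: real and i :: cell and r :: nat
    assume M2: "\<forall>q\<in>cball 0 R. norm (\<Sum>u\<in>dirs. norm (nrm u h q)) \<le> M * h ^ 0"
      and R: "\<forall>i. \<forall>r<4. vertex \<phi> (2 * h) i r \<in> K \<longrightarrow> h > 0 \<and>
    (\<exists>u\<in>dirs. \<exists>q\<in>cball 0 R. vertex \<phi> (2 * h) i r = \<phi> (q - h *\<^sub>R u) \<and> vertex \<phi> (2 * h) i (Suc r) = \<phi> (q + h *\<^sub>R u) \<and>
      q - h *\<^sub>R u \<in> cball 0 R \<and> q + h *\<^sub>R u \<in> cball 0 R \<and>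
      regular h (q - h *\<^sub>R u) \<and> regular h (q + h *\<^sub>R u))" and r: "r < 4" and K: "vertex \<phi> (2 * h) i r \<in> K"
    then obtain u q where u: "u \<in> dirs" and q: "q \<in> cball 0 R" "q - h *\<^sub>R u \<in> cball 0 R" "q + h *\<^sub>R u \<in> cball 0 R" and h: "h > 0"
      and v: "vertex \<phi> (2 * h) i r = \<phi> (q - h *\<^sub>R u)" "vertex \<phi> (2 * h) i (Suc r) = \<phi> (q + h *\<^sub>R u)"
      by blast
    define a b n where "a = \<phi> (q - h *\<^sub>R u)" and "b = \<phi> (q + h *\<^sub>R u)" and "n = edge_normal \<phi> (2 * h) i r"
    have "n = unit_nrm u h q"
      unfolding n_def edge_normal_def v by (rule right_normal_edge(1)[OF h])
    then have n1: "norm n \<le> 1" by (cases "nrm u h q = 0") (simp_all add: unit_nrm_def)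
    interpret L: bounded_linear "normal_flux n" by (rule bounded_linear_normal_flux)
    have "norm (nrm u h q) \<le> (\<Sum>u\<in>dirs. norm (nrm u h q))"
      by (rule member_le_sum[OF u]) simp_all
    also have "\<dots> \<le> M" using M2 q(1) by force
    finally have "h * norm (nrm u h q) \<le> h * M" using h by (intro mult_left_mono) auto
    then have ab: "dist a b ^ 4 \<le> (h * M) ^ 4"
      unfolding a_def b_def dist_edge[OF h] using h by (intro power_mono) auto
    have s: "simpson_flux \<gamma> U \<phi> (2 * h) i r = normal_flux n ((1/6) *\<^sub>R F a + (2/3) *\<^sub>R F (midpoint a b) + (1/6) *\<^sub>R F b)"
      unfolding simpson_flux_def Let_def v a_def[symmetric] b_def[symmetric] n_def[symmetric]
      by (simp add: normal_flux_def F_def inner_add_left)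
    have "(\<lambda>t. F (linepath a b t)) integrable_on {0..1}"
      unfolding linepath_def
      by (intro integrable_continuous_interval continuous_on_compose2[OF smooth_continuous_on[OF F, of UNIV]] continuous_intros) auto
    from integral_linear[OF this bounded_linear_normal_flux]
    have e: "exact_flux \<gamma> U \<phi> (2 * h) i r = normal_flux n (integral {0..1} (\<lambda>t. F (linepath a b t)))"
      unfolding exact_flux_def Let_def v a_def[symmetric] b_def[symmetric] n_def[symmetric]
      by (simp add: normal_flux_def F_def o_def)
    have "norm (simpson_flux \<gamma> U \<phi> (2 * h) i r - exact_flux \<gamma> U \<phi> (2 * h) i r) \<le> 3 * (C * dist a b ^ 4)"
      unfolding s e L.diff[symmetric]
      by (rule order_trans[OF norm_normal_flux[OF n1]]) (use C(2) B q in \<open>auto simp: a_def b_def\<close>)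
    also have "\<dots> \<le> 3 * (C * (h * M) ^ 4)" using ab C(1) by (intro mult_left_mono) auto
    finally show "norm (simpson_flux \<gamma> U \<phi> (2 * h) i r - exact_flux \<gamma> U \<phi> (2 * h) i r) \<le> (3 * C * M ^ 4) * h ^ 4"
      by (simp add: power_mult_distrib mult_ac)
  qed
  then show "\<exists>C. \<forall>\<^sub>F h in at_right 0. \<forall>i. \<forall>r<4. vertex \<phi> (2 * h) i r \<in> K \<longrightarrow>
    norm (simpson_flux \<gamma> U \<phi> (2 * h) i r - exact_flux \<gamma> U \<phi> (2 * h) i r) \<le> C * h ^ 4" ..
qed

end

theorem theorem2:
  fixes \<gamma> :: real
    and U :: "real^2 \<Rightarrow> state"
    and \<phi> \<psi> :: "real^2 \<Rightarrow> real^2"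
    and vt :: "real \<Rightarrow> real^2 \<Rightarrow> real^2"
    and PA PB :: "real \<Rightarrow> cell \<Rightarrow> nat \<Rightarrow> real"
  assumes "\<gamma> > 1"
    and "smooth U" and "physical_field \<gamma> U"
    and "homeomorphism UNIV UNIV \<phi> \<psi>" and "smooth \<phi>" and "smooth \<psi>"
    and "\<And>h. h > 0 \<Longrightarrow> jump_condition \<gamma> U \<phi> h (vt h) (PA h) (PB h)"
    and "\<And>h. h > 0 \<Longrightarrow> balance_condition \<phi> h (PA h) (PB h)"
  shows "edge_error_order 4 \<phi>
           (\<lambda>h i r. numerical_flux \<phi> h (vt h) (PA h) (PB h) i r - simpson_flux \<gamma> U \<phi> h i r)
       \<and> edge_error_order 4 \<phi>
           (\<lambda>h i r. simpson_flux \<gamma> U \<phi> h i r - exact_flux \<gamma> U \<phi> h i r)"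
proof -
  interpret gas_scheme \<phi> \<psi> \<gamma> U vt PA PB
    by unfold_locales (use assms in \<open>auto simp: homeomorphism_def\<close>)
  show ?thesis using numerical_flux_order simpson_flux_order by blast
qed

end
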